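(* Let $D$ be an $m\times n$ array of square cells (pixels), with $m$ columns and $n$ rows, and let $\mathcal T=\{l_1,\dots,l_{m+n-2}\}$ be the corresponding regular linear tessellation, indexed so that for $i=1,\dots,n-1$, $l_i$ is the horizontal line between the $i$-th and $(i+1)$-st row, and for $i=1,\dots,m-1$, $l_{n+i-1}$ is the vertical line between the $i$-th and $(i+1)$-st column. Let $\pi_l\in(0,1)$ be activities, $k\ge2$ the number of colours, $\alpha_V\in[0,1]$, and $\hat{\mathcal A}_{\Phi_D}$ the consistent polygonal field in $D$. Then $\hat{\mathcal A}_{\Phi_D}$ is the dual of a random vector $X=(X_1,\dots,X_{mn})$ of pixel values, indexed in column major order, whose joint probability mass function $\mathbb P(X_1=x_1;\dots;X_{mn}=x_{mn})$ (which equals $\mathbb P(\hat{\mathcal A}_{\Phi_D}=\hat\gamma)$ for the configuration $\hat\gamma$ dual to $(x_1,\dots,x_{mn})$) factorises as $$\mathbb P(X_1=x_1)\prod_{i=2}^n\mathbb P(X_i=x_i\mid X_{i-1}=x_{i-1})\prod_{i=1}^{m-1}\mathbb P(X_{in+1}=x_{in+1}\mid X_{(i-1)n+1}=x_{(i-1)n+1})$$ $$\times\prod_{i=1}^{m-1}\prod_{j=2}^n\mathbb P\bigl(X_{in+j}=x_{in+j}\mid X_{(i-1)n+j-1}=x_{(i-1)n+j-1};\ X_{(i-1)n+j}=x_{(i-1)n+j};\ X_{in+j-1}=x_{in+j-1}\bigr)$$ for all $x_i\in\{1,\dots,k\}$, $i=1,\dots,mn$.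
   Context: Setting: $D$ is an open rectangle and the lines of $\mathcal T$ form a regular lattice dividing $D$ into $mn$ square cells (pixels). Nodes are the intersection points $n(l_1,l_2)$ of two lines of $\mathcal T$; segments are the pieces of lines of $\mathcal T$ between consecutive nodes (possibly truncated by $\partial D$). Column major order: the pixel in column $i+1$ and row $j$ has index $in+j$ ($0\le i\le m-1$, $1\le j\le n$). Admissible configurations and duality: assigning each cell a colour in $\{1,\dots,k\}$ gives a coloured planar graph $\hat\gamma$ in $\overline D$, whose underlying uncoloured graph $\gamma$ consists of all segments separating cells of different colours. The set of admissible coloured polygonal configurations $\hat\Gamma_D(\mathcal T)$ (coloured planar graphs with edges on lines of $\mathcal T$, interior vertices of degree 2, 3 or 4, boundary vertices of degree 1, and no two adjacent faces of equal colour) is thereby in bijection with the arrays of pixel colours; the array corresponding to $\hat\gamma$ (the colour of a pixel being that of the face of $\hat\gamma$ containing it) is called its dual. Notation: a node lying inside a straight piece of $\gamma$ at which no other segment of $\gamma$ ends or passes is not a vertex. V-, T- and X-vertices are the interior vertices of degree 2, 3 and 4, and $N_V(\gamma),N_T(\gamma),N_X(\gamma)$ are their numbers. $E(\gamma)$ is the set of edges: maximal unions of connected collinear segments of $\gamma$ not broken by a vertex; edges are taken open. $E^*(\gamma)$ is the set of primary edges: maximal unions of connected collinear segments of $\gamma$ (possibly containing several edges because of T- or X-vertices). $l[e]$ is the line of $\mathcal T$ containing $e$. Consistent polygonal field: given $\alpha_V\in[0,1]$ put $\alpha_X=1-\alpha_V$, $\alpha_T=\frac12\bigl(1-\frac{k-2}{k-1}\alpha_X\bigr)$,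 $\epsilon=\frac{\alpha_V}{k-1}+\frac{k-2}{k-1}\alpha_T$, and $$\Phi_D(\hat\gamma)=-N_V(\gamma)\log\alpha_V-N_T(\gamma)\log((k-1)\alpha_T)-N_X(\gamma)\log((k-1)\alpha_X)+\mathrm{card}(E(\gamma))\log(k-1)$$ $$-\sum_{e\in E(\gamma)}\ \sum_{l\in\mathcal T,\,l\nsim e}\log(1-\epsilon\pi_l)+\sum_{n(l_1,l_2)\in\gamma}\log\Bigl(1-\frac{\alpha_V}{k-1}\pi_{l_1}\pi_{l_2}\Bigr),$$ with $0\times\infty=0$. Here $l\nsim e$ means that $l$ intersects the open edge $e$ but is not collinear with it, and $n(l_1,l_2)\in\gamma$ ranges over nodes lying on edges of $\gamma$ or coinciding with vertices of $\gamma$. The consistent polygonal field $\hat{\mathcal A}_{\Phi_D}$ is the random element of $\hat\Gamma_D(\mathcal T)$ with $\mathbb P(\hat{\mathcal A}_{\Phi_D}=\hat\gamma)\propto e^{-\Phi_D(\hat\gamma)}\prod_{e\in E^*(\gamma)}\pi_{l[e]}$. *)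

theory Defs
  imports "HOL-Probability.Probability"
begin

section \<open>The pixel grid and its tessellation\<close>

text \<open>
  The domain is normalised to unit pixels: $D = (0,m) \times (0,n)$, first coordinate across the
  columns, second coordinate down the rows. Lines of the tessellation are represented by their
  indices \<open>1, ..., m + n - 2\<close>; \<open>line n l\<close> is the point set of line number \<open>l\<close>.
\<close>

type_synonym point = "real \<times> real"

definition domain :: "nat \<Rightarrow> nat \<Rightarrow> point set" where
  "domain m n = {0<..<real m} \<times> {0<..<real n}"

definition lines :: "nat \<Rightarrow> nat \<Rightarrow> nat set" where
  "lines m n = {1..m + n - 2}"

definition line :: "nat \<Rightarrow> nat \<Rightarrow> point set" where
  "line n l = (if l < n then {(x, y). y = real l} else {(x, y). x = real (l + 1 - n)})"

definition nodes :: "nat \<Rightarrow> nat \<Rightarrow> point set" where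
  "nodes m n = {p. \<exists>l\<in>lines m n. \<exists>l'\<in>lines m n. l \<noteq> l' \<and> p \<in> line n l \<inter> line n l'}"

text \<open>
  Segments are closed, hence contain the nodes and the points of the frontier at which they end.
\<close>

definition segments :: "nat \<Rightarrow> nat \<Rightarrow> point set set" where
  "segments m n =
     {closed_segment (real a, real b) (real (a + 1), real b) |a b. a < m \<and> b \<in> {1..<n}} \<union>
     {closed_segment (real a, real b) (real a, real (b + 1)) |a b. a \<in> {1..<m} \<and> b < n}"

text \<open>The (open) pixel with column major index \<open>q\<close>, \<open>1 \<le> q \<le> m * n\<close>.\<close>

definition pixel :: "nat \<Rightarrow> nat \<Rightarrow> point set" where
  "pixel n q = (let c = (q - 1) div n; r = (q - 1) mod n in
     {real c<..<real (c + 1)} \<times> {real r<..<real (r + 1)})"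


section \<open>Planar graphs with edges on the lines of the tessellation\<close>

text \<open>
  A graph is given by the set of the segments of which it consists; its support is the union of
  that set. Since a node or frontier point in a segment is one of its end points,
  \<open>degree\<close> is the usual vertex degree there.
\<close>

type_synonym graph = "point set set"

definition degree :: "graph \<Rightarrow> point \<Rightarrow> nat" where
  "degree \<gamma> p = card {s \<in> \<gamma>. p \<in> s}"

definition straight :: "nat \<Rightarrow> nat \<Rightarrow> graph \<Rightarrow> point \<Rightarrow> bool" where
  "straight m n \<gamma> p \<longleftrightarrow>
     degree \<gamma> p = 2 \<and> (\<exists>l\<in>lines m n. \<forall>s\<in>\<gamma>. p \<in> s \<longrightarrow> s \<subseteq> line n l)"

definition interior_vertices :: "nat \<Rightarrow> nat \<Rightarrow> graph \<Rightarrow> point set" where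
  "interior_vertices m n \<gamma> = {p \<in> nodes m n \<inter> \<Union>\<gamma>. \<not> straight m n \<gamma> p}"

definition boundary_vertices :: "nat \<Rightarrow> nat \<Rightarrow> graph \<Rightarrow> point set" where
  "boundary_vertices m n \<gamma> = frontier (domain m n) \<inter> \<Union>\<gamma>"

definition vertices :: "nat \<Rightarrow> nat \<Rightarrow> graph \<Rightarrow> point set" where
  "vertices m n \<gamma> = interior_vertices m n \<gamma> \<union> boundary_vertices m n \<gamma>"

definition V_vertices :: "nat \<Rightarrow> nat \<Rightarrow> graph \<Rightarrow> point set" where
  "V_vertices m n \<gamma> = {p \<in> interior_vertices m n \<gamma>. degree \<gamma> p = 2}"

definition T_vertices :: "nat \<Rightarrow> nat \<Rightarrow> graph \<Rightarrow> point set" where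
  "T_vertices m n \<gamma> = {p \<in> interior_vertices m n \<gamma>. degree \<gamma> p = 3}"

definition X_vertices :: "nat \<Rightarrow> nat \<Rightarrow> graph \<Rightarrow> point set" where
  "X_vertices m n \<gamma> = {p \<in> interior_vertices m n \<gamma>. degree \<gamma> p = 4}"

text \<open>
  Edges and primary edges are maximal connected pieces of the part of the graph running along a
  line. Segments of the graph crossing the line transversally are not part of that piece.
  Removing the vertices both breaks the edges there and makes them open.
\<close>

definition on_line :: "nat \<Rightarrow> graph \<Rightarrow> nat \<Rightarrow> point set" where
  "on_line n \<gamma> l = \<Union>{s \<in> \<gamma>. s \<subseteq> line n l}"

definition edges :: "nat \<Rightarrow> nat \<Rightarrow> graph \<Rightarrow> point set set" where
  "edges m n \<gamma> = (\<Union>l\<in>lines m n. components (on_line n \<gamma> l - vertices m n \<gamma>))"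

definition primary_edges :: "nat \<Rightarrow> nat \<Rightarrow> graph \<Rightarrow> point set set" where
  "primary_edges m n \<gamma> = (\<Union>l\<in>lines m n. components (on_line n \<gamma> l))"

definition line_of :: "nat \<Rightarrow> nat \<Rightarrow> point set \<Rightarrow> nat" where
  "line_of m n e = (THE l. l \<in> lines m n \<and> e \<subseteq> line n l)"

definition crosses :: "nat \<Rightarrow> nat \<Rightarrow> point set \<Rightarrow> bool" where
  "crosses n l e \<longleftrightarrow> line n l \<inter> e \<noteq> {} \<and> \<not> e \<subseteq> line n l"


section \<open>Coloured graphs and duality\<close>

definition faces :: "nat \<Rightarrow> nat \<Rightarrow> graph \<Rightarrow> point set set" where
  "faces m n \<gamma> = components (domain m n - \<Union>\<gamma>)"

text \<open>
  Two faces are adjacent if they lie on the two sides of a segment of the graph. A face lying on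
  both sides of the same segment is adjacent to itself, and so cannot be coloured.
\<close>

definition adjacent :: "nat \<Rightarrow> nat \<Rightarrow> graph \<Rightarrow> point set \<Rightarrow> point set \<Rightarrow> bool" where
  "adjacent m n \<gamma> F G \<longleftrightarrow> F \<in> faces m n \<gamma> \<and> G \<in> faces m n \<gamma> \<and>
     (\<exists>s\<in>\<gamma>. \<exists>p\<in>{1..m * n}. \<exists>q\<in>{1..m * n}. p \<noteq> q \<and>
        s \<subseteq> closure (pixel n p) \<inter> closure (pixel n q) \<and> pixel n p \<subseteq> F \<and> pixel n q \<subseteq> G)"

type_synonym coloured_graph = "graph \<times> (point set \<Rightarrow> nat)"

definition admissible :: "nat \<Rightarrow> nat \<Rightarrow> nat \<Rightarrow> coloured_graph set" where
  "admissible m n k = {(\<gamma>, \<phi>).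
     \<gamma> \<subseteq> segments m n \<and>
     (\<forall>p\<in>interior_vertices m n \<gamma>. degree \<gamma> p \<in> {2, 3, 4}) \<and>
     (\<forall>p\<in>boundary_vertices m n \<gamma>. degree \<gamma> p = 1) \<and>
     \<phi> \<in> faces m n \<gamma> \<rightarrow>\<^sub>E {1..k} \<and>
     (\<forall>F G. adjacent m n \<gamma> F G \<longrightarrow> \<phi> F \<noteq> \<phi> G)}"

definition arrays :: "nat \<Rightarrow> nat \<Rightarrow> nat \<Rightarrow> (nat \<Rightarrow> nat) set" where
  "arrays m n k = {1..m * n} \<rightarrow>\<^sub>E {1..k}"

definition dual :: "nat \<Rightarrow> nat \<Rightarrow> coloured_graph \<Rightarrow> nat \<Rightarrow> nat" where
  "dual m n = (\<lambda>(\<gamma>, \<phi>). \<lambda>q\<in>{1..m * n}. \<phi> (THE F. F \<in> faces m n \<gamma> \<and> pixel n q \<subseteq> F))"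


section \<open>The consistent polygonal field\<close>

text \<open>
  The logarithm and the exponential take values in, respectively arguments from, the extended
  reals. Together with \<open>0 * \<infinity> = 0\<close> on \<^typ>\<open>ereal\<close> this gives potential \<open>\<infinity>\<close>, hence probability
  zero, exactly to configurations with a vertex of a type whose parameter vanishes. For admissible
  parameter values the arguments of \<open>elog\<close> are nonnegative and the potential is never \<open>- \<infinity>\<close>.
\<close>

definition elog :: "real \<Rightarrow> ereal" where
  "elog x = (if x = 0 then - \<infinity> else ereal (ln x))"

definition exp_minus :: "ereal \<Rightarrow> real" where
  "exp_minus t = (if t = \<infinity> then 0 else exp (- real_of_ereal t))"

definition alpha_X :: "real \<Rightarrow> real" where
  "alpha_X \<alpha>\<^sub>V = 1 - \<alpha>\<^sub>V"

definition alpha_T :: "nat \<Rightarrow> real \<Rightarrow> real" where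
  "alpha_T k \<alpha>\<^sub>V = 1/2 * (1 - (real k - 2) / (real k - 1) * alpha_X \<alpha>\<^sub>V)"

definition epsilon :: "nat \<Rightarrow> real \<Rightarrow> real" where
  "epsilon k \<alpha>\<^sub>V = \<alpha>\<^sub>V / (real k - 1) + (real k - 2) / (real k - 1) * alpha_T k \<alpha>\<^sub>V"

text \<open>The last sum runs over the nodes $n(l_1,l_2)$ in the graph, each counted once.\<close>

definition potential :: "nat \<Rightarrow> nat \<Rightarrow> nat \<Rightarrow> (nat \<Rightarrow> real) \<Rightarrow> real \<Rightarrow> graph \<Rightarrow> ereal" where
  "potential m n k \<pi> \<alpha>\<^sub>V \<gamma> =
     - (ereal (real (card (V_vertices m n \<gamma>))) * elog \<alpha>\<^sub>V)
     - ereal (real (card (T_vertices m n \<gamma>))) * elog ((real k - 1) * alpha_T k \<alpha>\<^sub>V)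
     - ereal (real (card (X_vertices m n \<gamma>))) * elog ((real k - 1) * alpha_X \<alpha>\<^sub>V)
     + ereal (real (card (edges m n \<gamma>))) * elog (real k - 1)
     - (\<Sum>e\<in>edges m n \<gamma>. \<Sum>l\<in>{l \<in> lines m n. crosses n l e}. elog (1 - epsilon k \<alpha>\<^sub>V * \<pi> l))
     + (\<Sum>(l1, l2)\<in>{(l1, l2). l1 \<in> lines m n \<and> l2 \<in> lines m n \<and> l1 < l2 \<and>
                              line n l1 \<inter> line n l2 \<inter> \<Union>\<gamma> \<noteq> {}}.
          elog (1 - \<alpha>\<^sub>V / (real k - 1) * \<pi> l1 * \<pi> l2))"

definition weight :: "nat \<Rightarrow> nat \<Rightarrow> nat \<Rightarrow> (nat \<Rightarrow> real) \<Rightarrow> real \<Rightarrow> coloured_graph \<Rightarrow> real" where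
  "weight m n k \<pi> \<alpha>\<^sub>V = (\<lambda>(\<gamma>, \<phi>).
     exp_minus (potential m n k \<pi> \<alpha>\<^sub>V \<gamma>) * (\<Prod>e\<in>primary_edges m n \<gamma>. \<pi> (line_of m n e)))"

definition consistent_polygonal_field ::
    "nat \<Rightarrow> nat \<Rightarrow> nat \<Rightarrow> (nat \<Rightarrow> real) \<Rightarrow> real \<Rightarrow> 'w measure \<Rightarrow> ('w \<Rightarrow> coloured_graph) \<Rightarrow> bool" where
  "consistent_polygonal_field m n k \<pi> \<alpha>\<^sub>V M A \<longleftrightarrow>
     prob_space M \<and> A \<in> measurable M (count_space (admissible m n k)) \<and>
     (\<forall>g\<in>admissible m n k. \<P>(\<omega> in M. A \<omega> = g) =
        weight m n k \<pi> \<alpha>\<^sub>V g / (\<Sum>h\<in>admissible m n k. weight m n k \<pi> \<alpha>\<^sub>V h))"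

end

theory Submission
  imports Defs
begin

text \<open>
  Charge every edge and every primary edge of the graph to its left or upper end point. The weight of
  a configuration then becomes a product of one factor per pixel: a factor for every node, depending
  on the colours of the four pixels around it, and a factor for every segment starting at the left or
  upper side of the domain. The parameters are chosen so that the sum of a node factor over the colour
  of the lower right pixel is \<open>1 / (1 - \<alpha>\<^sub>V / (k - 1) * \<pi> l * \<pi> l')\<close>, whatever the colours of the three
  other pixels. So the normalised factors are transition probabilities of a process that colours the
  pixels in column major order, and each of them is the conditional probability of the colour of a
  pixel given its three neighbours above and to the left.
\<close>

section \<open>Random fields with sequential kernels\<close>

text \<open>The constants of the field can be read off from the sum over the lower right colour. If
  the three given colours agree, the sum fixes the term \<open>\<alpha>\<^sub>V / (k - 1)\<close> in
  the node normaliser. If the upper left colour agrees with exactly one of the other two, it fixes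
  \<open>epsilon\<close>. If only the two colours on the diagonal agree, it fixes
  \<open>alpha_X\<close>. If all three differ, it fixes \<open>alpha_T\<close>. The sequential
  process colours a pixel given all earlier pixels, whereas the factorisation conditions on at most
  three of them. This is harmless: later pixels sum out to constants, and on the conditioning event
  the kernel of the pixel is a constant that leaves the sum over the earlier pixels. Two obstacles
  remain. Edges are connected components in the plane, so counting them needs a passage to unions of
  unit intervals on the real line. And for \<open>\<alpha>\<^sub>V\<close> equal to 0 or 1 some
  vertex types have weight zero, so it has to be shown that every choice of the conditioning colours
  still has positive probability.\<close>

locale sequential_field =
  fixes N k :: nat and par :: "nat \<Rightarrow> nat set" and \<kappa> :: "nat \<Rightarrow> (nat \<Rightarrow> nat) \<Rightarrow> real"
    and C :: "nat \<Rightarrow> real"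
  assumes par_less: "q \<in> {1..N} \<Longrightarrow> par q \<subseteq> {1..<q}"
    and kernel_cong: "q \<in> {1..N} \<Longrightarrow> (\<And>i. i \<in> insert q (par q) \<Longrightarrow> y i = z i) \<Longrightarrow> \<kappa> q y = \<kappa> q z"
    and kernel_sum: "q \<in> {1..N} \<Longrightarrow> (\<And>i. i \<in> par q \<Longrightarrow> y i \<in> {1..k}) \<Longrightarrow>
           (\<Sum>s\<in>{1..k}. \<kappa> q (y(q := s))) = C q"
    and C_pos: "q \<in> {1..N} \<Longrightarrow> C q > 0"
begin

definition prefixes :: "nat \<Rightarrow> (nat \<Rightarrow> nat) set" where
  "prefixes q = {1..q} \<rightarrow>\<^sub>E {1..k}"

definition prefix_weight :: "nat \<Rightarrow> (nat \<Rightarrow> nat) \<Rightarrow> real" where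
  "prefix_weight q y = (\<Prod>i\<in>{1..q}. \<kappa> i y)"

text \<open>An unnormalised measure: probabilities are quotients by
  \<open>mass (\<lambda>_. True)\<close>, a constant that cancels in conditional probabilities.
  \<open>Q\<close> is a predicate on all functions, so that it can also be evaluated on
  prefixes.\<close>

definition mass :: "((nat \<Rightarrow> nat) \<Rightarrow> bool) \<Rightarrow> real" where
  "mass Q = (\<Sum>y\<in>prefixes N. of_bool (Q y) * prefix_weight N y)"

lemma finite_prefixes: "finite (prefixes q)"
  by (simp add: prefixes_def finite_PiE)

lemma sum_prefixes_Suc:
  "(\<Sum>y\<in>prefixes (Suc q). F y) = (\<Sum>z\<in>prefixes q. \<Sum>s\<in>{1..k}. F (z(Suc q := s)))"
proof -
  have *: "prefixes (Suc q) = (\<lambda>(y, g). g(Suc q := y)) ` ({1..k} \<times> prefixes q)"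
    by (simp add: prefixes_def atLeastAtMostSuc_conv PiE_insert_eq)
  have inj: "inj_on (\<lambda>(y, g). g(Suc q := y)) ({1..k} \<times> prefixes q)"
    unfolding prefixes_def by (rule inj_combinator) auto
  show ?thesis
    unfolding * sum.reindex[OF inj]
    by (subst sum.swap) (simp add: sum.cartesian_product case_prod_unfold)
qed

text \<open>Parents precede their child, so no kernel up to \<open>q\<close> reads the colour at
  \<open>Suc q\<close>.\<close>

lemma prefix_weight_upd:
  assumes "Suc q \<le> N"
  shows "prefix_weight (Suc q) (z(Suc q := s)) = prefix_weight q z * \<kappa> (Suc q) (z(Suc q := s))"
proof -
  have "\<kappa> i (z(Suc q := s)) = \<kappa> i z" if "i \<in> {1..q}" for i
    using that assms par_less[of i] by (intro kernel_cong) fastforce+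
  then show ?thesis
    by (simp add: prefix_weight_def)
qed

lemma sum_prefix_weight_Suc:
  assumes q: "Suc q \<le> N" and Q: "\<And>y s. Q (y(Suc q := s)) = Q y"
  shows "(\<Sum>y\<in>prefixes (Suc q). of_bool (Q y) * prefix_weight (Suc q) y) =
         C (Suc q) * (\<Sum>y\<in>prefixes q. of_bool (Q y) * prefix_weight q y)"
proof -
  have "(\<Sum>s\<in>{1..k}. \<kappa> (Suc q) (z(Suc q := s))) = C (Suc q)" if "z \<in> prefixes q" for z
    using that q par_less[of "Suc q"] by (intro kernel_sum) (fastforce simp: prefixes_def)+
  then show ?thesis
    unfolding sum_prefixes_Suc Q prefix_weight_upd[OF q] sum_distrib_left
    by (intro sum.cong refl) (simp add: sum_distrib_left[symmetric])
qed

text \<open>Colours that \<open>Q\<close> does not look at are summed out from the last pixel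
  backwards. Each sum contributes the factor \<open>C i\<close> because it does not depend on the
  remaining colours.\<close>

lemma mass_prefix:
  assumes "q \<le> N" and "\<And>y i s. i \<in> {q<..N} \<Longrightarrow> Q (y(i := s)) = Q y"
  shows "mass Q = (\<Prod>i\<in>{q<..N}. C i) * (\<Sum>y\<in>prefixes q. of_bool (Q y) * prefix_weight q y)"
  using assms
proof (induction q rule: inc_induct)
  case base
  then show ?case by (simp add: mass_def)
next
  case (step p)
  have "{p<..N} = insert (Suc p) {Suc p<..N}"
    using step.hyps by auto
  moreover have "Q (y(Suc p := s)) = Q y" for y s
    using step.hyps by (intro step.prems) simp
  ultimately show ?case
    using step.hyps step.IH sum_prefix_weight_Suc[of p Q] step.prems
    by (simp add: mult_ac del: fun_upd_apply)
qed

lemma mass_True: "mass (\<lambda>_. True) = (\<Prod>i\<in>{1..N}. C i)"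
  using mass_prefix[of 0 "\<lambda>_. True"] atLeastSucAtMost_greaterThanAtMost[of 0 N]
  by (simp add: prefixes_def prefix_weight_def)

lemma mass_single:
  assumes "x \<in> prefixes N"
  shows "mass (\<lambda>y. \<forall>i\<in>{1..N}. y i = x i) = prefix_weight N x"
proof -
  have "(\<forall>i\<in>{1..N}. y i = x i) \<longleftrightarrow> y = x" if "y \<in> prefixes N" for y
    using that assms unfolding prefixes_def by (metis PiE_ext)
  then show ?thesis
    using assms finite_prefixes
    by (simp add: mass_def of_bool_def if_distrib[of "\<lambda>u. u * _"] if_distribR sum.delta' cong: sum.cong if_cong)
qed

text \<open>This is the Markov property with the denominators cleared: the conditional probability
  of the colour at \<open>q\<close> given its parents is \<open>\<kappa> q x / C q\<close>. In
  product form it holds even if the conditioning event has mass 0. Both events concern only pixels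
  up to \<open>q\<close>, so \<open>mass_prefix\<close> reduces both sides to the same sum over
  prefixes of length \<open>q - 1\<close>.\<close>

lemma mass_kernel:
  assumes q: "q \<in> {1..N}" and x: "x q \<in> {1..k}"
  shows "mass (\<lambda>y. y q = x q \<and> (\<forall>i\<in>par q. y i = x i)) * C q =
         \<kappa> q x * mass (\<lambda>y. \<forall>i\<in>par q. y i = x i)"
proof -
  define p where "p = q - 1"
  then have p: "q = Suc p" "Suc p \<le> N" "p \<le> N"
    using q by auto
  define Q where "Q = (\<lambda>y. \<forall>i\<in>par q. y i = x i)"
  have Q: "Q (y(i := s)) = Q y" if "i \<ge> q" for y i s
    using that par_less[OF q] by (force simp: Q_def)
  \<comment> \<open>Only \<open>s = x q\<close> survives. Where \<open>Q z\<close> holds, the kernel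
    then sees the colours of \<open>x\<close> at \<open>q\<close> and its parents, so its value
    \<open>\<kappa> q x\<close> no longer depends on the prefix \<open>z\<close>.\<close>
  have sel: "(\<Sum>s\<in>{1..k}. of_bool (s = x q \<and> Q z) * (prefix_weight p z * \<kappa> q (z(q := s)))) =
      of_bool (Q z) * prefix_weight p z * \<kappa> q x" for z
  proof -
    have "(\<Sum>s\<in>{1..k}. of_bool (s = x q \<and> Q z) * (prefix_weight p z * \<kappa> q (z(q := s)))) =
      (\<Sum>s\<in>{1..k}. if s = x q then of_bool (Q z) * prefix_weight p z * \<kappa> q (z(q := s)) else 0)"
      by (intro sum.cong) auto
    also have "\<dots> = of_bool (Q z) * prefix_weight p z * \<kappa> q (z(q := x q))"
      using x by simp
    also have "\<dots> = of_bool (Q z) * prefix_weight p z * \<kappa> q x"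
    proof (cases "Q z")
      case True
      then have "\<kappa> q (z(q := x q)) = \<kappa> q x"
        using par_less[OF q] by (intro kernel_cong[OF q]) (auto simp: Q_def)
      then show ?thesis by simp
    qed simp
    finally show ?thesis .
  qed
  have "mass (\<lambda>y. y q = x q \<and> Q y) =
      (\<Prod>i\<in>{q<..N}. C i) * (\<Sum>y\<in>prefixes q. of_bool (y q = x q \<and> Q y) * prefix_weight q y)"
    using q by (intro mass_prefix) (auto simp: Q)
  also have "(\<Sum>y\<in>prefixes q. of_bool (y q = x q \<and> Q y) * prefix_weight q y) =
      \<kappa> q x * (\<Sum>y\<in>prefixes p. of_bool (Q y) * prefix_weight p y)"
    unfolding p(1) sum_prefixes_Suc
    using sel Q p by (simp add: prefix_weight_upd sum_distrib_left mult_ac)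
  finally have 1: "mass (\<lambda>y. y q = x q \<and> Q y) = (\<Prod>i\<in>{q<..N}. C i) *
      (\<kappa> q x * (\<Sum>y\<in>prefixes p. of_bool (Q y) * prefix_weight p y))" .
  have "{p<..N} = insert q {q<..N}"
    using p by auto
  moreover have "mass Q = (\<Prod>i\<in>{p<..N}. C i) * (\<Sum>y\<in>prefixes p. of_bool (Q y) * prefix_weight p y)"
    using p by (intro mass_prefix Q) auto
  ultimately have 2: "mass Q = C q * (\<Prod>i\<in>{q<..N}. C i) *
      (\<Sum>y\<in>prefixes p. of_bool (Q y) * prefix_weight p y)"
    by simp
  show ?thesis
    using 1 2 unfolding Q_def by simp
qed

text \<open>By \<open>mass_kernel\<close> each quotient is \<open>\<kappa> q x / C q\<close>, and
  the product of these is the weight of \<open>x\<close> over the total mass. Positivity allows the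
  division.\<close>

lemma mass_single_factorisation:
  assumes x: "x \<in> prefixes N"
    and pos: "\<And>q. q \<in> {1..N} \<Longrightarrow> mass (\<lambda>y. \<forall>i\<in>par q. y i = x i) > 0"
  shows "mass (\<lambda>y. \<forall>i\<in>{1..N}. y i = x i) / mass (\<lambda>_. True) =
    (\<Prod>q\<in>{1..N}. mass (\<lambda>y. y q = x q \<and> (\<forall>i\<in>par q. y i = x i)) /
                  mass (\<lambda>y. \<forall>i\<in>par q. y i = x i))"
proof -
  have "mass (\<lambda>y. y q = x q \<and> (\<forall>i\<in>par q. y i = x i)) / mass (\<lambda>y. \<forall>i\<in>par q. y i = x i) =
      \<kappa> q x / C q" if "q \<in> {1..N}" for q
  proof -
    have "x q \<in> {1..k}"
      using x that by (auto simp: prefixes_def)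
    from mass_kernel[of q x, OF that this] pos[OF that] C_pos[OF that] show ?thesis
      by (simp add: field_simps)
  qed
  then show ?thesis
    unfolding mass_single[OF x] mass_True prefix_weight_def by (simp add: prod_dividef)
qed

text \<open>One array in the event on which no kernel vanishes suffices, since all other terms are
  nonnegative.\<close>

lemma mass_pos:
  assumes nonneg: "\<And>q y. q \<in> {1..N} \<Longrightarrow> 0 \<le> \<kappa> q y"
    and y: "y \<in> prefixes N" "Q y" "\<And>q. q \<in> {1..N} \<Longrightarrow> 0 < \<kappa> q y"
  shows "0 < mass Q"
proof -
  have "0 < of_bool (Q y) * prefix_weight N y"
    using y unfolding prefix_weight_def by (auto intro!: prod_pos)
  then show ?thesis
    unfolding mass_def
    by (rule sum_pos2[OF finite_prefixes y(1)])
       (auto simp: prefix_weight_def intro!: prod_nonneg nonneg)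
qed

end

section \<open>Components of unions of unit cells\<close>

text \<open>A continuous left inverse makes \<open>f\<close> an embedding, and connected sets can be
  carried in both directions. This moves the components along a grid line to the real line.\<close>

lemma components_embedding_image:
  fixes f :: "'a::topological_space \<Rightarrow> 'b::topological_space"
  assumes f: "continuous_on UNIV f" and g: "continuous_on UNIV g" and gf: "\<And>t. g (f t) = t"
  shows "components (f ` T) = image f ` components T"
proof -
  have cc: "connected_component_set (f ` T) (f t) = f ` connected_component_set T t" if "t \<in> T" for t
  proof (rule antisym)
    show "f ` connected_component_set T t \<subseteq> connected_component_set (f ` T) (f t)"
      using that connected_component_subset[of T t]
      by (intro connected_component_maximal connected_continuous_image
            continuous_on_subset[OF f] connected_connected_component)
         (auto simp: connected_component_refl)
    let ?C = "connected_component_set (f ` T) (f t)"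
    have C: "?C \<subseteq> f ` T"
      by (rule connected_component_subset)
    have "g ` ?C \<subseteq> connected_component_set T t"
    proof (rule connected_component_maximal)
      show "t \<in> g ` ?C"
        using that by (intro image_eqI[of _ _ "f t"]) (simp_all add: gf connected_component_refl)
      show "connected (g ` ?C)"
        by (intro connected_continuous_image continuous_on_subset[OF g] connected_connected_component) auto
      show "g ` ?C \<subseteq> T"
        using C gf by force
    qed
    moreover have "?C = f ` g ` ?C"
      using C gf by (force simp: image_iff)
    ultimately show "?C \<subseteq> f ` connected_component_set T t"
      by blast
  qed
  show ?thesis
    unfolding components_def by (force simp: cc image_iff)
qed

text \<open>
  A union of unit cells, each with or without its end points: a component corresponds to its
  leftmost cell.
\<close>

definition start_cells :: "nat set \<Rightarrow> real set \<Rightarrow> nat set" where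
  "start_cells P T = {a \<in> P. \<not> (1 \<le> a \<and> a - 1 \<in> P \<and> real a \<in> T)}"

text \<open>Only the integer end points of the cells are left open. This covers primary edges, which
  contain all their end points, as well as edges, which contain only the nodes that are not
  vertices.\<close>

locale cell_union =
  fixes P :: "nat set" and T :: "real set"
  assumes cell_subset: "a \<in> P \<Longrightarrow> {real a<..<real a + 1} \<subseteq> T"
    and subset_cells: "T \<subseteq> (\<Union>a\<in>P. {real a..real a + 1})"
begin

lemma cell_subset_component:
  assumes "a \<in> P"
  shows "{real a<..<real a + 1} \<subseteq> connected_component_set T (real a + 1/2)"
  using assms cell_subset by (intro connected_component_maximal) auto

lemma segment_to_midpoint:
  assumes "a \<in> P" and "t \<in> T" and t: "t \<in> {real a..real a + 1}"
  shows "closed_segment t (real a + 1/2) \<subseteq> T"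
proof
  fix u assume "u \<in> closed_segment t (real a + 1/2)"
  then have "u = t \<or> u \<in> {real a<..<real a + 1}"
    using t by (auto simp: closed_segment_eq_real_ivl split: if_splits)
  then show "u \<in> T"
    using cell_subset[OF assms(1)] assms(2) by blast
qed

text \<open>From any point of a closed cell one reaches its midpoint inside \<open>T\<close>; hence
  midpoints of cells represent all components.\<close>

lemma midpoint_in_component:
  assumes c: "c \<in> components T" and t: "t \<in> c" "a \<in> P" "t \<in> {real a..real a + 1}"
  shows "real a + 1/2 \<in> c"
proof -
  have "t \<in> T"
    using c t in_components_subset by blast
  then have sub: "closed_segment t (real a + 1/2) \<subseteq> T"
    using segment_to_midpoint t by blast
  have "closed_segment t (real a + 1/2) \<subseteq> c"
    using c t(1) sub by (intro components_maximal[OF c]) auto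
  then show ?thesis by auto
qed

text \<open>A cell that is not a start cell is joined to its predecessor through its left end point,
  so the least cell of a component is a start cell. Two start cells cannot share a component,
  because the interval between their midpoints would join the later one to its predecessor.\<close>

lemma bij_betw_start_cells_components:
  "bij_betw (\<lambda>a. connected_component_set T (real a + 1/2)) (start_cells P T) (components T)"
proof (rule bij_betwI')
  have mid: "real a + 1/2 \<in> T" if "a \<in> P" for a
    using cell_subset[OF that] by auto
  have aux: False if a: "a \<in> start_cells P T" "b \<in> start_cells P T" "a < b"
    and eq: "connected_component_set T (real a + 1/2) = connected_component_set T (real b + 1/2)" for a b
  proof -
    let ?C = "connected_component_set T (real a + 1/2)"
    have P: "a \<in> P" "b \<in> P"
      using a by (auto simp: start_cells_def)
    have "{real a + 1/2..real b + 1/2} \<subseteq> ?C"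
      using mid[OF P(1)] mid[OF P(2)] eq
      by (intro connected_contains_Icc) (auto simp: connected_component_refl)
    also have "?C \<subseteq> T"
      by (rule connected_component_subset)
    finally have *: "{real a + 1/2..real b + 1/2} \<subseteq> T" .
    \<comment> \<open>The point \<open>real b - 1/2\<close> is the midpoint of the cell before
      \<open>b\<close> and can be covered by no other cell; together with
      \<open>real b \<in> T\<close> this contradicts that \<open>b\<close> is a start cell.\<close>
    then have "real b - 1/2 \<in> T" "real b \<in> T"
      using \<open>a < b\<close> by auto
    then obtain c where c: "c \<in> P" "real b - 1/2 \<in> {real c..real c + 1}"
      using subset_cells by blast
    then have "real c < real b" "real b < real c + 2"
      by auto
    then have "c = b - 1"
      by linarith
    then show False
      using a c \<open>real b \<in> T\<close> by (auto simp: start_cells_def)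
  qed
  show "(connected_component_set T (real a + 1/2) = connected_component_set T (real b + 1/2)) = (a = b)"
    if "a \<in> start_cells P T" "b \<in> start_cells P T" for a b
    using that aux[of a b] aux[of b a] by (metis linorder_neqE_nat)
  show "connected_component_set T (real a + 1/2) \<in> components T" if "a \<in> start_cells P T" for a
    using that mid by (auto simp: start_cells_def intro: componentsI)
  show "\<exists>a\<in>start_cells P T. c = connected_component_set T (real a + 1/2)" if c: "c \<in> components T" for c
  proof -
    define A where "A = {a \<in> P. real a + 1/2 \<in> c}"
    obtain t where "t \<in> c"
      using c in_components_nonempty by blast
    then obtain a where "a \<in> A"
      using midpoint_in_component[OF c] subset_cells in_components_subset[OF c] unfolding A_def by blast
    \<comment> \<open>The least cell of the component is its start cell: otherwise its left end
      point would put the preceding cell into the component too.\<close>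
    define a0 where "a0 = (LEAST a. a \<in> A)"
    have a0: "a0 \<in> A"
      unfolding a0_def using \<open>a \<in> A\<close> by (rule LeastI)
    have "a0 \<in> start_cells P T"
    proof (rule ccontr)
      assume "a0 \<notin> start_cells P T"
      then have *: "1 \<le> a0" "a0 - 1 \<in> P" "real a0 \<in> T"
        using a0 by (auto simp: start_cells_def A_def)
      have "closed_segment (real a0) (real a0 + 1/2) \<subseteq> T"
        using segment_to_midpoint[of a0] a0 *(3) by (auto simp: A_def)
      then have "closed_segment (real a0) (real a0 + 1/2) \<subseteq> c"
        using a0 by (intro components_maximal[OF c]) (auto simp: A_def)
      then have "real a0 \<in> c"
        by auto
      then have "a0 - 1 \<in> A"
        using midpoint_in_component[OF c _ *(2)] * by (auto simp: A_def of_nat_diff)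
      then have "a0 \<le> a0 - 1"
        unfolding a0_def by (rule Least_le)
      then show False
        using *(1) by simp
    qed
    moreover have "c = connected_component_set T (real a0 + 1/2)"
    proof -
      obtain t where "c = connected_component_set T t"
        using c by (auto simp: components_def)
      then show ?thesis
        using a0 connected_component_eq[of "real a0 + 1/2" T t] by (simp add: A_def)
    qed
    ultimately show ?thesis by blast
  qed
qed

lemma component_contains_cell:
  assumes "c \<in> components T"
  obtains a where "a \<in> P" "{real a<..<real a + 1} \<subseteq> c"
proof -
  have "c \<in> (\<lambda>a. connected_component_set T (real a + 1/2)) ` start_cells P T"
    using assms bij_betw_start_cells_components by (simp add: bij_betw_def)
  then show ?thesis
    using cell_subset_component that by (auto simp: start_cells_def)
qed

end

section \<open>Segments and nodes of the grid\<close>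

lemma closed_segment_Pair_horizontal:
  fixes a b c :: real
  assumes "a \<le> b"
  shows "closed_segment (a, c) (b, c) = {a..b} \<times> {c}"
proof -
  have "linear (\<lambda>t::real. (t, 0::real))"
    by (intro linearI) auto
  from closed_segment_linear_image[OF this, of a b]
  have "closed_segment (a, 0) (b, 0) = {a..b} \<times> {0::real}"
    unfolding closed_segment_eq_real_ivl using assms by auto
  moreover have "(+) (0, c) ` ({a..b} \<times> {0}) = {a..b} \<times> {c}"
  proof (intro antisym subsetI)
    fix z assume "z \<in> {a..b} \<times> {c}"
    then show "z \<in> (+) (0, c) ` ({a..b} \<times> {0})"
      by (intro image_eqI[of _ _ "(fst z, 0)"]) auto
  qed auto
  ultimately show ?thesis
    using closed_segment_translation[of "(0, c)" "(a, 0)" "(b, 0)"] by simp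
qed

lemma closed_segment_Pair_vertical:
  fixes a b c :: real
  assumes "a \<le> b"
  shows "closed_segment (c, a) (c, b) = {c} \<times> {a..b}"
proof -
  have "linear (\<lambda>t::real. (0::real, t))"
    by (intro linearI) auto
  from closed_segment_linear_image[OF this, of a b]
  have "closed_segment (0, a) (0, b) = {0::real} \<times> {a..b}"
    unfolding closed_segment_eq_real_ivl using assms by auto
  moreover have "(+) (c, 0) ` ({0} \<times> {a..b}) = {c} \<times> {a..b}"
  proof (intro antisym subsetI)
    fix z assume "z \<in> {c} \<times> {a..b}"
    then show "z \<in> (+) (c, 0) ` ({0} \<times> {a..b})"
      by (intro image_eqI[of _ _ "(0, snd z)"]) auto
  qed auto
  ultimately show ?thesis
    using closed_segment_translation[of "(c, 0)" "(0, a)" "(0, b)"] by simp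
qed

locale pixel_grid =
  fixes m n :: nat
  assumes m_pos: "1 \<le> m" and n_pos: "1 \<le> n"
begin

text \<open>Parametrises a line by the coordinate that varies along it, so that horizontal and
  vertical lines are treated by the same arguments. \<open>axis_coord\<close> is its continuous left
  inverse, and \<open>len l\<close> is the number of segments on the line.\<close>

definition on_axis :: "nat \<Rightarrow> real \<Rightarrow> point" where
  "on_axis l t = (if l < n then (t, real l) else (real (l + 1 - n), t))"

definition axis_coord :: "nat \<Rightarrow> point \<Rightarrow> real" where
  "axis_coord l z = (if l < n then fst z else snd z)"

definition len :: "nat \<Rightarrow> nat" where
  "len l = (if l < n then m else n)"

definition seg :: "nat \<Rightarrow> nat \<Rightarrow> point set" where
  "seg l a = on_axis l ` {real a..real a + 1}"

lemma axis_coord_on_axis [simp]: "axis_coord l (on_axis l t) = t"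
  by (simp add: axis_coord_def on_axis_def)

lemma on_axis_eq_iff [simp]: "on_axis l t = on_axis l t' \<longleftrightarrow> t = t'"
  by (simp add: on_axis_def)

lemma continuous_on_axis: "continuous_on S (on_axis l)"
  unfolding on_axis_def by (cases "l < n") (auto intro!: continuous_intros)

lemma continuous_axis_coord: "continuous_on S (axis_coord l)"
  unfolding axis_coord_def by (cases "l < n") (auto intro!: continuous_intros)

lemma line_eq: "line n l = range (on_axis l)"
  by (auto simp: line_def on_axis_def)

lemma seg_horizontal: "l < n \<Longrightarrow> seg l a = {real a..real a + 1} \<times> {real l}"
  by (auto simp: seg_def on_axis_def)

lemma seg_vertical: "\<not> l < n \<Longrightarrow> seg l a = {real (l + 1 - n)} \<times> {real a..real a + 1}"
  by (auto simp: seg_def on_axis_def)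

text \<open>The number of the vertical line at abscissa \<open>a\<close>. The value
  \<open>vline 0 = n - 1\<close> does not number a vertical line, whence the side condition
  \<open>1 \<le> a\<close> below.\<close>

definition vline :: "nat \<Rightarrow> nat" where
  "vline a = n - 1 + a"

lemma vline_image: "vline ` S = (+) (n - 1) ` S"
  by (simp add: vline_def)

lemma vline_not_less: "1 \<le> a \<Longrightarrow> \<not> vline a < n"
  unfolding vline_def by linarith

lemma vline_offset: "1 \<le> a \<Longrightarrow> vline a + 1 - n = a"
  using n_pos unfolding vline_def by linarith

lemma seg_vline: "1 \<le> a \<Longrightarrow> seg (vline a) b = {real a} \<times> {real b..real b + 1}"
  using vline_not_less vline_offset by (simp add: seg_vertical)

lemma lines_eq: "lines m n = {1..<n} \<union> vline ` {1..<m}"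
proof -
  have "vline ` {1..<m} = {n..<m + n - 1}"
    using n_pos m_pos image_add_atLeastLessThan[of "n - 1" 1 m] by (simp add: vline_image add.commute[of m])
  then show ?thesis
    using m_pos n_pos by (auto simp: lines_def)
qed

lemma segments_eq: "segments m n = (\<Union>l\<in>lines m n. seg l ` {..<len l})"
proof -
  have h: "closed_segment (real a, real b) (real (a + 1), real b) = {real a..real a + 1} \<times> {real b}" for a b
    using closed_segment_Pair_horizontal[of "real a" "real (a + 1)"] by (simp add: add.commute)
  have v: "closed_segment (real a, real b) (real a, real (b + 1)) = {real a} \<times> {real b..real b + 1}" for a b
    using closed_segment_Pair_vertical[of "real b" "real (b + 1)"] by (simp add: add.commute)
  have 1: "{{real a..real a + 1} \<times> {real b} |a b. a < m \<and> b \<in> {1..<n}} =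
      (\<Union>l\<in>{1..<n}. seg l ` {..<m})"
  proof -
    have "{{real a..real a + 1} \<times> {real b} |a b. a < m \<and> b \<in> {1..<n}} =
        (\<Union>b\<in>{1..<n}. (\<lambda>a. {real a..real a + 1} \<times> {real b}) ` {..<m})"
      by blast
    then show ?thesis
      by (simp add: seg_horizontal)
  qed
  have 2: "{{real a} \<times> {real b..real b + 1} |a b. a \<in> {1..<m} \<and> b < n} =
      (\<Union>l\<in>vline ` {1..<m}. seg l ` {..<n})"
  proof -
    have "{{real a} \<times> {real b..real b + 1} |a b. a \<in> {1..<m} \<and> b < n} =
        (\<Union>a\<in>{1..<m}. (\<lambda>b. {real a} \<times> {real b..real b + 1}) ` {..<n})"
      by blast
    then show ?thesis
      by (simp add: seg_vline)
  qed
  have 3: "(\<Union>l\<in>{1..<n}. seg l ` {..<len l}) = (\<Union>l\<in>{1..<n}. seg l ` {..<m})"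
    "(\<Union>l\<in>vline ` {1..<m}. seg l ` {..<len l}) = (\<Union>l\<in>vline ` {1..<m}. seg l ` {..<n})"
    using vline_not_less by (auto simp: len_def)
  show ?thesis
    unfolding segments_def h v 1 2 lines_eq UN_Un 3 ..
qed

text \<open>Parallel lines are disjoint and perpendicular ones meet once. Hence any set with two
  points determines its line, which makes the \<open>THE\<close> in \<open>line_of\<close>
  meaningful on edges.\<close>

lemma two_points_on_lines:
  assumes "l \<in> lines m n" "l' \<in> lines m n" "t < t'"
    and "on_axis l t \<in> line n l'" "on_axis l t' \<in> line n l'"
  shows "l = l'"
  using assms by (auto simp: line_def on_axis_def lines_def split: if_splits)

lemma line_of_eqI:
  assumes "l \<in> lines m n" "t < t'" "on_axis l t \<in> e" "on_axis l t' \<in> e" "e \<subseteq> line n l"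
  shows "line_of m n e = l"
  unfolding line_of_def using assms two_points_on_lines[of l _ t t']
  by (intro the_equality) blast+

lemma seg_subset_line_iff:
  assumes "l \<in> lines m n" "l' \<in> lines m n"
  shows "seg l a \<subseteq> line n l' \<longleftrightarrow> l = l'"
proof
  assume sub: "seg l a \<subseteq> line n l'"
  have "on_axis l (real a) \<in> seg l a" "on_axis l (real a + 1) \<in> seg l a"
    by (auto simp: seg_def)
  then show "l = l'"
    using sub two_points_on_lines[OF assms, of "real a" "real a + 1"] by auto
qed (auto simp: seg_def line_eq)

lemma on_axis_in_seg_iff [simp]: "on_axis l t \<in> seg l a \<longleftrightarrow> t \<in> {real a..real a + 1}"
  by (auto simp: seg_def)

lemma seg_eq_iff:
  assumes "l \<in> lines m n" "l' \<in> lines m n"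
  shows "seg l a = seg l' a' \<longleftrightarrow> l = l' \<and> a = a'"
proof
  assume eq: "seg l a = seg l' a'"
  then have l: "l = l'"
    using seg_subset_line_iff[OF assms, of a] seg_subset_line_iff[of l' l' a'] assms by simp
  then have "axis_coord l ` seg l a = axis_coord l ` seg l a'"
    using eq by simp
  then show "l = l' \<and> a = a'"
    using l by (simp add: seg_def image_image)
qed simp

definition cells :: "graph \<Rightarrow> nat \<Rightarrow> nat set" where
  "cells \<gamma> l = {a. a < len l \<and> seg l a \<in> \<gamma>}"

lemma finite_cells [simp]: "finite (cells \<gamma> l)"
  by (simp add: cells_def)

lemma on_line_eq:
  assumes \<gamma>: "\<gamma> \<subseteq> segments m n" and l: "l \<in> lines m n"
  shows "on_line n \<gamma> l = on_axis l ` (\<Union>a\<in>cells \<gamma> l. {real a..real a + 1})"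
proof -
  have "{s \<in> \<gamma>. s \<subseteq> line n l} = seg l ` cells \<gamma> l"
    using \<gamma> l seg_subset_line_iff by (force simp: cells_def segments_eq)
  then show ?thesis
    by (simp add: on_line_def seg_def image_UN)
qed

lemma horizontal_in_lines: "b \<in> {1..<n} \<Longrightarrow> b \<in> lines m n"
  using m_pos by (auto simp: lines_def)

lemma vline_in_lines: "a \<in> {1..<m} \<Longrightarrow> vline a \<in> lines m n"
  using n_pos by (auto simp: lines_def vline_def)

lemma horizontal_neq_vline: "b < n \<Longrightarrow> 1 \<le> a \<Longrightarrow> b \<noteq> vline a"
  using vline_not_less by blast

lemma vline_eq_iff [simp]: "vline a = vline a' \<longleftrightarrow> a = a'"
  by (simp add: vline_def)

lemma on_axis_horizontal: "b < n \<Longrightarrow> on_axis b t = (t, real b)"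
  by (simp add: on_axis_def)

lemma on_axis_vline: "1 \<le> a \<Longrightarrow> on_axis (vline a) t = (real a, t)"
  using vline_not_less vline_offset by (simp add: on_axis_def)

lemma len_horizontal: "b < n \<Longrightarrow> len b = m"
  by (simp add: len_def)

lemma len_vline: "1 \<le> a \<Longrightarrow> len (vline a) = n"
  using vline_not_less by (simp add: len_def)

lemma lines_cases:
  assumes "l \<in> lines m n"
  obtains (horizontal) "l \<in> {1..<n}" | (vertical) a where "a \<in> {1..<m}" "l = vline a"
  using assms unfolding lines_eq by blast

lemma nodes_eq: "nodes m n = {(real a, real b) |a b. a \<in> {1..<m} \<and> b \<in> {1..<n}}"
proof (intro set_eqI iffI)
  fix p assume "p \<in> nodes m n"
  then obtain l l' where l: "l \<in> lines m n" "l' \<in> lines m n" "l \<noteq> l'" "p \<in> line n l" "p \<in> line n l'"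
    by (auto simp: nodes_def)
  from l(1,2) show "p \<in> {(real a, real b) |a b. a \<in> {1..<m} \<and> b \<in> {1..<n}}"
    by (elim lines_cases) (use l(3-5) in \<open>auto simp: line_eq on_axis_horizontal on_axis_vline\<close>)
next
  fix p assume "p \<in> {(real a, real b) |a b. a \<in> {1..<m} \<and> b \<in> {1..<n}}"
  then obtain a b where ab: "p = (real a, real b)" "a \<in> {1..<m}" "b \<in> {1..<n}"
    by auto
  then have "p \<in> line n b" "p \<in> line n (vline a)" "b \<noteq> vline a"
    using horizontal_neq_vline by (auto simp: line_eq on_axis_horizontal on_axis_vline image_iff)
  then show "p \<in> nodes m n"
    using ab horizontal_in_lines vline_in_lines unfolding nodes_def by blast
qed

lemma frontier_domain: "frontier (domain m n) = {0..real m} \<times> {0..real n} - {0<..<real m} \<times> {0<..<real n}"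
  using m_pos n_pos
  by (simp add: frontier_def domain_def closure_Times interior_Times interior_open open_Times)

text \<open>The segment of \<open>\<gamma>\<close> to the right of, respectively below, the node or frontier point \<open>(a, b)\<close>.\<close>

definition hor :: "graph \<Rightarrow> nat \<Rightarrow> nat \<Rightarrow> bool" where
  "hor \<gamma> a b \<longleftrightarrow> seg b a \<in> \<gamma>"

definition ver :: "graph \<Rightarrow> nat \<Rightarrow> nat \<Rightarrow> bool" where
  "ver \<gamma> a b \<longleftrightarrow> seg (vline a) b \<in> \<gamma>"

lemma segments_at_node:
  assumes \<gamma>: "\<gamma> \<subseteq> segments m n" and a: "a \<in> {1..<m}" and b: "b \<in> {1..<n}"
  shows "{s \<in> \<gamma>. (real a, real b) \<in> s} =
    \<gamma> \<inter> {seg b (a - 1), seg b a, seg (vline a) (b - 1), seg (vline a) b}"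
proof (intro set_eqI iffI)
  fix s assume "s \<in> {s \<in> \<gamma>. (real a, real b) \<in> s}"
  then have s: "s \<in> \<gamma>" "(real a, real b) \<in> s" "s \<in> segments m n"
    using \<gamma> by auto
  then obtain l c where l: "l \<in> lines m n" "s = seg l c"
    by (auto simp: segments_eq)
  from l(1) have "s \<in> {seg b (a - 1), seg b a, seg (vline a) (b - 1), seg (vline a) b}"
  proof (cases rule: lines_cases)
    case horizontal
    then have "l = b" "real c \<le> real a" "real a \<le> real c + 1"
      using s l by (auto simp: seg_horizontal)
    then have "c = a \<or> c = a - 1" by linarith
    then show ?thesis using l \<open>l = b\<close> by auto
  next
    case (vertical d)
    then have "d = a" "real c \<le> real b" "real b \<le> real c + 1"
      using s l by (auto simp: seg_vline)
    then have "c = b \<or> c = b - 1" by linarith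
    then show ?thesis using l vertical \<open>d = a\<close> by auto
  qed
  then show "s \<in> \<gamma> \<inter> {seg b (a - 1), seg b a, seg (vline a) (b - 1), seg (vline a) b}"
    using s by blast
next
  fix s assume "s \<in> \<gamma> \<inter> {seg b (a - 1), seg b a, seg (vline a) (b - 1), seg (vline a) b}"
  then show "s \<in> {s \<in> \<gamma>. (real a, real b) \<in> s}"
    using a b by (auto simp: seg_horizontal seg_vline of_nat_diff)
qed

lemma degree_node:
  assumes \<gamma>: "\<gamma> \<subseteq> segments m n" and a: "a \<in> {1..<m}" and b: "b \<in> {1..<n}"
  shows "degree \<gamma> (real a, real b) =
    of_bool (hor \<gamma> (a - 1) b) + of_bool (hor \<gamma> a b) + of_bool (ver \<gamma> a (b - 1)) + of_bool (ver \<gamma> a b)"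
proof -
  have "b \<noteq> vline a"
    using a b horizontal_neq_vline by auto
  moreover have "a - 1 \<noteq> a" "b - 1 \<noteq> b"
    using a b by auto
  ultimately have "distinct [seg b (a - 1), seg b a, seg (vline a) (b - 1), seg (vline a) b]"
    using a b horizontal_in_lines vline_in_lines by (simp add: seg_eq_iff)
  then show ?thesis
    unfolding degree_def segments_at_node[OF assms] hor_def ver_def by (auto simp: Int_insert_right)
qed

definition straight_hor :: "graph \<Rightarrow> nat \<Rightarrow> nat \<Rightarrow> bool" where
  "straight_hor \<gamma> a b \<longleftrightarrow> hor \<gamma> (a - 1) b \<and> hor \<gamma> a b \<and> \<not> ver \<gamma> a (b - 1) \<and> \<not> ver \<gamma> a b"

definition straight_ver :: "graph \<Rightarrow> nat \<Rightarrow> nat \<Rightarrow> bool" where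
  "straight_ver \<gamma> a b \<longleftrightarrow> ver \<gamma> a (b - 1) \<and> ver \<gamma> a b \<and> \<not> hor \<gamma> (a - 1) b \<and> \<not> hor \<gamma> a b"

text \<open>The segments at a node lie on a common line unless both directions occur. With degree 2
  this leaves exactly two segments of the same direction.\<close>

lemma straight_node_iff:
  assumes \<gamma>: "\<gamma> \<subseteq> segments m n" and a: "a \<in> {1..<m}" and b: "b \<in> {1..<n}"
  shows "straight m n \<gamma> (real a, real b) \<longleftrightarrow> straight_hor \<gamma> a b \<or> straight_ver \<gamma> a b"
proof -
  have l: "b \<in> lines m n" "vline a \<in> lines m n" "b \<noteq> vline a"
    using a b horizontal_in_lines vline_in_lines horizontal_neq_vline by auto
  have "(\<exists>l\<in>lines m n. \<forall>s\<in>\<gamma>. (real a, real b) \<in> s \<longrightarrow> s \<subseteq> line n l) \<longleftrightarrow>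
      (\<exists>l\<in>lines m n. \<forall>s\<in>{s\<in>\<gamma>. (real a, real b) \<in> s}. s \<subseteq> line n l)"
    by blast
  also have "\<dots> \<longleftrightarrow> (\<exists>l\<in>lines m n. (hor \<gamma> (a - 1) b \<or> hor \<gamma> a b \<longrightarrow> l = b) \<and>
      (ver \<gamma> a (b - 1) \<or> ver \<gamma> a b \<longrightarrow> l = vline a))"
    unfolding segments_at_node[OF assms] hor_def ver_def
    using l(1,2) by (intro bex_cong refl) (simp add: ball_simps Int_insert_right seg_subset_line_iff, auto)
  finally have "(\<exists>l\<in>lines m n. \<forall>s\<in>\<gamma>. (real a, real b) \<in> s \<longrightarrow> s \<subseteq> line n l) \<longleftrightarrow>
      \<not> ((hor \<gamma> (a - 1) b \<or> hor \<gamma> a b) \<and> (ver \<gamma> a (b - 1) \<or> ver \<gamma> a b))"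
    using l by blast
  then show ?thesis
    unfolding straight_def degree_node[OF assms] straight_hor_def straight_ver_def by auto
qed

lemma node_in_graph_iff:
  assumes "\<gamma> \<subseteq> segments m n" and "a \<in> {1..<m}" and "b \<in> {1..<n}"
  shows "(real a, real b) \<in> \<Union>\<gamma> \<longleftrightarrow> hor \<gamma> (a - 1) b \<or> hor \<gamma> a b \<or> ver \<gamma> a (b - 1) \<or> ver \<gamma> a b"
proof -
  have "(real a, real b) \<in> \<Union>\<gamma> \<longleftrightarrow> {s \<in> \<gamma>. (real a, real b) \<in> s} \<noteq> {}"
    by blast
  then show ?thesis
    unfolding segments_at_node[OF assms] hor_def ver_def by blast
qed

section \<open>Edges of a graph\<close>

lemma on_axis_frontier_iff:
  assumes "l \<in> lines m n" "t \<in> {0..real (len l)}"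
  shows "on_axis l t \<in> frontier (domain m n) \<longleftrightarrow> t = 0 \<or> t = real (len l)"
  using assms(1)
  by (cases rule: lines_cases)
     (use assms(2) in \<open>auto simp: frontier_domain on_axis_horizontal on_axis_vline len_horizontal len_vline\<close>)

lemma on_axis_nodes_iff:
  assumes "l \<in> lines m n"
  shows "on_axis l t \<in> nodes m n \<longleftrightarrow> (\<exists>c\<in>{1..<len l}. t = real c)"
  using assms
  by (cases rule: lines_cases)
     (auto simp: nodes_eq on_axis_horizontal on_axis_vline len_horizontal len_vline)

text \<open>The positions on line \<open>l\<close> of the nodes lying inside an edge along
  \<open>l\<close>. These are the only places where two consecutive segments belong to the same
  edge, and also the only places where an edge is crossed by another line.\<close>

definition through :: "graph \<Rightarrow> nat \<Rightarrow> nat set" where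
  "through \<gamma> l = (if l < n then {a \<in> {1..<m}. straight_hor \<gamma> a l}
                   else {b \<in> {1..<n}. straight_ver \<gamma> (l + 1 - n) b})"

lemma through_horizontal: "b < n \<Longrightarrow> through \<gamma> b = {a \<in> {1..<m}. straight_hor \<gamma> a b}"
  by (simp add: through_def)

lemma through_vline: "1 \<le> a \<Longrightarrow> through \<gamma> (vline a) = {b \<in> {1..<n}. straight_ver \<gamma> a b}"
  using vline_not_less vline_offset by (simp add: through_def)

lemma cells_horizontal: "b < n \<Longrightarrow> cells \<gamma> b = {a. a < m \<and> hor \<gamma> a b}"
  by (simp add: cells_def len_horizontal hor_def)

lemma cells_vline: "1 \<le> a \<Longrightarrow> cells \<gamma> (vline a) = {b. b < n \<and> ver \<gamma> a b}"
  by (simp add: cells_def len_vline ver_def)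

lemma through_subset:
  assumes "l \<in> lines m n" "c \<in> through \<gamma> l"
  shows "c \<in> {1..<len l}" "c - 1 \<in> cells \<gamma> l" "c \<in> cells \<gamma> l"
  using assms
  by (auto elim!: lines_cases simp: through_horizontal through_vline cells_horizontal cells_vline
        len_horizontal len_vline straight_hor_def straight_ver_def)

lemma finite_through [simp]: "finite (through \<gamma> l)"
  by (simp add: through_def)

text \<open>The presence of a segment of line \<open>l\<close> at the node rules out straightness in
  the perpendicular direction.\<close>

lemma straight_iff_through:
  assumes \<gamma>: "\<gamma> \<subseteq> segments m n" and l: "l \<in> lines m n" and c: "c \<in> {1..<len l}"
    and "c - 1 \<in> cells \<gamma> l \<or> c \<in> cells \<gamma> l"
  shows "straight m n \<gamma> (on_axis l (real c)) \<longleftrightarrow> c \<in> through \<gamma> l"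
  using l
proof (cases rule: lines_cases)
  case horizontal
  then have "straight m n \<gamma> (on_axis l (real c)) \<longleftrightarrow> straight_hor \<gamma> c l \<or> straight_ver \<gamma> c l"
    using c straight_node_iff[OF \<gamma>, of c l] by (simp add: on_axis_horizontal len_horizontal)
  then show ?thesis
    using assms(4) horizontal c
    by (auto simp: through_horizontal cells_horizontal len_horizontal straight_ver_def)
next
  case (vertical a)
  then have "straight m n \<gamma> (on_axis l (real c)) \<longleftrightarrow> straight_hor \<gamma> a c \<or> straight_ver \<gamma> a c"
    using c straight_node_iff[OF \<gamma>, of a c] by (simp add: on_axis_vline len_vline)
  then show ?thesis
    using assms(4) vertical c
    by (auto simp: through_vline cells_vline len_vline straight_hor_def)
qed

definition edge_part :: "graph \<Rightarrow> nat \<Rightarrow> real set" where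
  "edge_part \<gamma> l = (\<Union>a\<in>cells \<gamma> l. {real a<..<real a + 1}) \<union> real ` through \<gamma> l"

definition primary_part :: "graph \<Rightarrow> nat \<Rightarrow> real set" where
  "primary_part \<gamma> l = (\<Union>a\<in>cells \<gamma> l. {real a..real a + 1})"

lemma cell_union_primary: "cell_union (cells \<gamma> l) (primary_part \<gamma> l)"
  by unfold_locales (auto simp: primary_part_def)

lemma cell_union_edge: "l \<in> lines m n \<Longrightarrow> cell_union (cells \<gamma> l) (edge_part \<gamma> l)"
  using through_subset(3) by unfold_locales (auto simp: edge_part_def, force)

lemma real_in_edge_part_iff: "real a \<in> edge_part \<gamma> l \<longleftrightarrow> a \<in> through \<gamma> l"
proof -
  have "\<not> (real c < real a \<and> real a < real c + 1)" for c
    by auto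
  then show ?thesis
    by (auto simp: edge_part_def)
qed

text \<open>At a node of \<open>through\<close> both adjacent cells are present, so the condition on
  the predecessor in \<open>start_cells\<close> holds automatically there.\<close>

lemma start_cells_edge:
  assumes "l \<in> lines m n"
  shows "start_cells (cells \<gamma> l) (edge_part \<gamma> l) = cells \<gamma> l - through \<gamma> l"
  using through_subset[OF assms] by (fastforce simp: start_cells_def real_in_edge_part_iff)

lemma start_cells_primary:
  "start_cells (cells \<gamma> l) (primary_part \<gamma> l) = {a \<in> cells \<gamma> l. \<not> (1 \<le> a \<and> a - 1 \<in> cells \<gamma> l)}"
  by (auto simp: start_cells_def primary_part_def)

text \<open>A point inside a segment is neither a node nor a frontier point. An end point of a
  segment is either on the frontier, and then a vertex, or a node, and then a vertex unless it is
  straight along \<open>l\<close>.\<close>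

lemma on_line_diff_vertices:
  assumes \<gamma>: "\<gamma> \<subseteq> segments m n" and l: "l \<in> lines m n"
  shows "on_line n \<gamma> l - vertices m n \<gamma> = on_axis l ` edge_part \<gamma> l"
proof -
  have key: "on_axis l t \<notin> vertices m n \<gamma> \<longleftrightarrow> t \<in> edge_part \<gamma> l"
    if a: "a \<in> cells \<gamma> l" and t: "t \<in> {real a..real a + 1}" for a t
  proof -
    have "a < len l" "seg l a \<in> \<gamma>" "on_axis l t \<in> seg l a"
      using a t by (auto simp: cells_def)
    then have \<Union>: "on_axis l t \<in> \<Union>\<gamma>"
      by blast
    have t': "t \<in> {0..real (len l)}"
      using t \<open>a < len l\<close> by auto
    note fr = on_axis_frontier_iff[OF l t']
    show ?thesis
    proof (cases "t \<in> {real a<..<real a + 1}")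
      case True
      then have "t \<noteq> real c" for c
        by auto
      then have "on_axis l t \<notin> vertices m n \<gamma>"
        using True on_axis_nodes_iff[OF l, of t] fr
        by (metis Int_iff Un_iff boundary_vertices_def interior_vertices_def mem_Collect_eq of_nat_0 vertices_def)
      moreover have "t \<in> edge_part \<gamma> l"
        using True a by (auto simp: edge_part_def)
      ultimately show ?thesis by simp
    next
      case False
      then have "t = real a \<or> t = real (a + 1)"
        using t by auto
      then obtain c where c: "t = real c" "c = a \<or> c = a + 1"
        by blast
      show ?thesis
      proof (cases "c \<in> {1..<len l}")
        case True
        then have "on_axis l t \<in> vertices m n \<gamma> \<longleftrightarrow> \<not> straight m n \<gamma> (on_axis l t)"
          using \<Union> fr on_axis_nodes_iff[OF l, of t] c
          by (auto simp: vertices_def interior_vertices_def boundary_vertices_def)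
        also have "\<dots> \<longleftrightarrow> c \<notin> through \<gamma> l"
          using straight_iff_through[OF \<gamma> l True] c a by auto
        finally show ?thesis
          using c real_in_edge_part_iff by simp
      next
        case c': False
        then have "c = 0 \<or> c = len l"
          using c \<open>a < len l\<close> by auto
        then have "on_axis l t \<in> vertices m n \<gamma>"
          using fr c \<Union> by (auto simp: vertices_def boundary_vertices_def)
        moreover have "t \<notin> edge_part \<gamma> l"
          using c c' through_subset(1)[OF l] real_in_edge_part_iff by blast
        ultimately show ?thesis by simp
      qed
    qed
  qed
  have "edge_part \<gamma> l \<subseteq> (\<Union>a\<in>cells \<gamma> l. {real a..real a + 1})"
    using cell_union.subset_cells[OF cell_union_edge[OF l]] .
  then show ?thesis
    unfolding on_line_eq[OF \<gamma> l] using key by blast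
qed

lemma components_on_axis: "components (on_axis l ` T) = image (on_axis l) ` components T"
  by (rule components_embedding_image[where g = "axis_coord l"])
     (simp_all add: continuous_on_axis continuous_axis_coord)

lemma inj_image_on_axis: "inj (image (on_axis l))"
  by (auto simp: inj_image_eq_iff inj_def)

text \<open>The family \<open>T\<close> stands for \<open>edge_part \<gamma>\<close> or
  \<open>primary_part \<gamma>\<close>, so that edges and primary edges are handled
  together.\<close>

context
  fixes \<gamma> and T :: "nat \<Rightarrow> real set"
  assumes cu: "\<And>l. l \<in> lines m n \<Longrightarrow> cell_union (cells \<gamma> l) (T l)"
begin

lemma finite_components_on_axis: "l \<in> lines m n \<Longrightarrow> finite (components (on_axis l ` T l))"
  using bij_betw_finite[OF cell_union.bij_betw_start_cells_components[OF cu, of l]]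
  by (simp add: components_on_axis start_cells_def)

lemma card_components_on_axis:
  assumes "l \<in> lines m n"
  shows "card (components (on_axis l ` T l)) = card (start_cells (cells \<gamma> l) (T l))"
proof -
  have "card (components (on_axis l ` T l)) = card (components (T l))"
    unfolding components_on_axis using inj_image_on_axis by (intro card_image) (blast intro: inj_on_subset)
  then show ?thesis
    using bij_betw_same_card[OF cell_union.bij_betw_start_cells_components[OF cu[OF assms]]] by simp
qed

lemma component_on_axis_subset_line:
  assumes "e \<in> components (on_axis l ` T l)"
  shows "e \<subseteq> line n l"
  unfolding line_eq using in_components_subset[OF assms] by blast

lemma component_on_axis_two_points:
  assumes l: "l \<in> lines m n" and e: "e \<in> components (on_axis l ` T l)"
  obtains t t' where "t < t'" "on_axis l t \<in> e" "on_axis l t' \<in> e"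
proof -
  obtain c where c: "c \<in> components (T l)" "e = on_axis l ` c"
    using e by (auto simp: components_on_axis)
  then obtain a where "{real a<..<real a + 1} \<subseteq> c"
    using cell_union.component_contains_cell[OF cu[OF l]] by blast
  then have "real a + 1/3 \<in> c" "real a + 1/2 \<in> c"
    by (auto simp: subset_eq)
  then show ?thesis
    using c(2) that[of "real a + 1/3" "real a + 1/2"] by auto
qed

lemma line_of_component_on_axis:
  assumes "l \<in> lines m n" and "e \<in> components (on_axis l ` T l)"
  shows "line_of m n e = l"
  using assms component_on_axis_two_points component_on_axis_subset_line line_of_eqI by metis

text \<open>\<open>line_of\<close> recovers the line from a component, so the families of components
  on different lines are disjoint.\<close>

lemma
  shows sum_components_on_axis:
    "(\<Sum>e\<in>(\<Union>l\<in>lines m n. components (on_axis l ` T l)). (f e :: 'a :: comm_monoid_add)) =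
     (\<Sum>l\<in>lines m n. \<Sum>e\<in>components (on_axis l ` T l). f e)"
  and prod_components_on_axis:
    "(\<Prod>e\<in>(\<Union>l\<in>lines m n. components (on_axis l ` T l)). (h e :: 'b :: comm_monoid_mult)) =
     (\<Prod>l\<in>lines m n. \<Prod>e\<in>components (on_axis l ` T l). h e)"
proof -
  have "\<forall>l\<in>lines m n. \<forall>l'\<in>lines m n. l \<noteq> l' \<longrightarrow>
      components (on_axis l ` T l) \<inter> components (on_axis l' ` T l') = {}"
    using line_of_component_on_axis by blast
  moreover have "finite (lines m n)"
    by (simp add: lines_def)
  ultimately show "(\<Sum>e\<in>(\<Union>l\<in>lines m n. components (on_axis l ` T l)). (f e :: 'a :: comm_monoid_add)) =
     (\<Sum>l\<in>lines m n. \<Sum>e\<in>components (on_axis l ` T l). f e)"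
    "(\<Prod>e\<in>(\<Union>l\<in>lines m n. components (on_axis l ` T l)). (h e :: 'b :: comm_monoid_mult)) =
     (\<Prod>l\<in>lines m n. \<Prod>e\<in>components (on_axis l ` T l). h e)"
    using finite_components_on_axis
    by (simp_all add: sum.UNION_disjoint prod.UNION_disjoint)
qed

end

lemma edges_eq:
  assumes "\<gamma> \<subseteq> segments m n"
  shows "edges m n \<gamma> = (\<Union>l\<in>lines m n. components (on_axis l ` edge_part \<gamma> l))"
  unfolding edges_def using on_line_diff_vertices[OF assms] by simp

lemma primary_edges_eq:
  assumes "\<gamma> \<subseteq> segments m n"
  shows "primary_edges m n \<gamma> = (\<Union>l\<in>lines m n. components (on_axis l ` primary_part \<gamma> l))"
  unfolding primary_edges_def primary_part_def using on_line_eq[OF assms] by simp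

lemma card_edges:
  assumes \<gamma>: "\<gamma> \<subseteq> segments m n"
  shows "card (edges m n \<gamma>) = (\<Sum>l\<in>lines m n. card (cells \<gamma> l - through \<gamma> l))"
proof -
  have "card (edges m n \<gamma>) = (\<Sum>l\<in>lines m n. \<Sum>e\<in>components (on_axis l ` edge_part \<gamma> l). 1)"
    unfolding edges_eq[OF \<gamma>] card_eq_sum
    by (rule sum_components_on_axis[OF cell_union_edge])
  then show ?thesis
    using card_components_on_axis[OF cell_union_edge] by (simp add: start_cells_edge)
qed

lemma prod_primary_edges:
  assumes \<gamma>: "\<gamma> \<subseteq> segments m n"
  shows "(\<Prod>e\<in>primary_edges m n \<gamma>. \<pi> (line_of m n e)) =
    (\<Prod>l\<in>lines m n. \<Prod>a\<in>{a \<in> cells \<gamma> l. \<not> (1 \<le> a \<and> a - 1 \<in> cells \<gamma> l)}. (\<pi> l :: real))"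
proof -
  have "(\<Prod>e\<in>primary_edges m n \<gamma>. \<pi> (line_of m n e)) =
      (\<Prod>l\<in>lines m n. \<Prod>e\<in>components (on_axis l ` primary_part \<gamma> l). \<pi> (line_of m n e))"
    unfolding primary_edges_eq[OF \<gamma>] by (rule prod_components_on_axis[OF cell_union_primary])
  also have "\<dots> = (\<Prod>l\<in>lines m n. \<Prod>e\<in>components (on_axis l ` primary_part \<gamma> l). \<pi> l)"
    using line_of_component_on_axis[OF cell_union_primary] by (intro prod.cong refl) simp
  finally show ?thesis
    using card_components_on_axis[OF cell_union_primary] by (simp add: start_cells_primary)
qed

section \<open>Lines crossing an edge\<close>

definition cross :: "nat \<Rightarrow> nat \<Rightarrow> nat" where
  "cross l c = (if l < n then vline c else c)"

text \<open>Lines parallel to \<open>l\<close> miss \<open>e\<close>, and a perpendicular line meets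
  \<open>l\<close> only at one integer position. The last premise reduces \<open>crosses\<close> to
  meeting \<open>e\<close> and being different from \<open>l\<close>.\<close>

lemma crossing_lines:
  assumes l: "l \<in> lines m n" and e: "e \<subseteq> line n l"
    and e': "\<And>l'. l' \<in> lines m n \<Longrightarrow> e \<subseteq> line n l' \<Longrightarrow> l' = l"
  shows "{l' \<in> lines m n. crosses n l' e} = cross l ` {c \<in> {1..<len l}. on_axis l (real c) \<in> e}"
proof -
  have cr: "crosses n l' e \<longleftrightarrow> l' \<noteq> l \<and> line n l' \<inter> e \<noteq> {}" if "l' \<in> lines m n" for l'
    using e e'[OF that] by (auto simp: crosses_def)
  have *: "(l' \<noteq> l \<and> line n l' \<inter> e \<noteq> {}) \<longleftrightarrow>
      l' \<in> cross l ` {c \<in> {1..<len l}. on_axis l (real c) \<in> e}" if l': "l' \<in> lines m n" for l'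
    using l
  proof (cases rule: lines_cases)
    case horizontal
    then have R: "cross l ` {c \<in> {1..<len l}. on_axis l (real c) \<in> e} =
        vline ` {c \<in> {1..<m}. (real c, real l) \<in> e}"
      by (simp add: cross_def len_horizontal on_axis_horizontal)
    have e_y: "snd z = real l" if "z \<in> e" for z
      using that e horizontal by (auto simp: line_eq on_axis_horizontal)
    from l' show ?thesis
    proof (cases rule: lines_cases)
      case h': horizontal
      then have "l' \<noteq> l \<Longrightarrow> line n l' \<inter> e = {}"
        using e_y by (force simp: line_eq on_axis_horizontal)
      then show ?thesis
        unfolding R using h' horizontal_neq_vline by auto
    next
      case v': (vertical a)
      have "line n l' \<inter> e \<noteq> {} \<longleftrightarrow> (real a, real l) \<in> e"
        using v' e_y by (force simp: line_eq on_axis_vline)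
      moreover have "l' \<noteq> l"
        using v' horizontal horizontal_neq_vline[of l a] by auto
      ultimately show ?thesis
        unfolding R using v' by auto
    qed
  next
    case (vertical d)
    then have R: "cross l ` {c \<in> {1..<len l}. on_axis l (real c) \<in> e} =
        {c \<in> {1..<n}. (real d, real c) \<in> e}"
      using vline_not_less[of d] by (simp add: cross_def len_vline on_axis_vline)
    have e_x: "fst z = real d" if "z \<in> e" for z
      using that e vertical by (auto simp: line_eq on_axis_vline)
    from l' show ?thesis
    proof (cases rule: lines_cases)
      case h': horizontal
      have "line n l' \<inter> e \<noteq> {} \<longleftrightarrow> (real d, real l') \<in> e"
        using h' e_x by (force simp: line_eq on_axis_horizontal)
      moreover have "l' \<noteq> l"
        using h' vertical horizontal_neq_vline[of l' d] by auto
      ultimately show ?thesis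
        unfolding R using h' by auto
    next
      case v': (vertical a)
      then have "l' \<noteq> l \<Longrightarrow> line n l' \<inter> e = {}"
        using e_x vertical by (force simp: line_eq on_axis_vline)
      then show ?thesis
        unfolding R using v' vline_not_less[of a] by auto
    qed
  qed
  have "cross l ` {c \<in> {1..<len l}. on_axis l (real c) \<in> e} \<subseteq> lines m n"
    using l by (cases rule: lines_cases)
      (use vline_not_less in \<open>auto simp: cross_def len_horizontal len_vline vline_in_lines horizontal_in_lines\<close>)
  then show ?thesis
    using cr * by blast
qed

text \<open>The integer points of the edges along \<open>l\<close> are exactly
  \<open>through \<gamma> l\<close>, and distinct components are disjoint. So every straight node is
  counted in one edge only, with the perpendicular line through it.\<close>

lemma sum_crossings:
  fixes g :: "nat \<Rightarrow> 'a :: comm_monoid_add"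
  assumes \<gamma>: "\<gamma> \<subseteq> segments m n"
  shows "(\<Sum>e\<in>edges m n \<gamma>. \<Sum>l\<in>{l \<in> lines m n. crosses n l e}. g l) =
    (\<Sum>l\<in>lines m n. \<Sum>c\<in>through \<gamma> l. g (cross l c))"
proof -
  have "(\<Sum>e\<in>components (on_axis l ` edge_part \<gamma> l). \<Sum>l'\<in>{l' \<in> lines m n. crosses n l' e}. g l') =
      (\<Sum>c\<in>through \<gamma> l. g (cross l c))" if l: "l \<in> lines m n" for l
  proof -
    define E where "E = components (on_axis l ` edge_part \<gamma> l)"
    define I where "I = (\<lambda>e. {c \<in> {1..<len l}. on_axis l (real c) \<in> e})"
    have "(\<Sum>l'\<in>{l' \<in> lines m n. crosses n l' e}. g l') = (\<Sum>c\<in>I e. g (cross l c))" if "e \<in> E" for e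
    proof -
      have sub: "e \<subseteq> line n l"
        using that component_on_axis_subset_line[OF cell_union_edge] unfolding E_def by blast
      have "l' = l" if "l' \<in> lines m n" "e \<subseteq> line n l'" for l'
        using component_on_axis_two_points[OF cell_union_edge l, of e] \<open>e \<in> E\<close>
          two_points_on_lines[OF l that(1)] that(2) unfolding E_def by (metis subsetD)
      from crossing_lines[OF l sub this]
      have "{l' \<in> lines m n. crosses n l' e} = cross l ` I e"
        by (simp add: I_def)
      moreover have "inj (cross l)"
        by (auto simp: inj_def cross_def)
      ultimately show ?thesis
        by (simp add: sum.reindex inj_on_subset)
    qed
    then have "(\<Sum>e\<in>E. \<Sum>l'\<in>{l' \<in> lines m n. crosses n l' e}. g l') = (\<Sum>e\<in>E. \<Sum>c\<in>I e. g (cross l c))"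
      by simp
    also have "\<dots> = (\<Sum>c\<in>(\<Union>e\<in>E. I e). g (cross l c))"
    proof (rule sum.UNION_disjoint[symmetric])
      show "finite E"
        unfolding E_def using finite_components_on_axis[OF cell_union_edge] l by blast
      show "\<forall>e\<in>E. \<forall>e'\<in>E. e \<noteq> e' \<longrightarrow> I e \<inter> I e' = {}"
        using components_nonoverlap[of _ "on_axis l ` edge_part \<gamma> l"] unfolding E_def I_def by blast
    qed (simp add: I_def)
    also have "(\<Union>e\<in>E. I e) = through \<gamma> l"
    proof -
      have "(\<Union>e\<in>E. I e) = {c \<in> {1..<len l}. on_axis l (real c) \<in> \<Union>E}"
        by (auto simp: I_def)
      also have "\<Union>E = on_axis l ` edge_part \<gamma> l"
        unfolding E_def by (rule Union_components)
      also have "{c \<in> {1..<len l}. on_axis l (real c) \<in> on_axis l ` edge_part \<gamma> l} = through \<gamma> l"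
        using through_subset(1)[OF l] real_in_edge_part_iff by (force simp: image_iff)
      finally show ?thesis .
    qed
    finally show ?thesis
      unfolding E_def .
  qed
  then show ?thesis
    unfolding edges_eq[OF \<gamma>] by (subst sum_components_on_axis[OF cell_union_edge]) simp_all
qed

section \<open>Duality\<close>

text \<open>Columns \<open>c\<close> and rows \<open>r\<close> are counted from 0, the index from 1:
  the pixel in column \<open>i + 1\<close> and row \<open>j\<close> has index
  \<open>idx i (j - 1)\<close>.\<close>

definition idx :: "nat \<Rightarrow> nat \<Rightarrow> nat" where
  "idx c r = c * n + r + 1"

lemma idx_eq_iff:
  assumes "r < n" "r' < n"
  shows "idx c r = idx c' r' \<longleftrightarrow> c = c' \<and> r = r'"
proof
  assume "idx c r = idx c' r'"
  then have "c * n + r = c' * n + r'"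
    by (simp add: idx_def)
  then have "(c * n + r) div n = (c' * n + r') div n" "(c * n + r) mod n = (c' * n + r') mod n"
    by simp_all
  then show "c = c' \<and> r = r'"
    using assms by simp
qed simp

lemma idx_in: "c < m \<Longrightarrow> r < n \<Longrightarrow> idx c r \<in> {1..m * n}"
proof -
  assume "c < m" "r < n"
  then have "Suc c * n \<le> m * n"
    by (intro mult_right_mono) auto
  then show ?thesis
    using \<open>r < n\<close> by (simp add: idx_def)
qed

lemma idx_cases:
  assumes "q \<in> {1..m * n}"
  obtains c r where "c < m" "r < n" "q = idx c r"
proof
  show "(q - 1) mod n < n"
    using n_pos by simp
  show "(q - 1) div n < m"
    using assms by (intro less_mult_imp_div_less) auto
  show "q = idx ((q - 1) div n) ((q - 1) mod n)"
    using assms by (simp add: idx_def)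
qed

lemma pixel_idx:
  assumes "r < n"
  shows "pixel n (idx c r) = {real c<..<real c + 1} \<times> {real r<..<real r + 1}"
  using assms by (simp add: pixel_def idx_def Let_def add.commute[of 1])

lemma closure_pixel_idx:
  assumes "r < n"
  shows "closure (pixel n (idx c r)) = {real c..real c + 1} \<times> {real r..real r + 1}"
  unfolding pixel_idx[OF assms] closure_Times by simp

text \<open>\<open>side1\<close> is the pixel above, respectively to the left of, the segment
  \<open>seg l a\<close>, and \<open>side2\<close> the one below, respectively to the right.\<close>

definition side1 :: "nat \<Rightarrow> nat \<Rightarrow> nat" where
  "side1 l a = (if l < n then idx a (l - 1) else idx (l - n) a)"

definition side2 :: "nat \<Rightarrow> nat \<Rightarrow> nat" where
  "side2 l a = (if l < n then idx a l else idx (l + 1 - n) a)"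

lemma side_horizontal: "b < n \<Longrightarrow> side1 b a = idx a (b - 1)" "b < n \<Longrightarrow> side2 b a = idx a b"
  by (simp_all add: side1_def side2_def)

lemma side_vline: "1 \<le> a \<Longrightarrow> side1 (vline a) b = idx (a - 1) b" "1 \<le> a \<Longrightarrow> side2 (vline a) b = idx a b"
proof -
  assume a: "1 \<le> a"
  then have "vline a - n = a - 1"
    using vline_offset[of a] by linarith
  then show "side1 (vline a) b = idx (a - 1) b" "side2 (vline a) b = idx a b"
    using a vline_not_less vline_offset[of a] by (simp_all add: side1_def side2_def)
qed

lemma sides_in:
  assumes "l \<in> lines m n" "a < len l"
  shows "side1 l a \<in> {1..m * n}" "side2 l a \<in> {1..m * n}" "side1 l a \<noteq> side2 l a"
proof -
  have "side1 l a \<in> {1..m * n} \<and> side2 l a \<in> {1..m * n} \<and> side1 l a \<noteq> side2 l a"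
    using assms(1)
  proof (cases rule: lines_cases)
    case horizontal
    then have "l - 1 < n" "l - 1 \<noteq> l"
      by auto
    then show ?thesis
      using horizontal assms(2) idx_in[of a "l - 1"] idx_in[of a l] by (simp add: side_horizontal len_horizontal idx_eq_iff)
  next
    case (vertical d)
    then have "d - 1 < m" "d - 1 \<noteq> d"
      by auto
    then show ?thesis
      using vertical assms(2) idx_in[of "d - 1" a] idx_in[of d a] by (simp add: side_vline len_vline idx_eq_iff)
  qed
  then show "side1 l a \<in> {1..m * n}" "side2 l a \<in> {1..m * n}" "side1 l a \<noteq> side2 l a"
    by auto
qed

lemma seg_subset_closure_pixel_iff:
  assumes l: "l \<in> lines m n" and a: "a < len l" and q: "q \<in> {1..m * n}"
  shows "seg l a \<subseteq> closure (pixel n q) \<longleftrightarrow> q = side1 l a \<or> q = side2 l a"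
proof -
  obtain c r where cr: "c < m" "r < n" "q = idx c r"
    using idx_cases[OF q] .
  from l show ?thesis
  proof (cases rule: lines_cases)
    case horizontal
    have "seg l a \<subseteq> closure (pixel n q) \<longleftrightarrow> c = a \<and> (r = l - 1 \<or> r = l)"
      using horizontal cr by (auto simp: closure_pixel_idx seg_horizontal times_subset_iff)
    also have "\<dots> \<longleftrightarrow> q = side1 l a \<or> q = side2 l a"
      using horizontal cr by (auto simp: side_horizontal idx_eq_iff)
    finally show ?thesis .
  next
    case (vertical d)
    have "seg l a \<subseteq> closure (pixel n q) \<longleftrightarrow> r = a \<and> (c = d - 1 \<or> c = d)"
      using vertical cr by (auto simp: closure_pixel_idx seg_vline times_subset_iff)
    also have "\<dots> \<longleftrightarrow> q = side1 l a \<or> q = side2 l a"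
      using vertical cr a by (auto simp: side_vline idx_eq_iff len_vline)
    finally show ?thesis .
  qed
qed

section \<open>Faces and the pixels they contain\<close>

lemma finite_segments: "finite (segments m n)"
  unfolding segments_eq by (simp add: lines_def)

lemma closed_Union_graph:
  assumes "\<gamma> \<subseteq> segments m n"
  shows "closed (\<Union>\<gamma>)"
proof (rule closed_Union)
  show "finite \<gamma>"
    using assms finite_segments by (rule finite_subset)
  show "\<forall>s\<in>\<gamma>. closed s"
    using assms by (auto simp: segments_def closed_segment)
qed

lemma open_domain_diff:
  assumes "\<gamma> \<subseteq> segments m n"
  shows "open (domain m n - \<Union>\<gamma>)"
  using closed_Union_graph[OF assms] by (auto simp: domain_def open_Times)

lemma pixel_disjoint_seg:
  assumes l: "l \<in> lines m n" and q: "q \<in> {1..m * n}"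
  shows "pixel n q \<inter> seg l a = {}"
proof -
  obtain c r where cr: "c < m" "r < n" "q = idx c r"
    using idx_cases[OF q] .
  from l show ?thesis
    by (cases rule: lines_cases) (auto simp: cr pixel_idx seg_horizontal seg_vline)
qed

lemma pixel_subset_domain_diff:
  assumes \<gamma>: "\<gamma> \<subseteq> segments m n" and q: "q \<in> {1..m * n}"
  shows "pixel n q \<subseteq> domain m n - \<Union>\<gamma>"
proof -
  obtain c r where cr: "c < m" "r < n" "q = idx c r"
    using idx_cases[OF q] .
  then have "real c + 1 \<le> real m" "real r + 1 \<le> real n"
    by linarith+
  then have "pixel n q \<subseteq> domain m n"
    by (auto simp: cr pixel_idx domain_def)
  moreover have "pixel n q \<inter> \<Union>\<gamma> = {}"
    using \<gamma> pixel_disjoint_seg[OF _ q] by (fastforce simp: segments_eq)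
  ultimately show ?thesis by blast
qed

lemma connected_pixel: "connected (pixel n q)"
  by (simp add: pixel_def Let_def connected_Times)

lemma pixel_nonempty: "pixel n q \<noteq> {}"
  by (simp add: pixel_def Let_def)

lemma pixel_subset_face:
  assumes \<gamma>: "\<gamma> \<subseteq> segments m n" and q: "q \<in> {1..m * n}"
    and F: "F \<in> faces m n \<gamma>" "F \<inter> pixel n q \<noteq> {}"
  shows "pixel n q \<subseteq> F"
  using F unfolding faces_def
  by (intro components_maximal[OF _ connected_pixel pixel_subset_domain_diff[OF \<gamma> q]]) auto

lemma ex1_face:
  assumes \<gamma>: "\<gamma> \<subseteq> segments m n" and q: "q \<in> {1..m * n}"
  shows "\<exists>!F. F \<in> faces m n \<gamma> \<and> pixel n q \<subseteq> F"
proof -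
  have "\<exists>F. F \<in> faces m n \<gamma> \<and> pixel n q \<subseteq> F"
    unfolding faces_def
    using exists_component_superset[OF pixel_subset_domain_diff[OF \<gamma> q] _ connected_pixel]
      pixel_subset_domain_diff[OF \<gamma> q] pixel_nonempty by blast
  moreover have "F = G" if "F \<in> faces m n \<gamma> \<and> pixel n q \<subseteq> F" "G \<in> faces m n \<gamma> \<and> pixel n q \<subseteq> G" for F G
    using that pixel_nonempty[of q] components_nonoverlap[of F "domain m n - \<Union>\<gamma>" G]
    unfolding faces_def by blast
  ultimately show ?thesis by blast
qed

definition pixel_face :: "graph \<Rightarrow> nat \<Rightarrow> point set" where
  "pixel_face \<gamma> q = (THE F. F \<in> faces m n \<gamma> \<and> pixel n q \<subseteq> F)"

lemma pixel_face:
  assumes "\<gamma> \<subseteq> segments m n" "q \<in> {1..m * n}"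
  shows "pixel_face \<gamma> q \<in> faces m n \<gamma>" "pixel n q \<subseteq> pixel_face \<gamma> q"
  using theI'[OF ex1_face[OF assms]] unfolding pixel_face_def by auto

lemma pixel_face_eqI:
  assumes "\<gamma> \<subseteq> segments m n" "q \<in> {1..m * n}" "F \<in> faces m n \<gamma>" "pixel n q \<subseteq> F"
  shows "pixel_face \<gamma> q = F"
  using ex1_face[OF assms(1,2)] pixel_face[OF assms(1,2)] assms(3,4) by blast

lemma domain_covered:
  assumes "z \<in> domain m n"
  obtains q where "q \<in> {1..m * n}" "z \<in> closure (pixel n q)"
proof -
  obtain u v where z: "z = (u, v)" "0 < u" "u < real m" "0 < v" "v < real n"
    using assms by (cases z) (auto simp: domain_def)
  define c r where "c = nat \<lfloor>u\<rfloor>" and "r = nat \<lfloor>v\<rfloor>"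
  have "real c \<le> u" "u < real c + 1" "real r \<le> v" "v < real r + 1"
    using z by (auto simp: c_def r_def)
  moreover from this have "c < m" "r < n"
    using z by linarith+
  ultimately show ?thesis
    using that[of "idx c r"] idx_in by (auto simp: closure_pixel_idx z)
qed

text \<open>A face is open and meets the closure of some pixel, hence the pixel itself.\<close>

lemma face_contains_pixel:
  assumes \<gamma>: "\<gamma> \<subseteq> segments m n" and F: "F \<in> faces m n \<gamma>"
  obtains q where "q \<in> {1..m * n}" "pixel n q \<subseteq> F"
proof -
  have "open F"
    using F open_domain_diff[OF \<gamma>] unfolding faces_def by (rule open_components[rotated])
  obtain z where z: "z \<in> F" "z \<in> domain m n"
    using F in_components_nonempty in_components_subset unfolding faces_def by blast
  then obtain q where q: "q \<in> {1..m * n}" "z \<in> closure (pixel n q)"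
    using domain_covered by blast
  then have "F \<inter> pixel n q \<noteq> {}"
    using open_Int_closure_eq_empty[OF \<open>open F\<close>, of "pixel n q"] z by blast
  then show ?thesis
    using that q pixel_subset_face[OF \<gamma> q(1) F] by blast
qed

text \<open>The open rectangle formed by the two pixels and the open segment between them is
  connected and meets no other segment of the grid. If this segment is absent, the rectangle avoids
  the graph and lies in one face.\<close>

lemma sides_same_face:
  assumes \<gamma>: "\<gamma> \<subseteq> segments m n" and l: "l \<in> lines m n" "a < len l" and s: "seg l a \<notin> \<gamma>"
  shows "pixel_face \<gamma> (side1 l a) = pixel_face \<gamma> (side2 l a)"
proof -
  have "\<exists>R. connected R \<and> R \<subseteq> domain m n \<and> pixel n (side1 l a) \<subseteq> R \<and> pixel n (side2 l a) \<subseteq> R \<and>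
      (\<forall>l'\<in>lines m n. \<forall>a'. seg l' a' \<inter> R \<noteq> {} \<longrightarrow> l' = l \<and> a' = a)"
    using l(1)
  proof (cases rule: lines_cases)
    case horizontal
    define R where "R = {real a<..<real a + 1} \<times> {real l - 1<..<real l + 1}"
    have "connected R"
      by (simp add: R_def connected_Times)
    moreover have "real l + 1 \<le> real n" "real a + 1 \<le> real m" "0 \<le> real l - 1"
      using horizontal l(2) by (auto simp: len_horizontal)
    then have "R \<subseteq> domain m n"
      by (auto simp: R_def domain_def)
    moreover have "pixel n (side1 l a) \<subseteq> R" "pixel n (side2 l a) \<subseteq> R"
      using horizontal by (auto simp: R_def side_horizontal pixel_idx of_nat_diff)
    moreover have "l' = l \<and> a' = a" if l': "l' \<in> lines m n" and ne: "seg l' a' \<inter> R \<noteq> {}" for l' a'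
      using l'
    proof (cases rule: lines_cases)
      case h: horizontal
      obtain u v where "(u, v) \<in> seg l' a'" "(u, v) \<in> R"
        using ne by auto
      then have "real l - 1 < real l'" "real l' < real l + 1" "real a' < real a + 1" "real a < real a' + 1"
        using h by (auto simp: R_def seg_horizontal)
      then show ?thesis by linarith
    next
      case (vertical d)
      then show ?thesis using ne by (auto simp: R_def seg_vline)
    qed
    ultimately show ?thesis by blast
  next
    case (vertical d)
    define R where "R = {real d - 1<..<real d + 1} \<times> {real a<..<real a + 1}"
    have "connected R"
      by (simp add: R_def connected_Times)
    moreover have "real d + 1 \<le> real m" "real a + 1 \<le> real n" "0 \<le> real d - 1"
      using vertical l(2) by (auto simp: len_vline)
    then have "R \<subseteq> domain m n"
      by (auto simp: R_def domain_def)
    moreover have "pixel n (side1 l a) \<subseteq> R" "pixel n (side2 l a) \<subseteq> R"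
      using vertical l(2) by (auto simp: R_def side_vline pixel_idx of_nat_diff len_vline)
    moreover have "l' = l \<and> a' = a" if l': "l' \<in> lines m n" and ne: "seg l' a' \<inter> R \<noteq> {}" for l' a'
      using l'
    proof (cases rule: lines_cases)
      case horizontal
      then show ?thesis using ne by (auto simp: R_def seg_horizontal)
    next
      case v: (vertical d')
      obtain u v where "(u, v) \<in> seg l' a'" "(u, v) \<in> R"
        using ne by auto
      then have "real d - 1 < real d'" "real d' < real d + 1" "real a' < real a + 1" "real a < real a' + 1"
        using v by (auto simp: R_def seg_vline)
      then have "d' = d" "a' = a" by linarith+
      then show ?thesis using v vertical by simp
    qed
    ultimately show ?thesis by blast
  qed
  then obtain R where R: "connected R" "R \<subseteq> domain m n" "pixel n (side1 l a) \<subseteq> R" "pixel n (side2 l a) \<subseteq> R"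
    "\<And>l' a'. l' \<in> lines m n \<Longrightarrow> seg l' a' \<inter> R \<noteq> {} \<Longrightarrow> l' = l \<and> a' = a"
    by blast
  have "R \<inter> \<Union>\<gamma> = {}"
    using \<gamma> s R(5) by (fastforce simp: segments_eq)
  then have sub: "R \<subseteq> domain m n - \<Union>\<gamma>"
    using R(2) by blast
  let ?F = "pixel_face \<gamma> (side1 l a)"
  note f1 = pixel_face[OF \<gamma> sides_in(1)[OF l]]
  have "R \<subseteq> ?F"
    using f1 R(3) pixel_nonempty[of "side1 l a"] unfolding faces_def
    by (intro components_maximal[OF _ R(1) sub]) auto
  then show ?thesis
    using pixel_face_eqI[OF \<gamma> sides_in(2)[OF l] f1(1)] R(4) by auto
qed

section \<open>From an array of colours back to the coloured graph\<close>

definition graph_of :: "(nat \<Rightarrow> nat) \<Rightarrow> graph" where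
  "graph_of x = {seg l a |l a. l \<in> lines m n \<and> a < len l \<and> x (side1 l a) \<noteq> x (side2 l a)}"

lemma graph_of_subset: "graph_of x \<subseteq> segments m n"
  by (auto simp: graph_of_def segments_eq)

lemma seg_in_graph_of_iff:
  assumes "l \<in> lines m n" "a < len l"
  shows "seg l a \<in> graph_of x \<longleftrightarrow> x (side1 l a) \<noteq> x (side2 l a)"
  using assms unfolding graph_of_def mem_Collect_eq by (metis seg_eq_iff)

lemma hor_graph_of:
  assumes "a < m" "b \<in> {1..<n}"
  shows "hor (graph_of x) a b \<longleftrightarrow> x (idx a (b - 1)) \<noteq> x (idx a b)"
  using seg_in_graph_of_iff[OF horizontal_in_lines[OF assms(2)], of a x] assms
  by (simp add: hor_def len_horizontal side_horizontal)

lemma ver_graph_of: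
  assumes "a \<in> {1..<m}" "b < n"
  shows "ver (graph_of x) a b \<longleftrightarrow> x (idx (a - 1) b) \<noteq> x (idx a b)"
  using seg_in_graph_of_iff[OF vline_in_lines[OF assms(1)], of b x] assms
  by (simp add: ver_def len_vline side_vline)

text \<open>The two pixels may touch only at a corner. Passing from \<open>(c, r)\<close> to
  \<open>(c', r')\<close> through \<open>(c', r)\<close>, at least one of the two moves changes the
  colour, and the segment crossed by that move contains \<open>z\<close>.\<close>

lemma closure_pixels_differ:
  assumes p: "p \<in> {1..m * n}" and q: "q \<in> {1..m * n}" and "x p \<noteq> x q"
    and z: "z \<in> closure (pixel n p)" "z \<in> closure (pixel n q)"
  shows "z \<in> \<Union>(graph_of x)"
proof -
  obtain c r where cr: "c < m" "r < n" "p = idx c r"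
    using idx_cases[OF p] .
  obtain c' r' where cr': "c' < m" "r' < n" "q = idx c' r'"
    using idx_cases[OF q] .
  obtain u v where uv: "z = (u, v)"
    by fastforce
  have u: "u \<in> {real c..real c + 1}" "u \<in> {real c'..real c' + 1}"
    and v: "v \<in> {real r..real r + 1}" "v \<in> {real r'..real r' + 1}"
    using z cr cr' by (auto simp: closure_pixel_idx uv)
  have vertical: "z \<in> \<Union>(graph_of x)"
    if "x (idx d r) \<noteq> x (idx (d + 1) r)" "d + 1 < m" "u = real d + 1" for d
  proof -
    have "seg (vline (d + 1)) r \<in> graph_of x"
      using that cr ver_graph_of[of "d + 1" r x] by (simp add: ver_def)
    moreover have "z \<in> seg (vline (d + 1)) r"
      using that v by (simp add: seg_vline uv)
    ultimately show ?thesis by blast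
  qed
  have horizontal: "z \<in> \<Union>(graph_of x)"
    if "x (idx c' s) \<noteq> x (idx c' (s + 1))" "s + 1 < n" "v = real s + 1" for s
  proof -
    have "seg (s + 1) c' \<in> graph_of x"
      using that cr' hor_graph_of[of c' "s + 1" x] by (simp add: hor_def)
    moreover have "z \<in> seg (s + 1) c'"
      using that u by (simp add: seg_horizontal uv)
    ultimately show ?thesis by blast
  qed
  have "c' = c \<or> c' = c + 1 \<or> c = c' + 1" "r' = r \<or> r' = r + 1 \<or> r = r' + 1"
    using u v by auto
  moreover have "x (idx c r) \<noteq> x (idx c' r) \<or> x (idx c' r) \<noteq> x (idx c' r')"
    using assms(3) cr cr' by auto
  ultimately show ?thesis
    using vertical[of c] vertical[of c'] horizontal[of r] horizontal[of r'] cr cr' u v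
    by (elim disjE) auto
qed

text \<open>Otherwise the closed pixels of the colour of \<open>p\<close> and those of all other
  colours give two closed sets separating the connected set \<open>F\<close>: by
  \<open>closure_pixels_differ\<close> they meet only on the graph.\<close>

lemma same_face_same_colour:
  assumes p: "p \<in> {1..m * n}" and q: "q \<in> {1..m * n}" and F: "F \<in> faces m n (graph_of x)"
    and sub: "pixel n p \<subseteq> F" "pixel n q \<subseteq> F"
  shows "x p = x q"
proof (rule ccontr)
  assume ne: "x p \<noteq> x q"
  define U where "U = (\<Union>i\<in>{i \<in> {1..m * n}. x i = x p}. closure (pixel n i))"
  define V where "V = (\<Union>i\<in>{i \<in> {1..m * n}. x i \<noteq> x p}. closure (pixel n i))"
  have conn: "connected F" and F': "F \<subseteq> domain m n - \<Union>(graph_of x)"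
    using F in_components_connected in_components_subset unfolding faces_def by blast+
  have "closed U" "closed V"
    by (auto simp: U_def V_def)
  moreover have "F \<subseteq> U \<union> V"
  proof
    fix z assume "z \<in> F"
    then obtain i where "i \<in> {1..m * n}" "z \<in> closure (pixel n i)"
      using F' domain_covered by blast
    then show "z \<in> U \<union> V"
      by (cases "x i = x p") (auto simp: U_def V_def)
  qed
  moreover have "U \<inter> V \<inter> F = {}"
  proof -
    have "z \<in> \<Union>(graph_of x)" if z: "z \<in> U" "z \<in> V" for z
    proof -
      obtain i j where "i \<in> {1..m * n}" "j \<in> {1..m * n}" "x i \<noteq> x j"
        "z \<in> closure (pixel n i)" "z \<in> closure (pixel n j)"
        using z unfolding U_def V_def by auto
      then show ?thesis
        by (rule closure_pixels_differ)
    qed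
    then show ?thesis
      using F' by blast
  qed
  moreover have "pixel n p \<subseteq> U" "pixel n q \<subseteq> V"
    using p q ne closure_subset[of "pixel n p"] closure_subset[of "pixel n q"]
    unfolding U_def V_def by auto
  then have "U \<inter> F \<noteq> {}" "V \<inter> F \<noteq> {}"
    using sub pixel_nonempty[of p] pixel_nonempty[of q] by blast+
  ultimately show False
    using conn unfolding connected_closed by blast
qed

text \<open>The choice of the pixel does not matter, by \<open>same_face_same_colour\<close>. The
  restriction to the faces makes the function extensional, as \<open>admissible\<close>
  demands.\<close>

definition colouring_of :: "(nat \<Rightarrow> nat) \<Rightarrow> point set \<Rightarrow> nat" where
  "colouring_of x = (\<lambda>F\<in>faces m n (graph_of x). x (SOME q. q \<in> {1..m * n} \<and> pixel n q \<subseteq> F))"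

lemma colouring_of_eq:
  assumes F: "F \<in> faces m n (graph_of x)" and q: "q \<in> {1..m * n}" "pixel n q \<subseteq> F"
  shows "colouring_of x F = x q"
proof -
  define q' where "q' = (SOME q. q \<in> {1..m * n} \<and> pixel n q \<subseteq> F)"
  have "q' \<in> {1..m * n} \<and> pixel n q' \<subseteq> F"
    unfolding q'_def by (rule someI[of _ q]) (use q in simp)
  then show ?thesis
    using same_face_same_colour[OF _ q(1) F _ q(2), of q'] F by (simp add: colouring_of_def q'_def)
qed

lemma dual_apply:
  "dual m n (\<gamma>, \<phi>) = (\<lambda>q\<in>{1..m * n}. \<phi> (pixel_face \<gamma> q))"
  by (simp add: dual_def pixel_face_def)

text \<open>Different lines meet only at nodes inside the domain, so a frontier point lies on one
  line and belongs only to the first or the last segment of it.\<close>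

lemma degree_boundary_vertex:
  assumes \<gamma>: "\<gamma> \<subseteq> segments m n" and p: "p \<in> boundary_vertices m n \<gamma>"
  shows "degree \<gamma> p = 1"
proof -
  obtain l a where l: "l \<in> lines m n" "a < len l" "seg l a \<in> \<gamma>" "p \<in> seg l a" and fr: "p \<in> frontier (domain m n)"
    using p \<gamma> by (fastforce simp: boundary_vertices_def segments_eq)
  then obtain t where t: "p = on_axis l t" "t \<in> {real a..real a + 1}"
    by (auto simp: seg_def)
  have ends: "t = 0 \<or> t = real (len l)"
    using on_axis_frontier_iff[OF l(1), of t] fr t l(2) by simp
  have "s = seg l a" if "s \<in> \<gamma>" "p \<in> s" for s
  proof -
    obtain l' a' where l': "l' \<in> lines m n" "a' < len l'" "s = seg l' a'"
      using \<open>s \<in> \<gamma>\<close> \<gamma> by (fastforce simp: segments_eq)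
    have "l' = l"
    proof (rule ccontr)
      assume "l' \<noteq> l"
      moreover have "p \<in> line n l" "p \<in> line n l'"
        using l l' that by (auto simp: seg_def line_eq)
      ultimately have "p \<in> nodes m n"
        using l l' by (auto simp: nodes_def)
      then obtain c where "c \<in> {1..<len l}" "t = real c"
        using on_axis_nodes_iff[OF l(1), of t] t by auto
      then show False
        using ends by auto
    qed
    then have "t \<in> {real a'..real a' + 1}" "a' < len l"
      using that l' t by auto
    then have "a' = a"
      using ends t(2) l(2) by auto
    then show ?thesis
      using l' \<open>l' = l\<close> by simp
  qed
  then have "{s \<in> \<gamma>. p \<in> s} = {seg l a}"
    using l by blast
  then show ?thesis
    by (simp add: degree_def)
qed

lemma dual_graph_of:
  assumes x: "x \<in> arrays m n k"
  shows "dual m n (graph_of x, colouring_of x) = x"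
proof -
  have "colouring_of x (pixel_face (graph_of x) q) = x q" if "q \<in> {1..m * n}" for q
    using colouring_of_eq pixel_face[OF graph_of_subset that] that by blast
  then show ?thesis
    using x unfolding dual_apply arrays_def
    by (intro extensionalityI[of _ "{1..m * n}"] restrict_extensional) (simp_all add: PiE_def)
qed

lemma graph_of_admissible:
  assumes x: "x \<in> arrays m n k"
  shows "(graph_of x, colouring_of x) \<in> admissible m n k"
proof -
  have "degree (graph_of x) p \<in> {2, 3, 4}" if "p \<in> interior_vertices m n (graph_of x)" for p
  proof -
    have "p \<in> nodes m n" "p \<in> \<Union>(graph_of x)"
      using that by (auto simp: interior_vertices_def)
    then obtain a b where ab: "p = (real a, real b)" "a \<in> {1..<m}" "b \<in> {1..<n}"
      by (auto simp: nodes_eq)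
    have lt: "a < m" "a - 1 < m" "b < n" "b - 1 < n"
      using ab by auto
    \<comment> \<open>Degree 1 is impossible: on a walk around the node the colour of the four
      pixels cannot change exactly once.\<close>
    show ?thesis
      using \<open>p \<in> \<Union>(graph_of x)\<close>
      unfolding ab(1) degree_node[OF graph_of_subset ab(2,3)] node_in_graph_iff[OF graph_of_subset ab(2,3)]
        hor_graph_of[OF lt(1) ab(3)] hor_graph_of[OF lt(2) ab(3)]
        ver_graph_of[OF ab(2) lt(3)] ver_graph_of[OF ab(2) lt(4)]
      by (auto simp: of_bool_def)
  qed
  moreover have "colouring_of x \<in> faces m n (graph_of x) \<rightarrow>\<^sub>E {1..k}"
  proof (rule PiE_I)
    fix F assume F: "F \<in> faces m n (graph_of x)"
    then obtain q where q: "q \<in> {1..m * n}" "pixel n q \<subseteq> F"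
      using face_contains_pixel[OF graph_of_subset] by blast
    then show "colouring_of x F \<in> {1..k}"
      using colouring_of_eq[OF F q] x by (auto simp: arrays_def)
  qed (simp add: colouring_of_def)
  moreover have "colouring_of x F \<noteq> colouring_of x G" if adj: "adjacent m n (graph_of x) F G" for F G
  proof -
    obtain s p q where s: "s \<in> graph_of x" "p \<in> {1..m * n}" "q \<in> {1..m * n}" "p \<noteq> q"
      "s \<subseteq> closure (pixel n p)" "s \<subseteq> closure (pixel n q)" "pixel n p \<subseteq> F" "pixel n q \<subseteq> G"
      and FG: "F \<in> faces m n (graph_of x)" "G \<in> faces m n (graph_of x)"
      using adj unfolding adjacent_def by (auto simp: Int_subset_iff)
    then obtain l a where l: "l \<in> lines m n" "a < len l" "s = seg l a" "x (side1 l a) \<noteq> x (side2 l a)"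
      by (auto simp: graph_of_def)
    then have "x p \<noteq> x q"
      using s seg_subset_closure_pixel_iff[OF l(1,2)] by metis
    then show ?thesis
      using colouring_of_eq FG s by metis
  qed
  ultimately show ?thesis
    using degree_boundary_vertex[OF graph_of_subset] graph_of_subset
    by (auto simp: admissible_def)
qed

text \<open>The array determines the graph: a segment of the graph separates adjacent faces, whose
  colours differ, and a missing segment has both its sides in one face. Every face contains a pixel,
  so the array also determines the colouring.\<close>

lemma bij_betw_dual: "bij_betw (dual m n) (admissible m n k) (arrays m n k)"
proof (rule bij_betw_byWitness[where f' = "\<lambda>x. (graph_of x, colouring_of x)"])
  show "dual m n ` admissible m n k \<subseteq> arrays m n k"
  proof (rule image_subsetI)
    fix g assume "g \<in> admissible m n k"
    then obtain \<gamma> \<phi> where g: "g = (\<gamma>, \<phi>)" "\<gamma> \<subseteq> segments m n" "\<phi> \<in> faces m n \<gamma> \<rightarrow>\<^sub>E {1..k}"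
      by (auto simp: admissible_def)
    then show "dual m n g \<in> arrays m n k"
      using pixel_face(1)[OF g(2)] unfolding arrays_def g(1) dual_apply
      by (intro restrict_PiE[THEN iffD2] Pi_I) (metis PiE_mem)
  qed
  show "\<forall>x\<in>arrays m n k. dual m n (graph_of x, colouring_of x) = x"
    by (simp add: dual_graph_of)
  show "\<forall>g\<in>admissible m n k. (graph_of (dual m n g), colouring_of (dual m n g)) = g"
  proof
    fix g assume "g \<in> admissible m n k"
    then obtain \<gamma> \<phi> where g: "g = (\<gamma>, \<phi>)" and \<gamma>: "\<gamma> \<subseteq> segments m n"
      and \<phi>: "\<phi> \<in> faces m n \<gamma> \<rightarrow>\<^sub>E {1..k}"
      and adj: "\<And>F G. adjacent m n \<gamma> F G \<Longrightarrow> \<phi> F \<noteq> \<phi> G"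
      by (auto simp: admissible_def)
    define x where "x = dual m n g"
    have x: "x q = \<phi> (pixel_face \<gamma> q)" if "q \<in> {1..m * n}" for q
      using that by (simp add: x_def g dual_apply)
    have "seg l a \<in> \<gamma> \<longleftrightarrow> x (side1 l a) \<noteq> x (side2 l a)" if l: "l \<in> lines m n" "a < len l" for l a
    proof
      assume "seg l a \<in> \<gamma>"
      then have "adjacent m n \<gamma> (pixel_face \<gamma> (side1 l a)) (pixel_face \<gamma> (side2 l a))"
        using sides_in[OF l] pixel_face[OF \<gamma>] seg_subset_closure_pixel_iff[OF l]
        unfolding adjacent_def by (metis Int_subset_iff)
      then show "x (side1 l a) \<noteq> x (side2 l a)"
        using adj x sides_in[OF l] by simp
    next
      assume "x (side1 l a) \<noteq> x (side2 l a)"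
      then show "seg l a \<in> \<gamma>"
        using sides_same_face[OF \<gamma> l] x sides_in[OF l] by metis
    qed
    then have \<gamma>x: "graph_of x = \<gamma>"
      using \<gamma> unfolding graph_of_def segments_eq by (fastforce simp: image_iff)
    have "colouring_of x F = \<phi> F" for F
    proof (cases "F \<in> faces m n \<gamma>")
      case True
      then obtain q where q: "q \<in> {1..m * n}" "pixel n q \<subseteq> F"
        using face_contains_pixel[OF \<gamma>] by blast
      then have "colouring_of x F = x q"
        using colouring_of_eq[of F x q] \<gamma>x True by simp
      then show ?thesis
        using x[OF q(1)] pixel_face_eqI[OF \<gamma> q(1) True q(2)] by simp
    next
      case False
      then show ?thesis
        using PiE_arb[OF \<phi> False] by (simp add: colouring_of_def \<gamma>x)
    qed
    then have "colouring_of x = \<phi>"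
      by (rule ext)
    then show "(graph_of (dual m n g), colouring_of (dual m n g)) = g"
      unfolding x_def[symmetric] \<gamma>x by (simp add: g)
  qed
  show "(\<lambda>x. (graph_of x, colouring_of x)) ` arrays m n k \<subseteq> admissible m n k"
    using graph_of_admissible by blast
qed

lemma fst_admissible:
  assumes "g \<in> admissible m n k"
  shows "fst g = graph_of (dual m n g)"
proof -
  have x: "dual m n g \<in> arrays m n k"
    using bij_betw_apply[OF bij_betw_dual assms] .
  have "g = (graph_of (dual m n g), colouring_of (dual m n g))"
    using bij_betw_imp_inj_on[OF bij_betw_dual[of k]] assms graph_of_admissible[OF x] dual_graph_of[OF x]
    by (metis inj_onD)
  then show ?thesis
    by (metis fst_conv)
qed

end

section \<open>The weight as a product over nodes\<close>

lemma sum_if_eq: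
  fixes u v :: real
  assumes "finite A" "p \<in> A"
  shows "(\<Sum>s\<in>A. if s = p then u else v) = u + (real (card A) - 1) * v"
proof -
  have "(\<Sum>s\<in>A. if s = p then u else v) = u + (\<Sum>s\<in>A - {p}. if s = p then u else v)"
    using sum.remove[OF assms, of "\<lambda>s. if s = p then u else v"] by simp
  also have "(\<Sum>s\<in>A - {p}. if s = p then u else v) = (\<Sum>s\<in>A - {p}. v)"
    by (intro sum.cong) auto
  also have "\<dots> = (real (card A) - 1) * v"
    using assms card_gt_0_iff[of A] by (auto simp: of_nat_diff)
  finally show ?thesis .
qed

lemma sum_if_eq_if_eq:
  fixes u v w :: real
  assumes "finite A" "p \<in> A" "q \<in> A" "p \<noteq> q"
  shows "(\<Sum>s\<in>A. if s = p then u else if s = q then v else w) = u + v + (real (card A) - 2) * w"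
proof -
  have "(\<Sum>s\<in>A. if s = p then u else if s = q then v else w) =
      (\<Sum>s\<in>A. (if s = p then u - w else 0) + (if s = q then v else w))"
    using assms by (intro sum.cong) auto
  also have "\<dots> = (u - w) + (v + (real (card A) - 1) * w)"
    using assms by (simp add: sum.distrib sum_if_eq)
  finally show ?thesis
    by (simp add: algebra_simps)
qed

text \<open>Without \<open>- \<infinity>\<close> no infinities cancel, and a summand
  \<open>\<infinity>\<close> makes both sides 0.\<close>

lemma exp_minus_add:
  assumes "s \<noteq> - \<infinity>" "t \<noteq> - \<infinity>"
  shows "exp_minus (s + t) = exp_minus s * exp_minus t"
  using assms by (cases s; cases t) (auto simp: exp_minus_def mult_exp_exp)

text \<open>For \<open>x = 0\<close> the convention \<open>0 * \<infinity> = 0\<close> matches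
  \<open>0 ^ 0 = 1\<close>, while a positive \<open>N\<close> gives potential
  \<open>\<infinity>\<close> and weight 0.\<close>

lemma exp_minus_neg_times_elog:
  assumes "0 \<le> x"
  shows "exp_minus (- (ereal (real N) * elog x)) = x ^ N" "- (ereal (real N) * elog x) \<noteq> - \<infinity>"
  using assms
  by (cases "x = 0"; cases "N = 0"; force simp: exp_minus_def elog_def exp_of_nat_mult)+

lemma exp_minus_times_elog:
  assumes "0 < x"
  shows "exp_minus (ereal (real N) * elog x) = (1 / x) ^ N" "ereal (real N) * elog x \<noteq> - \<infinity>"
  using assms
  by (simp_all add: exp_minus_def elog_def exp_of_nat_mult exp_minus power_one_over inverse_eq_divide)

lemma exp_minus_sum_elog:
  assumes "finite A" "\<And>a. a \<in> A \<Longrightarrow> 0 < f a"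
  shows "exp_minus (\<Sum>a\<in>A. elog (f a)) = (\<Prod>a\<in>A. 1 / f a)" "(\<Sum>a\<in>A. elog (f a)) \<noteq> - \<infinity>"
    "exp_minus (- (\<Sum>a\<in>A. elog (f a))) = (\<Prod>a\<in>A. f a)" "- (\<Sum>a\<in>A. elog (f a)) \<noteq> - \<infinity>"
proof -
  have e: "(\<Sum>a\<in>A. elog (f a)) = ereal (\<Sum>a\<in>A. ln (f a))"
  proof -
    have "elog (f a) = ereal (ln (f a))" if "a \<in> A" for a
      using assms(2)[OF that] by (simp add: elog_def)
    then show ?thesis by simp
  qed
  show "(\<Sum>a\<in>A. elog (f a)) \<noteq> - \<infinity>" "- (\<Sum>a\<in>A. elog (f a)) \<noteq> - \<infinity>"
    by (simp_all add: e)
  have "exp (\<Sum>a\<in>A. ln (f a)) = (\<Prod>a\<in>A. f a)"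
    using assms by (simp add: exp_sum)
  then show "exp_minus (\<Sum>a\<in>A. elog (f a)) = (\<Prod>a\<in>A. 1 / f a)"
    "exp_minus (- (\<Sum>a\<in>A. elog (f a))) = (\<Prod>a\<in>A. f a)"
    by (simp_all add: e exp_minus_def exp_minus inverse_eq_divide prod_dividef)
qed

lemma power_card_filter:
  fixes x :: "'a :: comm_monoid_mult"
  assumes "finite A"
  shows "x ^ card {a \<in> A. Q a} = (\<Prod>a\<in>A. if Q a then x else 1)"
  using assms by (simp add: prod.inter_filter[symmetric])

context pixel_grid
begin

lemma power_card_nodes:
  fixes x :: real
  shows "x ^ card {p \<in> nodes m n. Q p} =
    (\<Prod>a\<in>{1..<m}. \<Prod>b\<in>{1..<n}. if Q (real a, real b) then x else 1)"
proof -
  have "{p \<in> nodes m n. Q p} = (\<lambda>(a, b). (real a, real b)) `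
      {ab \<in> {1..<m} \<times> {1..<n}. Q (real (fst ab), real (snd ab))}"
    by (auto simp: nodes_eq)
  moreover have "inj_on (\<lambda>(a, b). (real a, real b)) S" for S
    by (auto simp: inj_on_def)
  ultimately have "card {p \<in> nodes m n. Q p} =
      card {ab \<in> {1..<m} \<times> {1..<n}. Q (real (fst ab), real (snd ab))}"
    by (simp add: card_image)
  then show ?thesis
    by (simp add: power_card_filter prod.cartesian_product case_prod_unfold)
qed

text \<open>Cell 0 of each line starts at the left or upper side of the domain. Any other cell
  starts at a node, and the two cells starting at the same node are grouped together.\<close>

lemma prod_lines_cells:
  fixes G :: "nat \<Rightarrow> nat \<Rightarrow> real"
  shows "(\<Prod>l\<in>lines m n. \<Prod>c\<in>{..<len l}. G l c) =
    (\<Prod>b\<in>{1..<n}. G b 0) * (\<Prod>a\<in>{1..<m}. G (vline a) 0) *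
    (\<Prod>a\<in>{1..<m}. \<Prod>b\<in>{1..<n}. G b a * G (vline a) b)"
proof -
  have split: "(\<Prod>c\<in>{..<N}. g c) = g 0 * (\<Prod>c\<in>{1..<N}. g c)" if "1 \<le> N" for N and g :: "nat \<Rightarrow> real"
  proof -
    have "{..<N} = insert 0 {1..<N}"
      using that by auto
    then show ?thesis by simp
  qed
  have "(\<Prod>l\<in>lines m n. \<Prod>c\<in>{..<len l}. G l c) =
      (\<Prod>b\<in>{1..<n}. \<Prod>c\<in>{..<len b}. G b c) * (\<Prod>l\<in>vline ` {1..<m}. \<Prod>c\<in>{..<len l}. G l c)"
    unfolding lines_eq using vline_not_less by (intro prod.union_disjoint) auto
  also have "(\<Prod>l\<in>vline ` {1..<m}. \<Prod>c\<in>{..<len l}. G l c) =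
      (\<Prod>a\<in>{1..<m}. G (vline a) 0 * (\<Prod>b\<in>{1..<n}. G (vline a) b))"
    using n_pos by (simp add: prod.reindex inj_on_def len_vline split)
  also have "(\<Prod>b\<in>{1..<n}. \<Prod>c\<in>{..<len b}. G b c) =
      (\<Prod>b\<in>{1..<n}. G b 0 * (\<Prod>a\<in>{1..<m}. G b a))"
    using m_pos by (simp add: len_horizontal split)
  finally have "(\<Prod>l\<in>lines m n. \<Prod>c\<in>{..<len l}. G l c) =
      (\<Prod>b\<in>{1..<n}. G b 0 * (\<Prod>a\<in>{1..<m}. G b a)) *
      (\<Prod>a\<in>{1..<m}. G (vline a) 0 * (\<Prod>b\<in>{1..<n}. G (vline a) b))" .
  moreover have "(\<Prod>b\<in>{1..<n}. \<Prod>a\<in>{1..<m}. G b a) = (\<Prod>a\<in>{1..<m}. \<Prod>b\<in>{1..<n}. G b a)"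
    by (rule prod.swap)
  ultimately show ?thesis
    by (simp only: prod.distrib mult_ac)
qed

end

locale polygonal_field_params = pixel_grid +
  fixes k :: nat and \<pi> :: "nat \<Rightarrow> real" and \<alpha> :: real
  assumes k_ge_2: "2 \<le> k"
    and activity: "l \<in> lines m n \<Longrightarrow> 0 < \<pi> l \<and> \<pi> l < 1"
    and alpha_nonneg: "0 \<le> \<alpha>" and alpha_le_1: "\<alpha> \<le> 1"
begin

abbreviation K :: real where "K \<equiv> real k - 1"
abbreviation \<alpha>T :: real where "\<alpha>T \<equiv> alpha_T k \<alpha>"
abbreviation \<alpha>X :: real where "\<alpha>X \<equiv> alpha_X \<alpha>"
abbreviation eps :: real where "eps \<equiv> epsilon k \<alpha>"

lemma K_ge_1: "1 \<le> K"
  using k_ge_2 by simp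

lemma alpha_X_bounds: "0 \<le> \<alpha>X" "\<alpha>X \<le> 1"
  using alpha_nonneg alpha_le_1 by (simp_all add: alpha_X_def)

lemma alpha_T_bounds: "0 < \<alpha>T" "\<alpha>T \<le> 1"
proof -
  have "0 \<le> (real k - 2) / K * \<alpha>X"
    using k_ge_2 alpha_X_bounds by simp
  moreover have "(real k - 2) / K < 1" "0 \<le> (real k - 2) / K"
    using k_ge_2 by simp_all
  then have "(real k - 2) / K * \<alpha>X < 1"
    using alpha_X_bounds mult_left_le[of "\<alpha>X" "(real k - 2) / K"] by linarith
  ultimately show "0 < \<alpha>T" "\<alpha>T \<le> 1"
    by (simp_all add: alpha_T_def)
qed

text \<open>\<open>eps\<close> is a convex combination of \<open>\<alpha>\<close> and
  \<open>\<alpha>T\<close> with weights \<open>1 / K\<close> and \<open>(k - 2) / K\<close>.\<close>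

lemma epsilon_bounds: "0 \<le> eps" "eps \<le> 1"
proof -
  have "0 \<le> (real k - 2) / K" "1 / K + (real k - 2) / K = 1"
    using k_ge_2 by (simp_all add: divide_simps)
  moreover have "(real k - 2) / K * \<alpha>T \<le> (real k - 2) / K"
    using calculation(1) alpha_T_bounds by (intro mult_left_le) auto
  moreover have "\<alpha> / K \<le> 1 / K"
    using K_ge_1 alpha_le_1 by (simp add: divide_right_mono)
  moreover have "0 \<le> \<alpha> / K" "0 \<le> (real k - 2) / K * \<alpha>T"
    using K_ge_1 alpha_nonneg k_ge_2 alpha_T_bounds by simp_all
  ultimately show "0 \<le> eps" "eps \<le> 1"
    unfolding epsilon_def by linarith+
qed

lemma crossing_pos:
  assumes "l \<in> lines m n"
  shows "0 < 1 - eps * \<pi> l"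
proof -
  have "eps * \<pi> l \<le> 1 * \<pi> l"
    using epsilon_bounds activity[OF assms] by (intro mult_right_mono) auto
  then show ?thesis
    using activity[OF assms] by linarith
qed

lemma node_pos:
  assumes "l \<in> lines m n" "l' \<in> lines m n"
  shows "0 < 1 - \<alpha> / K * \<pi> l * \<pi> l'"
proof -
  have "\<alpha> / K \<le> 1" "0 \<le> \<alpha> / K"
    using K_ge_1 alpha_le_1 alpha_nonneg by simp_all
  then have "\<alpha> / K * \<pi> l \<le> 1 * 1" "0 \<le> \<alpha> / K * \<pi> l"
    using activity[OF assms(1)] by (intro mult_mono mult_nonneg_nonneg; simp)+
  then have "\<alpha> / K * \<pi> l * \<pi> l' \<le> 1 * \<pi> l'"
    using activity[OF assms(2)] by (intro mult_right_mono) auto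
  then show ?thesis
    using activity[OF assms(2)] by linarith
qed

text \<open>
  \<open>W\<close>, \<open>E\<close>, \<open>N\<close>, \<open>S\<close> tell which of the segments to the left, to the right, above and below are present;
  \<open>p\<close> and \<open>q\<close> are the activities of the horizontal and the vertical line. An edge or primary edge
  is accounted for at its left or upper end point.
\<close>

definition node_factor :: "bool \<Rightarrow> bool \<Rightarrow> bool \<Rightarrow> bool \<Rightarrow> real \<Rightarrow> real \<Rightarrow> real" where
  "node_factor W E N S p q =
    (let d = of_bool W + of_bool E + of_bool N + of_bool S :: nat;
         sh = W \<and> E \<and> \<not> N \<and> \<not> S; sv = N \<and> S \<and> \<not> W \<and> \<not> E
     in (if d = 2 \<and> \<not> sh \<and> \<not> sv then \<alpha> else 1) *
        (if d = 3 then K * \<alpha>T else 1) * (if d = 4 then K * \<alpha>X else 1) *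
        ((if E \<and> \<not> sh then 1 / K else 1) * (if S \<and> \<not> sv then 1 / K else 1)) *
        ((if E \<and> \<not> W then p else 1) * (if S \<and> \<not> N then q else 1)) *
        ((if sh then 1 - eps * q else 1) * (if sv then 1 - eps * p else 1)) *
        (if W \<or> E \<or> N \<or> S then 1 / (1 - \<alpha> / K * p * q) else 1))"

text \<open>No summand of the potential is \<open>- \<infinity>\<close>, so \<open>exp_minus\<close>
  turns the sum into a product term by term.\<close>

lemma exp_minus_potential:
  assumes \<gamma>: "\<gamma> \<subseteq> segments m n"
  shows "exp_minus (potential m n k \<pi> \<alpha> \<gamma>) =
    \<alpha> ^ card (V_vertices m n \<gamma>) * (K * \<alpha>T) ^ card (T_vertices m n \<gamma>) *
    (K * \<alpha>X) ^ card (X_vertices m n \<gamma>) * (1 / K) ^ card (edges m n \<gamma>) *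
    (\<Prod>l\<in>lines m n. \<Prod>c\<in>through \<gamma> l. 1 - eps * \<pi> (cross l c)) *
    (\<Prod>a\<in>{1..<m}. \<Prod>b\<in>{1..<n}. if (real a, real b) \<in> \<Union>\<gamma>
        then 1 / (1 - \<alpha> / K * \<pi> b * \<pi> (vline a)) else 1)"
proof -
  have V: "exp_minus (- (ereal (real (card (V_vertices m n \<gamma>))) * elog \<alpha>)) = \<alpha> ^ card (V_vertices m n \<gamma>)"
      "- (ereal (real (card (V_vertices m n \<gamma>))) * elog \<alpha>) \<noteq> - \<infinity>"
    by (rule exp_minus_neg_times_elog[OF alpha_nonneg])+
  have KT: "0 \<le> K * \<alpha>T" and KX: "0 \<le> K * \<alpha>X"
    using K_ge_1 alpha_T_bounds alpha_X_bounds by simp_all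
  note T = exp_minus_neg_times_elog[OF KT] and X = exp_minus_neg_times_elog[OF KX]
  have K: "0 < K"
    using K_ge_1 by simp
  note E = exp_minus_times_elog[OF K]
  define I where "I = (SIGMA l:lines m n. through \<gamma> l)"
  have fin: "finite I"
    by (auto simp: I_def lines_def)
  have "cross l c \<in> lines m n" if "l \<in> lines m n" "c \<in> through \<gamma> l" for l c
    using that through_subset(1)[OF that] vline_not_less
    by (auto elim!: lines_cases simp: cross_def len_horizontal len_vline vline_in_lines horizontal_in_lines)
  then have "(case i of (l, c) \<Rightarrow> 0 < 1 - eps * \<pi> (cross l c))" if "i \<in> I" for i
    using that crossing_pos by (auto simp: I_def)
  then have Ipos: "0 < 1 - eps * \<pi> (cross (fst i) (snd i))" if "i \<in> I" for i
    using that by (auto simp: case_prod_unfold)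
  have crossings: "(\<Sum>e\<in>edges m n \<gamma>. \<Sum>l\<in>{l \<in> lines m n. crosses n l e}. elog (1 - eps * \<pi> l)) =
      (\<Sum>i\<in>I. elog (1 - eps * \<pi> (cross (fst i) (snd i))))"
    unfolding sum_crossings[OF \<gamma>] I_def
    by (subst sum.Sigma) (auto simp: lines_def case_prod_unfold)
  note C = exp_minus_sum_elog(3,4)[OF fin Ipos]
  have Cprod: "(\<Prod>i\<in>I. 1 - eps * \<pi> (cross (fst i) (snd i))) =
      (\<Prod>l\<in>lines m n. \<Prod>c\<in>through \<gamma> l. 1 - eps * \<pi> (cross l c))"
    unfolding I_def by (subst prod.Sigma) (auto simp: lines_def case_prod_unfold)
  define J where "J = {ab \<in> {1..<m} \<times> {1..<n}. (real (fst ab), real (snd ab)) \<in> \<Union>\<gamma>}"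
  define J' where "J' = {(l1, l2). l1 \<in> lines m n \<and> l2 \<in> lines m n \<and> l1 < l2 \<and>
                              line n l1 \<inter> line n l2 \<inter> \<Union>\<gamma> \<noteq> {}}"
  \<comment> \<open>Parallel lines do not meet, and horizontal lines have smaller numbers than
    vertical ones. Hence each node arises from exactly one pair, namely
    \<open>(b, vline a)\<close>.\<close>
  have J': "J' = (\<lambda>(a, b). (b, vline a)) ` J"
  proof -
    have hh: "line n b \<inter> line n b' = {}" if "b < n" "b' < n" "b < b'" for b b'
      using that by (auto simp: line_eq on_axis_horizontal)
    have vv: "line n (vline a) \<inter> line n (vline a') = {}" if "1 \<le> a" "1 \<le> a'" "vline a < vline a'" for a a'
      using that by (auto simp: line_eq on_axis_vline)
    have hv: "line n b \<inter> line n (vline a) = {(real a, real b)}" if "b < n" "1 \<le> a" for a b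
      using that by (auto simp: line_eq on_axis_horizontal on_axis_vline)
    have "(l1, l2) \<in> J' \<longleftrightarrow> (l1, l2) \<in> (\<lambda>(a, b). (b, vline a)) ` J" for l1 l2
    proof
      assume *: "(l1, l2) \<in> J'"
      then have l: "l1 \<in> lines m n" "l2 \<in> lines m n" "l1 < l2" "line n l1 \<inter> line n l2 \<inter> \<Union>\<gamma> \<noteq> {}"
        by (auto simp: J'_def)
      from l(1) show "(l1, l2) \<in> (\<lambda>(a, b). (b, vline a)) ` J"
      proof (cases rule: lines_cases)
        case h: horizontal
        from l(2) show ?thesis
        proof (cases rule: lines_cases)
          case horizontal
          then show ?thesis using l h hh[of l1 l2] by auto
        next
          case (vertical a)
          then show ?thesis
            using l h hv[of l1 a] by (intro image_eqI[of _ _ "(a, l1)"]) (auto simp: J_def)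
        qed
      next
        case v: (vertical a)
        from l(2) show ?thesis
        proof (cases rule: lines_cases)
          case horizontal
          then show ?thesis using l v vline_not_less[of a] by auto
        next
          case (vertical a')
          then show ?thesis using l v vv[of a a'] by auto
        qed
      qed
    next
      assume "(l1, l2) \<in> (\<lambda>(a, b). (b, vline a)) ` J"
      then obtain a where a: "(a, l1) \<in> J" "l2 = vline a"
        by auto
      then have "l1 < l2"
        using vline_not_less[of a] by (auto simp: J_def)
      then show "(l1, l2) \<in> J'"
        using a hv[of l1 a] horizontal_in_lines vline_in_lines by (auto simp: J_def J'_def)
    qed
    then show ?thesis by auto
  qed
  have J'_pos: "0 < 1 - \<alpha> / K * \<pi> (fst i) * \<pi> (snd i)" if "i \<in> J'" for i
    using that node_pos by (auto simp: J'_def)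
  have finJ: "finite J'"
    unfolding J' by (simp add: J_def)
  have nodes: "(\<Sum>(l1, l2)\<in>J'. elog (1 - \<alpha> / K * \<pi> l1 * \<pi> l2)) =
      (\<Sum>i\<in>J'. elog (1 - \<alpha> / K * \<pi> (fst i) * \<pi> (snd i)))"
    by (simp add: case_prod_unfold)
  note N = exp_minus_sum_elog(1,2)[OF finJ J'_pos]
  have inj: "inj_on (\<lambda>(a, b). (b, vline a)) J"
    by (auto simp: inj_on_def)
  have Nprod: "(\<Prod>i\<in>J'. 1 / (1 - \<alpha> / K * \<pi> (fst i) * \<pi> (snd i))) =
     (\<Prod>a\<in>{1..<m}. \<Prod>b\<in>{1..<n}. if (real a, real b) \<in> \<Union>\<gamma>
        then 1 / (1 - \<alpha> / K * \<pi> b * \<pi> (vline a)) else 1)"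
    unfolding J' prod.reindex[OF inj]
    unfolding J_def prod.cartesian_product
    by (subst prod.inter_filter) (auto simp: case_prod_unfold intro!: prod.cong)
  have add_ninf: "s + t \<noteq> - \<infinity>" if "s \<noteq> - \<infinity>" "t \<noteq> - \<infinity>" for s t :: ereal
    using that by (cases s; cases t) auto
  show ?thesis
    unfolding potential_def J'_def[symmetric] minus_ereal_def crossings nodes
    by (simp only: exp_minus_add add_ninf V T X E C N Cprod Nprod not_False_eq_True simp_thms)
qed

text \<open>A segment starting at the left or upper side starts both an edge, worth
  \<open>1 / K\<close>, and a primary edge, worth the activity of its line.\<close>

definition side_factor :: "bool \<Rightarrow> real \<Rightarrow> real" where
  "side_factor B p = (if B then p / K else 1)"

text \<open>A segment starts an edge unless it leaves a straight node along the straight direction,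
  and it starts a primary edge iff the preceding segment of its line is absent. Both can be read off
  at its starting point, so every count becomes a product of local factors.\<close>

lemma weight_eq_prod:
  assumes \<gamma>: "\<gamma> \<subseteq> segments m n"
  shows "weight m n k \<pi> \<alpha> (\<gamma>, \<phi>) =
    (\<Prod>b\<in>{1..<n}. side_factor (hor \<gamma> 0 b) (\<pi> b)) *
    (\<Prod>a\<in>{1..<m}. side_factor (ver \<gamma> a 0) (\<pi> (vline a))) *
    (\<Prod>a\<in>{1..<m}. \<Prod>b\<in>{1..<n}.
       node_factor (hor \<gamma> (a - 1) b) (hor \<gamma> a b) (ver \<gamma> a (b - 1)) (ver \<gamma> a b) (\<pi> b) (\<pi> (vline a)))"
proof -
  define d where "d = (\<lambda>a b. of_bool (hor \<gamma> (a - 1) b) + of_bool (hor \<gamma> a b) +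
    of_bool (ver \<gamma> a (b - 1)) + of_bool (ver \<gamma> a b) :: nat)"
  let ?P = "\<lambda>F :: nat \<Rightarrow> nat \<Rightarrow> real. \<Prod>a\<in>{1..<m}. \<Prod>b\<in>{1..<n}. F a b"
  let ?sh = "straight_hor \<gamma>" and ?sv = "straight_ver \<gamma>"
  have iv: "interior_vertices m n \<gamma> = {p \<in> nodes m n. p \<in> \<Union>\<gamma> \<and> \<not> straight m n \<gamma> p}"
    by (auto simp: interior_vertices_def)
  have vert: "x ^ card {p \<in> interior_vertices m n \<gamma>. degree \<gamma> p = D} =
      ?P (\<lambda>a b. if d a b = D \<and> \<not> ?sh a b \<and> \<not> ?sv a b then x else 1)" if "D \<noteq> 0" for x :: real and D
  proof -
    have "x ^ card {p \<in> interior_vertices m n \<gamma>. degree \<gamma> p = D} =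
       x ^ card {p \<in> nodes m n. p \<in> \<Union>\<gamma> \<and> \<not> straight m n \<gamma> p \<and> degree \<gamma> p = D}"
      unfolding iv by (simp add: conj_assoc)
    also have "\<dots> = ?P (\<lambda>a b. if d a b = D \<and> \<not> ?sh a b \<and> \<not> ?sv a b then x else 1)"
      unfolding power_card_nodes
    proof (intro prod.cong refl if_cong)
      fix a b assume ab: "a \<in> {1..<m}" "b \<in> {1..<n}"
      show "((real a, real b) \<in> \<Union>\<gamma> \<and> \<not> straight m n \<gamma> (real a, real b) \<and> degree \<gamma> (real a, real b) = D) =
          (d a b = D \<and> \<not> ?sh a b \<and> \<not> ?sv a b)"
        unfolding node_in_graph_iff[OF \<gamma> ab] straight_node_iff[OF \<gamma> ab] degree_node[OF \<gamma> ab] d_def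
        using that by auto
    qed
    finally show ?thesis .
  qed
  have V: "\<alpha> ^ card (V_vertices m n \<gamma>) = ?P (\<lambda>a b. if d a b = 2 \<and> \<not> ?sh a b \<and> \<not> ?sv a b then \<alpha> else 1)"
    unfolding V_vertices_def by (rule vert) simp
  \<comment> \<open>Straight nodes have degree 2, so non-straightness is a genuine condition only
    for V-vertices.\<close>
  have deg: "\<not> ?sh a b \<and> \<not> ?sv a b" if "d a b = 3 \<or> d a b = 4" for a b
    using that by (auto simp: d_def straight_hor_def straight_ver_def of_bool_def split: if_splits)
  have T: "(K * \<alpha>T) ^ card (T_vertices m n \<gamma>) = ?P (\<lambda>a b. if d a b = 3 then K * \<alpha>T else 1)"
  proof -
    have "(d a b = 3 \<and> \<not> ?sh a b \<and> \<not> ?sv a b) = (d a b = 3)" for a b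
      using deg by blast
    then show ?thesis
      unfolding T_vertices_def by (subst vert) (simp_all only: zero_neq_numeral not_False_eq_True)
  qed
  have X: "(K * \<alpha>X) ^ card (X_vertices m n \<gamma>) = ?P (\<lambda>a b. if d a b = 4 then K * \<alpha>X else 1)"
  proof -
    have "(d a b = 4 \<and> \<not> ?sh a b \<and> \<not> ?sv a b) = (d a b = 4)" for a b
      using deg by blast
    then show ?thesis
      unfolding X_vertices_def by (subst vert) (simp_all only: zero_neq_numeral not_False_eq_True)
  qed
  have E: "(1 / K) ^ card (edges m n \<gamma>) =
      (\<Prod>b\<in>{1..<n}. if hor \<gamma> 0 b then 1 / K else 1) *
      (\<Prod>a\<in>{1..<m}. if ver \<gamma> a 0 then 1 / K else 1) *
      ?P (\<lambda>a b. (if hor \<gamma> a b \<and> \<not> ?sh a b then 1 / K else 1) * (if ver \<gamma> a b \<and> \<not> ?sv a b then 1 / K else 1))"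
  proof -
    have "(1 / K) ^ card (cells \<gamma> l - through \<gamma> l) =
        (\<Prod>c\<in>{..<len l}. if c \<in> cells \<gamma> l \<and> c \<notin> through \<gamma> l then 1 / K else 1)" for l
    proof -
      have "cells \<gamma> l - through \<gamma> l = {c \<in> {..<len l}. c \<in> cells \<gamma> l \<and> c \<notin> through \<gamma> l}"
        by (auto simp: cells_def)
      then show ?thesis
        by (simp only: power_card_filter[OF finite_lessThan])
    qed
    then have "(1 / K) ^ card (edges m n \<gamma>) = (\<Prod>l\<in>lines m n. \<Prod>c\<in>{..<len l}.
        if c \<in> cells \<gamma> l \<and> c \<notin> through \<gamma> l then 1 / K else 1)"
      unfolding card_edges[OF \<gamma>] power_sum by simp
    also have "\<dots> = (\<Prod>b\<in>{1..<n}. if hor \<gamma> 0 b then 1 / K else 1) *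
      (\<Prod>a\<in>{1..<m}. if ver \<gamma> a 0 then 1 / K else 1) *
      ?P (\<lambda>a b. (if hor \<gamma> a b \<and> \<not> ?sh a b then 1 / K else 1) * (if ver \<gamma> a b \<and> \<not> ?sv a b then 1 / K else 1))"
      unfolding prod_lines_cells using m_pos n_pos
      by (intro arg_cong2[where f = "(*)"] prod.cong refl if_cong)
         (auto simp: cells_horizontal cells_vline through_horizontal through_vline)
    finally show ?thesis .
  qed
  have P: "(\<Prod>e\<in>primary_edges m n \<gamma>. \<pi> (line_of m n e)) =
      (\<Prod>b\<in>{1..<n}. if hor \<gamma> 0 b then \<pi> b else 1) *
      (\<Prod>a\<in>{1..<m}. if ver \<gamma> a 0 then \<pi> (vline a) else 1) *
      ?P (\<lambda>a b. (if hor \<gamma> a b \<and> \<not> hor \<gamma> (a - 1) b then \<pi> b else 1) *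
                (if ver \<gamma> a b \<and> \<not> ver \<gamma> a (b - 1) then \<pi> (vline a) else 1))"
  proof -
    have "(\<Prod>a\<in>{a \<in> cells \<gamma> l. \<not> (1 \<le> a \<and> a - 1 \<in> cells \<gamma> l)}. \<pi> l) =
        (\<Prod>c\<in>{..<len l}. if c \<in> cells \<gamma> l \<and> \<not> (1 \<le> c \<and> c - 1 \<in> cells \<gamma> l) then \<pi> l else 1)" for l
    proof -
      have "{a \<in> cells \<gamma> l. \<not> (1 \<le> a \<and> a - 1 \<in> cells \<gamma> l)} =
          {c \<in> {..<len l}. c \<in> cells \<gamma> l \<and> \<not> (1 \<le> c \<and> c - 1 \<in> cells \<gamma> l)}"
        by (auto simp: cells_def)
      then show ?thesis
        by (simp only: prod.inter_filter[OF finite_lessThan])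
    qed
    then have "(\<Prod>e\<in>primary_edges m n \<gamma>. \<pi> (line_of m n e)) = (\<Prod>l\<in>lines m n. \<Prod>c\<in>{..<len l}.
        if c \<in> cells \<gamma> l \<and> \<not> (1 \<le> c \<and> c - 1 \<in> cells \<gamma> l) then \<pi> l else 1)"
      unfolding prod_primary_edges[OF \<gamma>] by simp
    also have "\<dots> = (\<Prod>b\<in>{1..<n}. if hor \<gamma> 0 b then \<pi> b else 1) *
      (\<Prod>a\<in>{1..<m}. if ver \<gamma> a 0 then \<pi> (vline a) else 1) *
      ?P (\<lambda>a b. (if hor \<gamma> a b \<and> \<not> hor \<gamma> (a - 1) b then \<pi> b else 1) *
                (if ver \<gamma> a b \<and> \<not> ver \<gamma> a (b - 1) then \<pi> (vline a) else 1))"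
      unfolding prod_lines_cells using m_pos n_pos
      by (intro arg_cong2[where f = "(*)"] prod.cong refl if_cong)
         (auto simp: cells_horizontal cells_vline)
    finally show ?thesis .
  qed
  \<comment> \<open>A node that is straight horizontally is crossed by the vertical line, and
    conversely, so the activity of the perpendicular line enters.\<close>
  have C: "(\<Prod>l\<in>lines m n. \<Prod>c\<in>through \<gamma> l. 1 - eps * \<pi> (cross l c)) =
      ?P (\<lambda>a b. (if ?sh a b then 1 - eps * \<pi> (vline a) else 1) * (if ?sv a b then 1 - eps * \<pi> b else 1))"
  proof -
    have "(\<Prod>c\<in>through \<gamma> l. 1 - eps * \<pi> (cross l c)) =
        (\<Prod>c\<in>{..<len l}. if c \<in> through \<gamma> l then 1 - eps * \<pi> (cross l c) else 1)" if "l \<in> lines m n" for l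
    proof -
      have "through \<gamma> l = {c \<in> {..<len l}. c \<in> through \<gamma> l}"
        using through_subset(1)[OF that] by auto
      then show ?thesis
        unfolding prod.inter_filter[OF finite_lessThan, symmetric] by (rule prod.cong[OF _ refl])
    qed
    then have "(\<Prod>l\<in>lines m n. \<Prod>c\<in>through \<gamma> l. 1 - eps * \<pi> (cross l c)) = (\<Prod>l\<in>lines m n. \<Prod>c\<in>{..<len l}.
        if c \<in> through \<gamma> l then 1 - eps * \<pi> (cross l c) else 1)"
      by simp
    also have "\<dots> = ?P (\<lambda>a b. (if ?sh a b then 1 - eps * \<pi> (vline a) else 1) *
        (if ?sv a b then 1 - eps * \<pi> b else 1))"
    proof -
      have "(\<Prod>b\<in>{1..<n}. if 0 \<in> through \<gamma> b then 1 - eps * \<pi> (cross b 0) else 1) = 1"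
        "(\<Prod>a\<in>{1..<m}. if 0 \<in> through \<gamma> (vline a) then 1 - eps * \<pi> (cross (vline a) 0) else 1) = 1"
        by (auto intro!: prod.neutral simp: through_horizontal through_vline)
      moreover have "?P (\<lambda>a b. (if a \<in> through \<gamma> b then 1 - eps * \<pi> (cross b a) else 1) *
            (if b \<in> through \<gamma> (vline a) then 1 - eps * \<pi> (cross (vline a) b) else 1)) =
          ?P (\<lambda>a b. (if ?sh a b then 1 - eps * \<pi> (vline a) else 1) * (if ?sv a b then 1 - eps * \<pi> b else 1))"
        using vline_not_less
        by (intro prod.cong refl arg_cong2[where f = "(*)"]) (auto simp: through_horizontal through_vline cross_def)
      ultimately show ?thesis
        unfolding prod_lines_cells by simp
    qed
    finally show ?thesis .
  qed
  have N: "?P (\<lambda>a b. if (real a, real b) \<in> \<Union>\<gamma> then 1 / (1 - \<alpha> / K * \<pi> b * \<pi> (vline a)) else 1) =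
      ?P (\<lambda>a b. if hor \<gamma> (a - 1) b \<or> hor \<gamma> a b \<or> ver \<gamma> a (b - 1) \<or> ver \<gamma> a b
        then 1 / (1 - \<alpha> / K * \<pi> b * \<pi> (vline a)) else 1)"
    by (intro prod.cong refl if_cong node_in_graph_iff[OF \<gamma>]) auto
  have side: "side_factor B p = (if B then 1 / K else 1) * (if B then p else 1)" for B p
    by (simp add: side_factor_def)
  show ?thesis
    unfolding weight_def prod.case exp_minus_potential[OF \<gamma>] V T X E P C N side node_factor_def Let_def
      d_def straight_hor_def straight_ver_def prod.distrib
    by (simp only: mult_ac)
qed

section \<open>The kernels of the consistent field\<close>

text \<open>Here \<open>p\<close>, \<open>q\<close>, \<open>r\<close>, \<open>s\<close> are the
  colours at the upper left, lower left, upper right and lower right of the node, and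
  \<open>u\<close>, \<open>v\<close> the activities of its horizontal and vertical line. The five
  patterns of equality among \<open>p\<close>, \<open>q\<close>, \<open>r\<close> each lead to a
  defining relation of the parameters.\<close>

lemma node_factor_sum:
  assumes pqr: "p \<in> {1..k}" "q \<in> {1..k}" "r \<in> {1..k}" and D: "0 < 1 - \<alpha> / K * u * v"
  shows "(\<Sum>s\<in>{1..k}. node_factor (p \<noteq> q) (r \<noteq> s) (p \<noteq> r) (q \<noteq> s) u v) = 1 / (1 - \<alpha> / K * u * v)"
proof -
  define D where "D = 1 / (1 - \<alpha> / K * u * v)"
  have K: "K \<noteq> 0" "real k = K + 1"
    using K_ge_1 by auto
  have aT: "2 * \<alpha>T = 1 - (real k - 2) / K * \<alpha>X"
    by (simp add: alpha_T_def)
  have DX: "D * (1 - \<alpha> / K * u * v) = 1"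
    by (rule nonzero_eq_divide_eq[THEN iffD1, OF less_imp_neq[OF D, THEN not_sym] D_def])
  have eps: "eps = \<alpha> / K + (real k - 2) / K * \<alpha>T"
    by (simp add: epsilon_def)
  \<comment> \<open>The closing identities of the cases, with a variable \<open>c\<close> in place
    of \<open>K\<close>, which abbreviates \<open>real k - 1\<close>.\<close>
  have aux1: "1 + c * (a * (1 / c * (1 / c)) * (u * v) * d) = d"
    if "c \<noteq> 0" "d * (1 - a / c * u * v) = 1" for a c d :: real
  proof -
    have "c * (a * (1 / c * (1 / c)) * (u * v) * d) = d - d * (1 - a / c * u * v)"
      using that(1) by (simp add: algebra_simps)
    then show ?thesis
      using that(2) by simp
  qed
  have aux2: "a * (1 / c) * w * d + (1 - (a / c + b / c * t) * w) * d + b * (c * t * (1 / c * (1 / c)) * w * d) = d"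
    if "c \<noteq> 0" for a b c d t w :: real
    using that by (simp add: algebra_simps)
  have aux3: "a * d + c * (c * (1 - a) * (1 / c * (1 / c)) * d) = d" if "c \<noteq> 0" for a c d :: real
    using that by (simp add: field_simps)
  have aux4: "c * t * (1 / c) * d + c * t * (1 / c) * d + b * (c * y * (1 / c * (1 / c)) * d) = (2 * t + b / c * y) * d"
    if "c \<noteq> 0" for b c d t y :: real
    using that by (simp add: algebra_simps)
  let ?g = "\<lambda>s. node_factor (p \<noteq> q) (r \<noteq> s) (p \<noteq> r) (q \<noteq> s) u v"
  have "(\<Sum>s\<in>{1..k}. ?g s) = D"
  proof (cases "p = q")
    case pq: True
    show ?thesis
    proof (cases "p = r")
      case True
      \<comment> \<open>Nothing arrives from the left or from above: the node is either empty or a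
        V-vertex starting two primary edges, for \<open>K\<close> colours. The identity
        \<open>1 + \<alpha> / K * u * v * D = D\<close> is what fixes \<open>D\<close>.\<close>
      have "(\<Sum>s\<in>{1..k}. ?g s) = (\<Sum>s\<in>{1..k}. if s = p then 1 else \<alpha> * (1 / K * (1 / K)) * (u * v) * D)"
        using pq True by (intro sum.cong) (auto simp: node_factor_def D_def)
      also have "\<dots> = 1 + K * (\<alpha> * (1 / K * (1 / K)) * (u * v) * D)"
        using pqr by (subst sum_if_eq) auto
      also have "\<dots> = D"
        by (rule aux1[OF K(1) DX])
      finally show ?thesis .
    next
      case False
      \<comment> \<open>A vertical edge arrives from above and turns, goes straight on, or branches.
        \<open>eps\<close> is the number for which the weights of turning and branching make up for
        the loss \<open>eps * u\<close> in going straight.\<close>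
      have "(\<Sum>s\<in>{1..k}. ?g s) = (\<Sum>s\<in>{1..k}. if s = p then \<alpha> * (1 / K) * u * D
          else if s = r then (1 - eps * u) * D else K * \<alpha>T * (1 / K * (1 / K)) * u * D)"
        using pq False by (intro sum.cong) (auto simp: node_factor_def D_def)
      also have "\<dots> = \<alpha> * (1 / K) * u * D + (1 - eps * u) * D +
          (real k - 2) * (K * \<alpha>T * (1 / K * (1 / K)) * u * D)"
        using pqr False by (subst sum_if_eq_if_eq) auto
      also have "\<dots> = D"
        unfolding eps by (rule aux2[OF K(1)])
      finally show ?thesis .
    qed
  next
    case pq: False
    show ?thesis
    proof (cases "p = r")
      case True
      have "(\<Sum>s\<in>{1..k}. ?g s) = (\<Sum>s\<in>{1..k}. if s = p then \<alpha> * (1 / K) * v * D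
          else if s = q then (1 - eps * v) * D else K * \<alpha>T * (1 / K * (1 / K)) * v * D)"
        using pq True by (intro sum.cong) (auto simp: node_factor_def D_def)
      also have "\<dots> = \<alpha> * (1 / K) * v * D + (1 - eps * v) * D +
          (real k - 2) * (K * \<alpha>T * (1 / K * (1 / K)) * v * D)"
        using pqr pq by (subst sum_if_eq_if_eq) auto
      also have "\<dots> = D"
        unfolding eps by (rule aux2[OF K(1)])
      finally show ?thesis .
    next
      case pr: False
      show ?thesis
      proof (cases "q = r")
        case True
        \<comment> \<open>Two edges arrive, with the same colour on both outer sides: either they
          end in a V-vertex or they cross, the latter for \<open>K\<close> colours. The sum is right
          because \<open>\<alpha> + \<alpha>X = 1\<close>.\<close>
        have "(\<Sum>s\<in>{1..k}. ?g s) = (\<Sum>s\<in>{1..k}. if s = q then \<alpha> * D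
            else K * \<alpha>X * (1 / K * (1 / K)) * D)"
          using pq pr True by (intro sum.cong) (auto simp: node_factor_def D_def)
        also have "\<dots> = \<alpha> * D + K * (K * \<alpha>X * (1 / K * (1 / K)) * D)"
          using pqr by (subst sum_if_eq) auto
        also have "\<dots> = D"
          unfolding alpha_X_def by (rule aux3[OF K(1)])
        finally show ?thesis .
      next
        case False
        \<comment> \<open>Two edges arrive and all three colours differ: one of the edges ends at
          the other, in one of two ways, or they cross, for \<open>k - 2\<close> colours. This gives
          the defining equation of \<open>\<alpha>T\<close>.\<close>
        have "(\<Sum>s\<in>{1..k}. ?g s) = (\<Sum>s\<in>{1..k}. if s = q then K * \<alpha>T * (1 / K) * D
            else if s = r then K * \<alpha>T * (1 / K) * D else K * \<alpha>X * (1 / K * (1 / K)) * D)"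
          using pq pr False by (intro sum.cong) (auto simp: node_factor_def D_def)
        also have "\<dots> = K * \<alpha>T * (1 / K) * D + K * \<alpha>T * (1 / K) * D +
            (real k - 2) * (K * \<alpha>X * (1 / K * (1 / K)) * D)"
          using pqr False by (subst sum_if_eq_if_eq) auto
        also have "\<dots> = (2 * \<alpha>T + (real k - 2) / K * \<alpha>X) * D"
          by (rule aux4[OF K(1)])
        also have "\<dots> = D"
          unfolding aT by simp
        finally show ?thesis .
      qed
    qed
  qed
  then show ?thesis
    by (simp add: D_def)
qed

lemma side_factor_sum:
  assumes "p \<in> {1..k}"
  shows "(\<Sum>s\<in>{1..k}. side_factor (p \<noteq> s) u) = 1 + u"
proof -
  have "(\<Sum>s\<in>{1..k}. side_factor (p \<noteq> s) u) = (\<Sum>s\<in>{1..k}. if s = p then 1 else u / K)"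
    by (intro sum.cong) (auto simp: side_factor_def)
  also have "\<dots> = 1 + K * (u / K)"
    using assms by (subst sum_if_eq) auto
  finally show ?thesis
    using K_ge_1 by simp
qed

text \<open>Each factor of \<open>weight_eq_prod\<close> is assigned to the pixel to the lower right
  of its node or starting point. The first pixel receives none, so its colour is uniform and its
  normaliser is \<open>k\<close>.\<close>

definition cell_kernel :: "nat \<Rightarrow> nat \<Rightarrow> (nat \<Rightarrow> nat) \<Rightarrow> real" where
  "cell_kernel c r x =
    (if c = 0 then
       if r = 0 then 1 else side_factor (x (idx 0 (r - 1)) \<noteq> x (idx 0 r)) (\<pi> r)
     else if r = 0 then side_factor (x (idx (c - 1) 0) \<noteq> x (idx c 0)) (\<pi> (vline c))
     else node_factor (x (idx (c - 1) (r - 1)) \<noteq> x (idx (c - 1) r)) (x (idx c (r - 1)) \<noteq> x (idx c r))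
            (x (idx (c - 1) (r - 1)) \<noteq> x (idx c (r - 1))) (x (idx (c - 1) r) \<noteq> x (idx c r))
            (\<pi> r) (\<pi> (vline c)))"

definition cell_parents :: "nat \<Rightarrow> nat \<Rightarrow> nat set" where
  "cell_parents c r =
    (if c = 0 then if r = 0 then {} else {idx 0 (r - 1)}
     else if r = 0 then {idx (c - 1) 0}
     else {idx (c - 1) (r - 1), idx (c - 1) r, idx c (r - 1)})"

definition cell_norm :: "nat \<Rightarrow> nat \<Rightarrow> real" where
  "cell_norm c r =
    (if c = 0 then if r = 0 then real k else 1 + \<pi> r
     else if r = 0 then 1 + \<pi> (vline c)
     else 1 / (1 - \<alpha> / K * \<pi> r * \<pi> (vline c)))"

definition kernel :: "nat \<Rightarrow> (nat \<Rightarrow> nat) \<Rightarrow> real" where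
  "kernel q = cell_kernel ((q - 1) div n) ((q - 1) mod n)"

definition parents :: "nat \<Rightarrow> nat set" where
  "parents q = cell_parents ((q - 1) div n) ((q - 1) mod n)"

definition norm_const :: "nat \<Rightarrow> real" where
  "norm_const q = cell_norm ((q - 1) div n) ((q - 1) mod n)"

lemma idx_div_mod: "r < n \<Longrightarrow> (idx c r - 1) div n = c" "r < n \<Longrightarrow> (idx c r - 1) mod n = r"
  by (simp_all add: idx_def)

lemma kernel_idx: "r < n \<Longrightarrow> kernel (idx c r) = cell_kernel c r"
  and parents_idx: "r < n \<Longrightarrow> parents (idx c r) = cell_parents c r"
  and norm_const_idx: "r < n \<Longrightarrow> norm_const (idx c r) = cell_norm c r"
  by (simp_all only: kernel_def parents_def norm_const_def idx_div_mod)

lemma side_factor_pos: "l \<in> lines m n \<Longrightarrow> 0 < side_factor B (\<pi> l)"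
  using activity K_ge_1 by (simp add: side_factor_def)

lemma node_factor_nonneg:
  assumes "l \<in> lines m n" "l' \<in> lines m n"
  shows "0 \<le> node_factor W E N S (\<pi> l) (\<pi> l')"
proof -
  have "0 \<le> \<alpha>" "0 \<le> K * \<alpha>T" "0 \<le> K * \<alpha>X" "0 \<le> 1 / K" "0 \<le> \<pi> l" "0 \<le> \<pi> l'"
    "0 \<le> 1 - eps * \<pi> l" "0 \<le> 1 - eps * \<pi> l'" "0 \<le> 1 / (1 - \<alpha> / K * \<pi> l * \<pi> l')"
    using alpha_nonneg K_ge_1 alpha_T_bounds alpha_X_bounds activity[OF assms(1)] activity[OF assms(2)]
      crossing_pos[OF assms(1)] crossing_pos[OF assms(2)] node_pos[OF assms]
    by simp_all
  then show ?thesis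
    unfolding node_factor_def Let_def
    by (intro mult_nonneg_nonneg) (simp_all split: if_split)
qed

text \<open>No vertex sits at such a node, so these factors stay positive even if
  \<open>\<alpha>\<close> is 0 or 1.\<close>

lemma node_factor_straight_pos:
  assumes "l \<in> lines m n" "l' \<in> lines m n"
  shows "0 < node_factor B B False False (\<pi> l) (\<pi> l')" "0 < node_factor False False B B (\<pi> l) (\<pi> l')"
proof -
  have "node_factor B B False False (\<pi> l) (\<pi> l') =
      (if B then (1 - eps * \<pi> l') * (1 / (1 - \<alpha> / K * \<pi> l * \<pi> l')) else 1)"
    "node_factor False False B B (\<pi> l) (\<pi> l') =
      (if B then (1 - eps * \<pi> l) * (1 / (1 - \<alpha> / K * \<pi> l * \<pi> l')) else 1)"
    by (simp_all add: node_factor_def)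
  moreover have "0 < 1 / (1 - \<alpha> / K * \<pi> l * \<pi> l')"
    using node_pos[OF assms] by (rule divide_pos_pos[OF zero_less_one])
  ultimately show "0 < node_factor B B False False (\<pi> l) (\<pi> l')" "0 < node_factor False False B B (\<pi> l) (\<pi> l')"
    using crossing_pos[OF assms(1)] crossing_pos[OF assms(2)] by (auto intro: mult_pos_pos)
qed

lemma cell_kernel_nonneg:
  assumes "c < m" "r < n"
  shows "0 \<le> cell_kernel c r y"
proof -
  have "r \<noteq> 0 \<Longrightarrow> r \<in> lines m n" "c \<noteq> 0 \<Longrightarrow> vline c \<in> lines m n"
    using assms horizontal_in_lines vline_in_lines by auto
  then show ?thesis
    using side_factor_pos node_factor_nonneg by (auto simp: cell_kernel_def less_imp_le)
qed

lemma kernel_nonneg: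
  assumes "q \<in> {1..m * n}"
  shows "0 \<le> kernel q y"
proof -
  obtain c r where "c < m" "r < n" "q = idx c r"
    using idx_cases[OF assms] .
  then show ?thesis
    using cell_kernel_nonneg by (simp add: kernel_idx)
qed

lemma sequential: "sequential_field (m * n) k parents kernel norm_const"
proof
  fix q assume q: "q \<in> {1..m * n}"
  then obtain c r where cr: "c < m" "r < n" "q = idx c r"
    by (rule idx_cases)
  have r: "r - 1 < n"
    using cr by simp
  have rl: "r \<noteq> 0 \<Longrightarrow> r \<in> lines m n" and cl: "c \<noteq> 0 \<Longrightarrow> vline c \<in> lines m n"
    using cr horizontal_in_lines vline_in_lines by auto
  show "parents q \<subseteq> {1..<q}"
  proof -
    have "(c - 1) * n + n = c * n" if "c \<noteq> 0"
      using that by (cases c) auto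
    then show ?thesis
      using cr n_pos unfolding cr(3) parents_idx[OF cr(2)] by (auto simp: cell_parents_def idx_def)
  qed
  show "0 < norm_const q"
    using k_ge_2 rl cl activity node_pos
    unfolding cr(3) norm_const_idx[OF cr(2)] by (auto simp: cell_norm_def add_pos_pos)
  show "kernel q y = kernel q z" if "\<And>i. i \<in> insert q (parents q) \<Longrightarrow> y i = z i" for y z
    using that unfolding cr(3) parents_idx[OF cr(2)] kernel_idx[OF cr(2)]
    by (auto simp: cell_kernel_def cell_parents_def)
  show "(\<Sum>s\<in>{1..k}. kernel q (y(q := s))) = norm_const q" if y: "\<And>i. i \<in> parents q \<Longrightarrow> y i \<in> {1..k}" for y
  proof -
    have ne: "idx c' r' \<noteq> q" if "c' \<noteq> c \<or> r' \<noteq> r" "r' < n" for c' r'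
      using that cr idx_eq_iff by auto
    consider "c = 0" "r = 0" | "c = 0" "r \<noteq> 0" | "c \<noteq> 0" "r = 0" | "c \<noteq> 0" "r \<noteq> 0"
      by blast
    then show ?thesis
    proof cases
      case 1
      then show ?thesis
        unfolding cr(3) kernel_idx[OF cr(2)] norm_const_idx[OF cr(2)]
        by (simp add: cell_kernel_def cell_norm_def)
    next
      case 2
      then have "y (idx 0 (r - 1)) \<in> {1..k}" "idx 0 (r - 1) \<noteq> idx c r"
        using y ne[of 0 "r - 1"] r cr by (auto simp: parents_idx cell_parents_def)
      then show ?thesis
        using 2 side_factor_sum[of "y (idx 0 (r - 1))" "\<pi> r"]
        unfolding cr(3) kernel_idx[OF cr(2)] norm_const_idx[OF cr(2)]
        by (simp add: cell_kernel_def cell_norm_def)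
    next
      case 3
      then have "y (idx (c - 1) 0) \<in> {1..k}" "idx (c - 1) 0 \<noteq> idx c r"
        using y ne[of "c - 1" 0] n_pos cr by (auto simp: parents_idx cell_parents_def)
      then show ?thesis
        using 3 side_factor_sum[of "y (idx (c - 1) 0)" "\<pi> (vline c)"]
        unfolding cr(3) kernel_idx[OF cr(2)] norm_const_idx[OF cr(2)]
        by (simp add: cell_kernel_def cell_norm_def)
    next
      case 4
      then have y': "y (idx (c - 1) (r - 1)) \<in> {1..k}" "y (idx (c - 1) r) \<in> {1..k}" "y (idx c (r - 1)) \<in> {1..k}"
        using y cr by (auto simp: parents_idx cell_parents_def)
      have "idx (c - 1) (r - 1) \<noteq> idx c r" "idx (c - 1) r \<noteq> idx c r" "idx c (r - 1) \<noteq> idx c r"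
        using 4 ne[of "c - 1" "r - 1"] ne[of "c - 1" r] ne[of c "r - 1"] r cr by auto
      then show ?thesis
        using 4 node_factor_sum[OF y' node_pos[OF rl cl]]
        unfolding cr(3) kernel_idx[OF cr(2)] norm_const_idx[OF cr(2)]
        by (simp add: cell_kernel_def cell_norm_def)
    qed
  qed
qed

sublocale sequential_field "m * n" k parents kernel norm_const
  by (rule sequential)

lemma prod_pixels:
  fixes F :: "nat \<Rightarrow> real"
  shows "(\<Prod>q\<in>{1..m * n}. F q) = F (idx 0 0) * (\<Prod>r\<in>{1..<n}. F (idx 0 r)) *
    (\<Prod>c\<in>{1..<m}. F (idx c 0)) * (\<Prod>c\<in>{1..<m}. \<Prod>r\<in>{1..<n}. F (idx c r))"
proof -
  have "bij_betw (\<lambda>(c, r). idx c r) ({..<m} \<times> {..<n}) {1..m * n}"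
    unfolding bij_betw_def
  proof
    show "inj_on (\<lambda>(c, r). idx c r) ({..<m} \<times> {..<n})"
      by (auto simp: inj_on_def idx_eq_iff)
    show "(\<lambda>(c, r). idx c r) ` ({..<m} \<times> {..<n}) = {1..m * n}"
    proof (intro antisym subsetI)
      fix q assume "q \<in> {1..m * n}"
      then show "q \<in> (\<lambda>(c, r). idx c r) ` ({..<m} \<times> {..<n})"
        by (rule idx_cases) (auto simp: image_iff)
    next
      fix q assume "q \<in> (\<lambda>(c, r). idx c r) ` ({..<m} \<times> {..<n})"
      then show "q \<in> {1..m * n}"
        using idx_in by (auto simp del: atLeastAtMost_iff)
    qed
  qed
  from prod.reindex_bij_betw[OF this, of F]
  have "(\<Prod>q\<in>{1..m * n}. F q) = (\<Prod>c\<in>{..<m}. \<Prod>r\<in>{..<n}. F (idx c r))"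
    by (simp add: prod.cartesian_product case_prod_unfold)
  moreover have "{..<m} = insert 0 {1..<m}" "{..<n} = insert 0 {1..<n}"
    using m_pos n_pos by auto
  ultimately show ?thesis
    by (simp add: prod.distrib mult_ac)
qed

text \<open>In \<open>graph_of x\<close> the presence of a segment means a change of colour across
  it, so the local factors of \<open>weight_eq_prod\<close> become the kernels.\<close>

lemma weight_graph_of: "weight m n k \<pi> \<alpha> (graph_of x, \<phi>) = prefix_weight (m * n) x"
proof -
  have 1: "(\<Prod>b\<in>{1..<n}. side_factor (hor (graph_of x) 0 b) (\<pi> b)) = (\<Prod>r\<in>{1..<n}. kernel (idx 0 r) x)"
    using m_pos by (intro prod.cong refl) (simp add: kernel_idx cell_kernel_def hor_graph_of)
  have 2: "(\<Prod>a\<in>{1..<m}. side_factor (ver (graph_of x) a 0) (\<pi> (vline a))) = (\<Prod>c\<in>{1..<m}. kernel (idx c 0) x)"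
    using n_pos by (intro prod.cong refl) (simp add: kernel_idx cell_kernel_def ver_graph_of)
  have 3: "(\<Prod>a\<in>{1..<m}. \<Prod>b\<in>{1..<n}. node_factor (hor (graph_of x) (a - 1) b) (hor (graph_of x) a b)
        (ver (graph_of x) a (b - 1)) (ver (graph_of x) a b) (\<pi> b) (\<pi> (vline a))) =
      (\<Prod>c\<in>{1..<m}. \<Prod>r\<in>{1..<n}. kernel (idx c r) x)"
    by (intro prod.cong refl) (simp add: kernel_idx cell_kernel_def ver_graph_of hor_graph_of less_imp_diff_less)
  have "kernel (idx 0 0) x = 1"
    using n_pos by (simp add: kernel_idx cell_kernel_def)
  then show ?thesis
    unfolding weight_eq_prod[OF graph_of_subset] 1 2 3 prefix_weight_def prod_pixels by simp
qed

lemma weight_admissible: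
  assumes "g \<in> admissible m n k"
  shows "weight m n k \<pi> \<alpha> g = prefix_weight (m * n) (dual m n g)"
proof -
  have "g = (graph_of (dual m n g), snd g)"
    by (rule prod_eqI) (simp_all add: fst_admissible[OF assms])
  then have "weight m n k \<pi> \<alpha> g = weight m n k \<pi> \<alpha> (graph_of (dual m n g), snd g)"
    by (rule arg_cong)
  also have "\<dots> = prefix_weight (m * n) (dual m n g)"
    by (rule weight_graph_of)
  finally show ?thesis .
qed

section \<open>Positivity of the conditioning events\<close>

lemma prefixes_eq_arrays: "prefixes (m * n) = arrays m n k"
  by (simp add: prefixes_def arrays_def)

text \<open>
  An array of positive weight with the prescribed colours is constant on each of the four quadrants
  around the node, so that all other nodes are straight or empty.
\<close>

lemma mass_quadrants_pos:
  assumes c: "c \<in> {1..<m}" and r: "r \<in> {1..<n}" and x: "x \<in> arrays m n k"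
  shows "0 < mass (\<lambda>y. \<forall>i\<in>cell_parents c r. y i = x i)"
proof -
  have in': "idx (c - 1) (r - 1) \<in> {1..m * n}" "idx (c - 1) r \<in> {1..m * n}" "idx c (r - 1) \<in> {1..m * n}"
  proof -
    have "c < m" "c - 1 < m" "r < n" "r - 1 < n"
      using c r by auto
    then show "idx (c - 1) (r - 1) \<in> {1..m * n}" "idx (c - 1) r \<in> {1..m * n}" "idx c (r - 1) \<in> {1..m * n}"
      using idx_in by blast+
  qed
  define p q t where "p = x (idx (c - 1) (r - 1))" and "q = x (idx (c - 1) r)" and "t = x (idx c (r - 1))"
  have pqt: "p \<in> {1..k}" "q \<in> {1..k}" "t \<in> {1..k}"
    using in' x unfolding p_def q_def t_def arrays_def by (auto simp del: atLeastAtMost_iff)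
  have l: "r \<in> lines m n" "vline c \<in> lines m n"
    using c r horizontal_in_lines vline_in_lines by auto
  \<comment> \<open>For \<open>\<alpha>\<close> equal to 0 or 1 a given colour of the lower right
    pixel may have factor 0. As the factors have a positive sum, some colour \<open>s\<close> has a
    positive one.\<close>
  have "0 < (\<Sum>s\<in>{1..k}. node_factor (p \<noteq> q) (t \<noteq> s) (p \<noteq> t) (q \<noteq> s) (\<pi> r) (\<pi> (vline c)))"
    unfolding node_factor_sum[OF pqt node_pos[OF l]] using node_pos[OF l] by simp
  then obtain s where s: "s \<in> {1..k}" "0 < node_factor (p \<noteq> q) (t \<noteq> s) (p \<noteq> t) (q \<noteq> s) (\<pi> r) (\<pi> (vline c))"
    by (meson not_less sum_nonpos)
  define z where "z = (\<lambda>i j. if i < c then if j < r then p else q else if j < r then t else s)"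
  define y where "y = (\<lambda>i\<in>{1..m * n}. z ((i - 1) div n) ((i - 1) mod n))"
  have y: "y (idx i j) = z i j" if "i < m" "j < n" for i j
    using that idx_in[OF that] by (simp add: y_def idx_div_mod[unfolded One_nat_def])
  show ?thesis
  proof (rule mass_pos)
    show "y \<in> prefixes (m * n)"
      using pqt s unfolding prefixes_def y_def z_def by (auto simp: PiE_iff extensional_def)
    show "\<forall>i\<in>cell_parents c r. y i = x i"
      using c r y[of "c - 1" "r - 1"] y[of "c - 1" r] y[of c "r - 1"]
      by (simp add: cell_parents_def z_def p_def q_def t_def less_imp_diff_less)
    fix e assume "e \<in> {1..m * n}"
    then obtain i j where ij: "i < m" "j < n" "e = idx i j"
      by (rule idx_cases)
    have jl: "j \<noteq> 0 \<Longrightarrow> j \<in> lines m n" and il: "i \<noteq> 0 \<Longrightarrow> vline i \<in> lines m n"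
      using ij horizontal_in_lines vline_in_lines by auto
    show "0 < kernel e y"
    proof (cases "i = 0 \<or> j = 0")
      case True
      then show ?thesis
        using jl il side_factor_pos unfolding ij(3) kernel_idx[OF ij(2)] by (auto simp: cell_kernel_def)
    next
      case False
      then have l': "j \<in> lines m n" "vline i \<in> lines m n"
        using jl il by auto
      have k: "kernel e y = node_factor (z (i - 1) (j - 1) \<noteq> z (i - 1) j) (z i (j - 1) \<noteq> z i j)
          (z (i - 1) (j - 1) \<noteq> z i (j - 1)) (z (i - 1) j \<noteq> z i j) (\<pi> j) (\<pi> (vline i))"
        using False ij unfolding ij(3) kernel_idx[OF ij(2)] by (simp add: cell_kernel_def y)
      consider "i \<noteq> c" | "i = c" "j \<noteq> r" | "i = c" "j = r"
        by blast
      then show ?thesis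
      proof cases
        case 1
        then have "z (i - 1) j' = z i j'" for j'
          using False by (auto simp: z_def)
        then show ?thesis
          unfolding k using node_factor_straight_pos(1)[OF l'] by simp
      next
        case 2
        then have "z i' (j - 1) = z i' j" for i'
          using False by (auto simp: z_def)
        then show ?thesis
          unfolding k using node_factor_straight_pos(2)[OF l'] by simp
      next
        case 3
        then show ?thesis
          unfolding k using s(2) c r by (simp add: z_def)
      qed
    qed
  qed (rule kernel_nonneg)
qed

text \<open>The constant array has no segments, so all its kernels are 1.\<close>

lemma mass_at_pos:
  assumes x: "x \<in> arrays m n k" and e: "e \<in> {1..m * n}"
  shows "0 < mass (\<lambda>y. y e = x e)"
proof (rule mass_pos)
  define y where "y = (\<lambda>i\<in>{1..m * n}. x e)"
  have y: "y (idx i j) = x e" if "i < m" "j < n" for i j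
    using idx_in[OF that] by (simp add: y_def)
  show "y \<in> prefixes (m * n)"
    using x e unfolding prefixes_def y_def arrays_def by (auto simp: PiE_iff)
  show "y e = x e"
    using e by (simp add: y_def)
  fix q assume "q \<in> {1..m * n}"
  then obtain i j where "i < m" "j < n" "q = idx i j"
    by (rule idx_cases)
  then show "0 < kernel q y"
    by (simp add: kernel_idx cell_kernel_def y side_factor_def node_factor_def)
qed (rule kernel_nonneg)

lemma mass_True_pos: "0 < mass (\<lambda>_. True)"
  unfolding mass_True using C_pos by (intro prod_pos) auto

lemma mass_parents_pos:
  assumes x: "x \<in> arrays m n k" and q: "q \<in> {1..m * n}"
  shows "0 < mass (\<lambda>y. \<forall>i\<in>parents q. y i = x i)"
proof -
  obtain c r where cr: "c < m" "r < n" "q = idx c r"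
    using idx_cases[OF q] .
  consider "c = 0" "r = 0" | "c = 0" "r \<noteq> 0" | "c \<noteq> 0" "r = 0" | "c \<noteq> 0" "r \<noteq> 0"
    by blast
  then show ?thesis
  proof cases
    case 1
    then show ?thesis
      using mass_True_pos unfolding cr(3) parents_idx[OF cr(2)] by (simp add: cell_parents_def)
  next
    case 2
    then show ?thesis
      using mass_at_pos[OF x idx_in[of 0 "r - 1"]] cr
      unfolding cr(3) parents_idx[OF cr(2)] by (simp add: cell_parents_def)
  next
    case 3
    then show ?thesis
      using mass_at_pos[OF x idx_in[of "c - 1" 0]] cr n_pos
      unfolding cr(3) parents_idx[OF cr(2)] by (simp add: cell_parents_def)
  next
    case 4
    then show ?thesis
      using mass_quadrants_pos[OF _ _ x, of c r] cr
      unfolding cr(3) parents_idx[OF cr(2)] by simp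
  qed
qed

section \<open>Probabilities as normalised masses\<close>

lemma prob_dual:
  assumes field: "consistent_polygonal_field m n k \<pi> \<alpha> M A"
  shows "\<P>(\<omega> in M. Q (dual m n (A \<omega>))) = mass Q / mass (\<lambda>_. True)"
proof -
  note field' = field[unfolded consistent_polygonal_field_def]
  note A = field'[THEN conjunct2, THEN conjunct1]
  have law: "\<P>(\<omega> in M. A \<omega> = g) =
      weight m n k \<pi> \<alpha> g / (\<Sum>h\<in>admissible m n k. weight m n k \<pi> \<alpha> h)"
    if "g \<in> admissible m n k" for g
    by (rule field'[THEN conjunct2, THEN conjunct2, rule_format, OF that])
  interpret prob_space M by (rule field'[THEN conjunct1])
  have fin: "finite (admissible m n k)"
    using bij_betw_finite[OF bij_betw_dual[of k]] finite_prefixes[of "m * n"] by (simp add: prefixes_eq_arrays)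
  have mass: "(\<Sum>g\<in>admissible m n k. of_bool (R (dual m n g)) * weight m n k \<pi> \<alpha> g) = mass R" for R
  proof -
    have "(\<Sum>g\<in>admissible m n k. of_bool (R (dual m n g)) * weight m n k \<pi> \<alpha> g) =
        (\<Sum>g\<in>admissible m n k. of_bool (R (dual m n g)) * prefix_weight (m * n) (dual m n g))"
      by (intro sum.cong) (simp_all add: weight_admissible)
    also have "\<dots> = mass R"
      unfolding mass_def prefixes_eq_arrays
      by (rule sum.reindex_bij_betw[OF bij_betw_dual, of "\<lambda>x. of_bool (R x) * prefix_weight (m * n) x"])
    finally show ?thesis .
  qed
  define G where "G = {g \<in> admissible m n k. Q (dual m n g)}"
  have "A \<omega> \<in> admissible m n k" if "\<omega> \<in> space M" for \<omega>
    using measurable_space[OF A that] by simp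
  \<comment> \<open>The law is prescribed only for single configurations; as there are finitely
    many, the event is a finite disjoint union of the events \<open>A \<omega> = g\<close>.\<close>
  then have "{\<omega> \<in> space M. Q (dual m n (A \<omega>))} = (\<Union>g\<in>G. {\<omega> \<in> space M. A \<omega> = g})"
    by (auto simp: G_def)
  moreover have "{\<omega> \<in> space M. A \<omega> = g} \<in> events" if "g \<in> G" for g
  proof -
    have "A -` {g} \<inter> space M \<in> events"
      using that by (intro measurable_sets[OF A]) (auto simp: G_def)
    moreover have "A -` {g} \<inter> space M = {\<omega> \<in> space M. A \<omega> = g}"
      by auto
    ultimately show ?thesis by simp
  qed
  moreover have "finite G"
    using fin by (simp add: G_def)
  moreover have "disjoint_family_on (\<lambda>g. {\<omega> \<in> space M. A \<omega> = g}) G"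
    by (auto simp: disjoint_family_on_def)
  ultimately have "\<P>(\<omega> in M. Q (dual m n (A \<omega>))) = (\<Sum>g\<in>G. \<P>(\<omega> in M. A \<omega> = g))"
    using finite_measure_finite_Union[of G "\<lambda>g. {\<omega> \<in> space M. A \<omega> = g}"] by (simp add: image_subset_iff)
  also have "\<dots> = (\<Sum>g\<in>G. weight m n k \<pi> \<alpha> g) / (\<Sum>h\<in>admissible m n k. weight m n k \<pi> \<alpha> h)"
    using law by (simp add: G_def sum_divide_distrib)
  also have "(\<Sum>g\<in>G. weight m n k \<pi> \<alpha> g) = mass Q"
    unfolding mass[symmetric] G_def sum.inter_filter[OF fin] by (intro sum.cong) auto
  also have "(\<Sum>h\<in>admissible m n k. weight m n k \<pi> \<alpha> h) = mass (\<lambda>_. True)"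
    unfolding mass[symmetric] by simp
  finally show ?thesis .
qed

text \<open>The normaliser cancels in every conditional probability, so this is
  \<open>mass_single_factorisation\<close>.\<close>

lemma prob_array_factorisation:
  assumes field: "consistent_polygonal_field m n k \<pi> \<alpha> M A" and x: "x \<in> arrays m n k"
    and X: "\<And>i \<omega>. X i \<omega> = dual m n (A \<omega>) i"
  shows "\<P>(\<omega> in M. \<forall>i\<in>{1..m * n}. X i \<omega> = x i) =
    (\<Prod>q\<in>{1..m * n}. \<P>(\<omega> in M. X q \<omega> = x q \<bar> \<forall>i\<in>parents q. X i \<omega> = x i))"
proof -
  note prob = prob_dual[OF field]
  have "\<P>(\<omega> in M. X q \<omega> = x q \<bar> \<forall>i\<in>parents q. X i \<omega> = x i) =
      mass (\<lambda>y. y q = x q \<and> (\<forall>i\<in>parents q. y i = x i)) / mass (\<lambda>y. \<forall>i\<in>parents q. y i = x i)" for q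
    using mass_True_pos prob[of "\<lambda>y. y q = x q \<and> (\<forall>i\<in>parents q. y i = x i)"]
      prob[of "\<lambda>y. \<forall>i\<in>parents q. y i = x i"]
    unfolding cond_prob_def X by simp
  moreover have "\<P>(\<omega> in M. \<forall>i\<in>{1..m * n}. X i \<omega> = x i) =
      mass (\<lambda>y. \<forall>i\<in>{1..m * n}. y i = x i) / mass (\<lambda>_. True)"
    unfolding X by (rule prob)
  ultimately show ?thesis
    using mass_single_factorisation[of x] x mass_parents_pos by (simp only: prefixes_eq_arrays)
qed

section \<open>Translation into column major indices\<close>

lemma prod_shift:
  fixes F :: "nat \<Rightarrow> real"
  shows "(\<Prod>i\<in>{2..N}. F i) = (\<Prod>r\<in>{1..<N}. F (r + 1))"
proof -
  have "{2..N} = {Suc 1..<Suc N}"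
    by auto
  then show ?thesis
    unfolding \<open>{2..N} = _\<close> prod.atLeast_Suc_lessThan_Suc_shift by simp
qed

lemma column_major_factorisation:
  assumes field: "consistent_polygonal_field m n k \<pi> \<alpha> M A" and x: "x \<in> arrays m n k"
    and X: "\<And>i \<omega>. X i \<omega> = dual m n (A \<omega>) i"
  shows "\<P>(\<omega> in M. \<forall>i\<in>{1..m * n}. X i \<omega> = x i) =
          \<P>(\<omega> in M. X 1 \<omega> = x 1) *
          (\<Prod>i\<in>{2..n}. \<P>(\<omega> in M. X i \<omega> = x i \<bar> X (i - 1) \<omega> = x (i - 1))) *
          (\<Prod>i\<in>{1..m - 1}.
             \<P>(\<omega> in M. X (i * n + 1) \<omega> = x (i * n + 1) \<bar>
                       X ((i - 1) * n + 1) \<omega> = x ((i - 1) * n + 1))) *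
          (\<Prod>i\<in>{1..m - 1}. \<Prod>j\<in>{2..n}.
             \<P>(\<omega> in M. X (i * n + j) \<omega> = x (i * n + j) \<bar>
                       X ((i - 1) * n + j - 1) \<omega> = x ((i - 1) * n + j - 1) \<and>
                       X ((i - 1) * n + j) \<omega> = x ((i - 1) * n + j) \<and>
                       X (i * n + j - 1) \<omega> = x (i * n + j - 1)))"
proof -
  have ps: "prob_space M"
    using field unfolding consistent_polygonal_field_def by (rule conjunct1)
  have n0: "0 < n"
    using n_pos by simp
  define P where "P = (\<lambda>q. \<P>(\<omega> in M. X q \<omega> = x q \<bar> \<forall>i\<in>parents q. X i \<omega> = x i))"
  \<comment> \<open>The first pixel has no parents, so its conditioning event is the whole space, of
    probability 1.\<close>
  have 1: "P (idx 0 0) = \<P>(\<omega> in M. X 1 \<omega> = x 1)"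
    unfolding P_def parents_idx[OF n0] cond_prob_def
    using prob_space.prob_space[OF ps] by (simp add: cell_parents_def idx_def)
  have 2: "P (idx 0 r) = \<P>(\<omega> in M. X (r + 1) \<omega> = x (r + 1) \<bar> X (r + 1 - 1) \<omega> = x (r + 1 - 1))"
    if "r \<in> {1..<n}" for r
  proof -
    have "r < n" "r \<noteq> 0"
      using that by auto
    then show ?thesis
      unfolding P_def parents_idx[OF \<open>r < n\<close>] by (simp add: cell_parents_def idx_def)
  qed
  have 3: "P (idx c 0) = \<P>(\<omega> in M. X (c * n + 1) \<omega> = x (c * n + 1) \<bar>
      X ((c - 1) * n + 1) \<omega> = x ((c - 1) * n + 1))" if "c \<in> {1..<m}" for c
    using that unfolding P_def parents_idx[OF n0] by (simp add: cell_parents_def idx_def)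
  \<comment> \<open>Rows are counted from 1 by \<open>j\<close> and from 0 by \<open>r\<close>, so
    \<open>j = r + 1\<close>.\<close>
  have 4: "P (idx c r) = \<P>(\<omega> in M. X (c * n + (r + 1)) \<omega> = x (c * n + (r + 1)) \<bar>
                       X ((c - 1) * n + (r + 1) - 1) \<omega> = x ((c - 1) * n + (r + 1) - 1) \<and>
                       X ((c - 1) * n + (r + 1)) \<omega> = x ((c - 1) * n + (r + 1)) \<and>
                       X (c * n + (r + 1) - 1) \<omega> = x (c * n + (r + 1) - 1))"
    if "c \<in> {1..<m}" "r \<in> {1..<n}" for c r
  proof -
    have "r < n" "r \<noteq> 0" "c \<noteq> 0"
      using that by auto
    then have "cell_parents c r = {(c - 1) * n + (r + 1) - 1, (c - 1) * n + (r + 1), c * n + (r + 1) - 1}"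
      by (simp add: cell_parents_def idx_def)
    then show ?thesis
      unfolding P_def parents_idx[OF \<open>r < n\<close>] by (simp add: idx_def)
  qed
  have m': "{1..m - 1} = {1..<m}"
    using m_pos by auto
  have "\<P>(\<omega> in M. \<forall>i\<in>{1..m * n}. X i \<omega> = x i) = (\<Prod>q\<in>{1..m * n}. P q)"
    unfolding P_def by (rule prob_array_factorisation[OF assms])
  also have "\<dots> = P (idx 0 0) * (\<Prod>r\<in>{1..<n}. P (idx 0 r)) *
    (\<Prod>c\<in>{1..<m}. P (idx c 0)) * (\<Prod>c\<in>{1..<m}. \<Prod>r\<in>{1..<n}. P (idx c r))"
    by (rule prod_pixels)
  finally show ?thesis
    unfolding m' prod_shift by (simp only: 1 2 3 4 cong: prod.cong)
qed

end

text \<open>The clauses on positivity guarantee that all conditional probabilities in the product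
  are genuine: on a null event \<open>cond_prob\<close> would be a division by zero with value 0.
  Bijectivity of \<open>dual\<close> is what allows a probability of arrays to be read as one of
  configurations.\<close>

theorem corollary3:
  fixes m n k :: nat and \<pi> :: "nat \<Rightarrow> real" and \<alpha>\<^sub>V :: real
    and M :: "'w measure" and A :: "'w \<Rightarrow> coloured_graph"
  assumes "m \<ge> 1" and "n \<ge> 1" and "k \<ge> 2"
    and "\<And>l. l \<in> lines m n \<Longrightarrow> 0 < \<pi> l \<and> \<pi> l < 1"
    and "0 \<le> \<alpha>\<^sub>V" and "\<alpha>\<^sub>V \<le> 1"
    and "consistent_polygonal_field m n k \<pi> \<alpha>\<^sub>V M A"
  shows "bij_betw (dual m n) (admissible m n k) (arrays m n k) \<and>
    (\<exists>X :: nat \<Rightarrow> 'w \<Rightarrow> nat.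
      (\<forall>i\<in>{1..m * n}. X i \<in> measurable M (count_space {1..k})) \<and>
      (\<forall>\<omega>\<in>space M. \<forall>i\<in>{1..m * n}. X i \<omega> = dual m n (A \<omega>) i) \<and>
      (\<forall>g\<in>admissible m n k.
        \<P>(\<omega> in M. \<forall>i\<in>{1..m * n}. X i \<omega> = dual m n g i) = \<P>(\<omega> in M. A \<omega> = g)) \<and>
      (\<forall>x\<in>arrays m n k.
        (\<forall>i\<in>{1..m * n}. \<P>(\<omega> in M. X i \<omega> = x i) > 0) \<and>
        (\<forall>i\<in>{1..m - 1}. \<forall>j\<in>{2..n}.
          \<P>(\<omega> in M. X ((i - 1) * n + j - 1) \<omega> = x ((i - 1) * n + j - 1) \<and>
                    X ((i - 1) * n + j) \<omega> = x ((i - 1) * n + j) \<and>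
                    X (i * n + j - 1) \<omega> = x (i * n + j - 1)) > 0) \<and>
        \<P>(\<omega> in M. \<forall>i\<in>{1..m * n}. X i \<omega> = x i) =
          \<P>(\<omega> in M. X 1 \<omega> = x 1) *
          (\<Prod>i\<in>{2..n}. \<P>(\<omega> in M. X i \<omega> = x i \<bar> X (i - 1) \<omega> = x (i - 1))) *
          (\<Prod>i\<in>{1..m - 1}.
             \<P>(\<omega> in M. X (i * n + 1) \<omega> = x (i * n + 1) \<bar>
                       X ((i - 1) * n + 1) \<omega> = x ((i - 1) * n + 1))) *
          (\<Prod>i\<in>{1..m - 1}. \<Prod>j\<in>{2..n}.
             \<P>(\<omega> in M. X (i * n + j) \<omega> = x (i * n + j) \<bar>
                       X ((i - 1) * n + j - 1) \<omega> = x ((i - 1) * n + j - 1) \<and>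
                       X ((i - 1) * n + j) \<omega> = x ((i - 1) * n + j) \<and>
                       X (i * n + j - 1) \<omega> = x (i * n + j - 1)))))"
proof -
  interpret polygonal_field_params m n k \<pi> \<alpha>\<^sub>V
    by unfold_locales (use assms in auto)
  note field = assms(7)
  note prob = prob_dual[OF field]
  have A: "A \<in> measurable M (count_space (admissible m n k))"
    using field unfolding consistent_polygonal_field_def by (elim conjE)
  define X where "X = (\<lambda>i \<omega>. dual m n (A \<omega>) i)"
  have X: "X i \<omega> = dual m n (A \<omega>) i" for i \<omega>
    by (simp add: X_def)
  have dual: "dual m n g \<in> arrays m n k" if "g \<in> admissible m n k" for g
    using bij_betw_apply[OF bij_betw_dual that] .
  have A_space: "A \<omega> \<in> admissible m n k" if "\<omega> \<in> space M" for \<omega>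
    using measurable_space[OF A that] by simp
  have "X i \<in> measurable M (count_space {1..k})" if i: "i \<in> {1..m * n}" for i
    unfolding X_def
    by (rule measurable_compose[OF A]) (use dual i in \<open>auto simp: arrays_def PiE_iff\<close>)
  moreover have "\<P>(\<omega> in M. \<forall>i\<in>{1..m * n}. X i \<omega> = dual m n g i) = \<P>(\<omega> in M. A \<omega> = g)"
    if g: "g \<in> admissible m n k" for g
  proof -
    have "(\<forall>i\<in>{1..m * n}. X i \<omega> = dual m n g i) \<longleftrightarrow> A \<omega> = g" if \<omega>: "\<omega> \<in> space M" for \<omega>
    proof
      assume "\<forall>i\<in>{1..m * n}. X i \<omega> = dual m n g i"
      then have "dual m n (A \<omega>) = dual m n g"
        using dual[OF g] dual[OF A_space[OF \<omega>]] unfolding arrays_def X by (intro PiE_ext) auto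
      then show "A \<omega> = g"
        using bij_betw_imp_inj_on[OF bij_betw_dual] A_space[OF \<omega>] g by (auto dest: inj_onD)
    qed (simp add: X)
    then show ?thesis
      by (intro arg_cong[where f = "measure M"] Collect_cong) auto
  qed
  moreover have "\<P>(\<omega> in M. X i \<omega> = x i) > 0" if "x \<in> arrays m n k" "i \<in> {1..m * n}" for x i
    unfolding X prob[of "\<lambda>y. y i = x i"] using mass_at_pos[OF that] mass_True_pos by simp
  moreover have "\<P>(\<omega> in M. X ((i - 1) * n + j - 1) \<omega> = x ((i - 1) * n + j - 1) \<and>
                    X ((i - 1) * n + j) \<omega> = x ((i - 1) * n + j) \<and>
                    X (i * n + j - 1) \<omega> = x (i * n + j - 1)) > 0"
    if x: "x \<in> arrays m n k" and i: "i \<in> {1..m - 1}" and j: "j \<in> {2..n}" for x i j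
  proof -
    have ij: "i \<in> {1..<m}" "j - 1 \<in> {1..<n}"
      using i j by auto
    have "cell_parents i (j - 1) = {(i - 1) * n + j - 1, (i - 1) * n + j, i * n + j - 1}"
      using i j by (auto simp: cell_parents_def idx_def)
    then have "0 < mass (\<lambda>y. y ((i - 1) * n + j - 1) = x ((i - 1) * n + j - 1) \<and>
        y ((i - 1) * n + j) = x ((i - 1) * n + j) \<and> y (i * n + j - 1) = x (i * n + j - 1))"
      using mass_quadrants_pos[OF ij x] by simp
    then show ?thesis
      unfolding X prob[of "\<lambda>y. y ((i - 1) * n + j - 1) = x ((i - 1) * n + j - 1) \<and>
        y ((i - 1) * n + j) = x ((i - 1) * n + j) \<and> y (i * n + j - 1) = x (i * n + j - 1)"]
      using mass_True_pos by (rule divide_pos_pos)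
  qed
  moreover note column_major_factorisation[OF field _ X]
  ultimately show ?thesis
    using bij_betw_dual X by (intro conjI exI[of _ X] ballI) blast+
qed

end
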